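(* For any $\mu\in\mathcal M^o$ and $t\in[0,\infty)$, there exists a probability measure $\mathbf Q^\mu_{t,\infty}$ on $\mathcal M$ such that $\mathbf Q^\mu_{t,r}$ converges strongly to $\mathbf Q^\mu_{t,\infty}$ as $r\to\infty$.
   Context: Setting. $E$ is a Polish space. For a metric space $F$, $b\mathcal B(F)$, $p\mathcal B(F)$, $bp\mathcal B(F)$ denote the bounded, the non-negative, and the bounded non-negative Borel functions on $F$. $\mathbb R_+=[0,\infty)$. $(\xi_t)_{t\in[0,\zeta)}$ is an $E$-valued Borel right process with (possibly sub-Markovian) transition semigroup $(P_t)_{t\ge0}$ and lifetime $\zeta$; $\Pi_x$ is its law started from $x\in E$. The branching mechanism is $$\psi(x,z)=-\beta(x)z+\sigma(x)^2z^2+\int_{(0,\infty)}(e^{-zu}-1+zu)\,\pi(x,du),\quad x\in E,\ z\ge0,$$ with $\beta,\sigma\in b\mathcal B(E)$ and $\pi$ a kernel from $E$ to $(0,\infty)$ with $\sup_{x\in E}\int_{(0,\infty)}(u\wedge u^2)\pi(x,du)<\infty$. For $f\in bp\mathcal B(E)$, $(t,x)\mapsto V_tf(x)$ is the unique non-negative Borel function on $\mathbb R_+\times E$ that is bounded on $[0,t_0]\times E$ for every $t_0\ge 0$ and satisfies $V_tf(x)+\int_0^t ds\int_E\psi(y,V_{t-s}f(y))P_s(x,dy)=P_tf(x)$ for all $t\ge0,x\in E$. $\mathcal M$ is the Polish space of finite Borel measures on $E$ with the topology of weak convergence, $\mathbf 0$ is the null measure, $\mathcal M^o=\mathcal M\setminus\{\mathbf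 0\}$, and $\gamma(f)=\int f\,d\gamma$. The $(\xi,\psi)$-superprocess $X=(X_t)_{t\ge0}$ is the $\mathcal M$-valued conservative right process with transition semigroup $(Q_t)_{t\ge0}$ determined by $\int_{\mathcal M}e^{-\eta(f)}Q_t(\mu,d\eta)=e^{-\mu(V_tf)}$ for $\mu\in\mathcal M$, $t\ge0$, $f\in bp\mathcal B(E)$. It is realized as the coordinate process on the space $\Omega$ of $\mathcal M$-valued right-continuous functions on $\mathbb R_+$; $\mathcal F_t=\sigma(X_s:s\le t)$, $\mathcal F=\sigma(X_s:s\ge0)$; $\mathrm P_\mu$ is the law (and expectation) of $X$ with $X_0=\mu$. The mean semigroup is $T_tf(x)=\Pi_x[e^{\int_0^t\beta(\xi_s)ds}f(\xi_t)\mathbf 1_{\{t<\zeta\}}]$, and $L_1^+(\nu)$ is the set of $f\in p\mathcal B(E)$ with $\nu(f)<\infty$. Standing assumptions: (i) There are $\lambda\in\mathbb R$, a bounded strictly positive Borel function $\phi$ on $E$ and a probability measure $\nu$ with full support on $E$ such that $\nu(\phi)=1$ and, for all $t\ge0$, $T_t\phi=e^{\lambda t}\phi$ and $\nu T_t=e^{\lambda t}\nu$. (ii) There is a map $(t,x,f)\mapsto H_tf(x)$ from $(0,\infty)\times E\times L_1^+(\nu)$ to $\mathbb R$ with $T_tf(x)=e^{\lambda t}\phi(x)\nu(f)(1+H_tf(x))$ for all $t>0$, $x\in E$, $f\in L_1^+(\nu)$; $\sup_{x\in E,f\in L_1^+(\nu)}|H_tf(x)|<\infty$ for every $t>0$;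 and $\lim_{t\to\infty}\sup_{x\in E,f\in L_1^+(\nu)}|H_tf(x)|=0$. (iii) $\lambda<0$ (subcriticality). (iv) $\mathrm P_\nu(X_t=\mathbf 0)>0$ for all $t>0$. For $\mu\in\mathcal M^o$ and $t,r\ge0$, $\mathbf Q^\mu_{t,r}(A):=\mathrm P_\mu(X_t\in A\mid X_{t+r}\ne\mathbf 0)$ for Borel $A\subset\mathcal M$. Strong convergence (setwise convergence): probability measures $\mu_n$ on a measurable space converge strongly to a probability measure $\mu$ if $\mu_n(f)\to\mu(f)$ for every bounded measurable function $f$. *)

theory Defs
  imports "HOL-Probability.Probability"
begin

section \<open>Finite Borel measures with the topology of weak convergence\<close>

typedef (overloaded) 'a fin_measure =
    "{M :: 'a::topological_space measure. sets M = sets borel \<and> finite_measure M}"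
  morphisms as_measure Fin_measure
  by (rule exI[of _ "null_measure borel"]) (auto intro!: finite_measureI)

definition integ :: "'a::topological_space fin_measure \<Rightarrow> ('a \<Rightarrow> real) \<Rightarrow> real" where
  "integ \<mu> f = (\<integral>x. f x \<partial>as_measure \<mu>)"

instantiation fin_measure :: (topological_space) topological_space
begin

text \<open>The topology of weak convergence is the coarsest one making \<open>\<mu> \<mapsto> \<mu>(f)\<close>
  continuous for every bounded continuous \<open>f\<close>.\<close>

definition open_fin_measure :: "'a fin_measure set \<Rightarrow> bool" where
  "open_fin_measure = generate_topology
     {{\<mu>. integ \<mu> f \<in> U} | f U. continuous_on UNIV f \<and> bounded (range f) \<and> open U}"

instance
  by standard (auto simp: open_fin_measure_def intro: generate_topology.intros)

end

instantiation fin_measure :: (topological_space) zero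
begin

definition zero_fin_measure :: "'a fin_measure" where
  "0 = Fin_measure (null_measure borel)"

instance ..

end


section \<open>Classes of Borel functions\<close>

definition nonneg_borel :: "('a::topological_space \<Rightarrow> real) set" where
  "nonneg_borel = {f \<in> borel_measurable borel. \<forall>x. 0 \<le> f x}"

definition bdd_borel :: "('a::topological_space \<Rightarrow> real) set" where
  "bdd_borel = {f \<in> borel_measurable borel. bounded (range f)}"

definition L1_plus :: "'a::topological_space fin_measure \<Rightarrow> ('a \<Rightarrow> real) set" where
  "L1_plus \<nu> = {f \<in> nonneg_borel. (\<integral>\<^sup>+x. ennreal (f x) \<partial>as_measure \<nu>) < \<infinity>}"

definition universally_measurable :: "('a::topological_space \<Rightarrow> ennreal) \<Rightarrow> bool" where
  "universally_measurable f \<longleftrightarrow>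
     (\<forall>M. sets M = sets borel \<and> finite_measure M \<longrightarrow> f \<in> borel_measurable (completion M))"


section \<open>Borel right processes\<close>

definition borel_semigroup :: "(real \<Rightarrow> 's::topological_space \<Rightarrow> 's measure) \<Rightarrow> bool" where
  "borel_semigroup P \<longleftrightarrow>
     (\<forall>t\<ge>0. P t \<in> borel \<rightarrow>\<^sub>M subprob_algebra borel) \<and>
     (\<forall>x. P 0 x = return borel x) \<and>
     (\<forall>s\<ge>0. \<forall>t\<ge>0. \<forall>x. P (s + t) x = P s x \<bind> P t)"

definition excessive ::
  "(real \<Rightarrow> 's::topological_space \<Rightarrow> 's measure) \<Rightarrow> real \<Rightarrow> ('s \<Rightarrow> ennreal) \<Rightarrow> bool" where
  "excessive P \<alpha> f \<longleftrightarrow> universally_measurable f \<and>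
     (\<forall>t\<ge>0. \<forall>x. ennreal (exp (- \<alpha> * t)) * (\<integral>\<^sup>+y. f y \<partial>completion (P t x)) \<le> f x) \<and>
     (\<forall>x. ((\<lambda>t. ennreal (exp (- \<alpha> * t)) * (\<integral>\<^sup>+y. f y \<partial>completion (P t x))) \<longlongrightarrow> f x)
        (at_right 0))"

text \<open>A process \<open>(\<xi>\<^sub>t)\<close> on the measurable space \<open>W\<close> lives on \<open>[0,\<zeta>)\<close>: the value \<open>\<xi> t \<omega>\<close> is
  meaningful only for \<open>0 \<le> t < \<zeta> \<omega>\<close>, and for \<open>t \<ge> \<zeta> \<omega>\<close> the process is thought of as sitting at an
  isolated cemetery, where all functions on the state space are put equal to 0.  The set
  \<open>proc_event W \<xi> \<zeta> t B\<close> is the event that \<open>t < \<zeta>\<close> and \<open>\<xi>\<^sub>t \<in> B\<close>.\<close>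

definition proc_event ::
  "'w measure \<Rightarrow> (real \<Rightarrow> 'w \<Rightarrow> 's) \<Rightarrow> ('w \<Rightarrow> ereal) \<Rightarrow> real \<Rightarrow> 's set \<Rightarrow> 'w set" where
  "proc_event W \<xi> \<zeta> t B = {\<omega> \<in> space W. ereal t < \<zeta> \<omega> \<and> \<xi> t \<omega> \<in> B}"

definition natural_filtration ::
  "'w measure \<Rightarrow> (real \<Rightarrow> 'w \<Rightarrow> 's::topological_space) \<Rightarrow> ('w \<Rightarrow> ereal) \<Rightarrow> real \<Rightarrow> 'w measure" where
  "natural_filtration W \<xi> \<zeta> s =
     sigma (space W) {proc_event W \<xi> \<zeta> r B | r B. 0 \<le> r \<and> r \<le> s \<and> B \<in> sets borel}"

text \<open>Right process in the sense of Sharpe (\<open>General Theory of Markov Processes\<close>): a normal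
  right-continuous Markov process with semigroup \<open>P\<close> such that, for each \<open>\<alpha> > 0\<close>, every
  \<open>\<alpha>\<close>-excessive function is almost surely right-continuous along the paths, under every
  initial law \<open>m\<close> (last clause, where \<open>m \<bind> Law\<close> is the law of the process started from \<open>m\<close>).
  It is Borel because \<open>P\<close> is a semigroup of Borel kernels.\<close>

definition borel_right_process ::
  "'w measure \<Rightarrow> (real \<Rightarrow> 'w \<Rightarrow> 's::topological_space) \<Rightarrow> ('w \<Rightarrow> ereal) \<Rightarrow> ('s \<Rightarrow> 'w measure) \<Rightarrow>
   (real \<Rightarrow> 's \<Rightarrow> 's measure) \<Rightarrow> bool" where
  "borel_right_process W \<xi> \<zeta> Law P \<longleftrightarrow>
     borel_semigroup P \<and>
     Law \<in> borel \<rightarrow>\<^sub>M prob_algebra W \<and>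
     (\<forall>t\<ge>0. \<forall>B\<in>sets borel. proc_event W \<xi> \<zeta> t B \<in> sets W) \<and>
     (\<forall>\<omega>\<in>space W. \<forall>t\<ge>0. ereal t < \<zeta> \<omega> \<longrightarrow> continuous (at_right t) (\<lambda>s. \<xi> s \<omega>)) \<and>
     (\<forall>x. AE \<omega> in Law x. 0 < \<zeta> \<omega> \<and> \<xi> 0 \<omega> = x) \<and>
     (\<forall>s\<ge>0. \<forall>t\<ge>0. \<forall>x. \<forall>A\<in>sets (natural_filtration W \<xi> \<zeta> s). \<forall>B\<in>sets borel.
        emeasure (Law x) (A \<inter> proc_event W \<xi> \<zeta> (s + t) B) =
        (\<integral>\<^sup>+\<omega>. emeasure (P t (\<xi> s \<omega>)) B * indicator (A \<inter> proc_event W \<xi> \<zeta> s UNIV) \<omega> \<partial>Law x)) \<and>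
     (\<forall>\<alpha>>0. \<forall>f. excessive P \<alpha> f \<longrightarrow>
        (\<forall>m. sets m = sets borel \<and> prob_space m \<longrightarrow>
          (AE \<omega> in m \<bind> Law. \<forall>t\<ge>0. ereal t < \<zeta> \<omega> \<longrightarrow> continuous (at_right t) (\<lambda>s. f (\<xi> s \<omega>)))))"


section \<open>Branching mechanism, cumulant semigroup and superprocess\<close>

definition branching_data ::
  "('e::topological_space \<Rightarrow> real) \<Rightarrow> ('e \<Rightarrow> real) \<Rightarrow> ('e \<Rightarrow> real measure) \<Rightarrow> bool" where
  "branching_data \<beta> \<sigma> \<pi> \<longleftrightarrow> \<beta> \<in> bdd_borel \<and> \<sigma> \<in> bdd_borel \<and>
     (\<forall>x. sets (\<pi> x) = sets (restrict_space borel {0<..})) \<and>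
     (\<forall>B\<in>sets (restrict_space borel {0<..}). (\<lambda>x. emeasure (\<pi> x) B) \<in> borel_measurable borel) \<and>
     (SUP x. \<integral>\<^sup>+u. ennreal (min u (u\<^sup>2)) \<partial>\<pi> x) < \<infinity>"

definition branching_mechanism ::
  "('e \<Rightarrow> real) \<Rightarrow> ('e \<Rightarrow> real) \<Rightarrow> ('e \<Rightarrow> real measure) \<Rightarrow> 'e \<Rightarrow> real \<Rightarrow> real" where
  "branching_mechanism \<beta> \<sigma> \<pi> x z =
     - \<beta> x * z + (\<sigma> x)\<^sup>2 * z\<^sup>2 + (\<integral>u. (exp (- z * u) - 1 + z * u) \<partial>\<pi> x)"

definition cumulant_solution ::
  "(real \<Rightarrow> 'e::topological_space \<Rightarrow> 'e measure) \<Rightarrow> ('e \<Rightarrow> real \<Rightarrow> real) \<Rightarrow> ('e \<Rightarrow> real) \<Rightarrow>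
   (real \<Rightarrow> 'e \<Rightarrow> real) \<Rightarrow> bool" where
  "cumulant_solution P \<psi> f v \<longleftrightarrow>
     (\<lambda>(t, x). v t x) \<in> borel_measurable (restrict_space borel ({0..} \<times> UNIV)) \<and>
     (\<forall>t\<ge>0. \<forall>x. 0 \<le> v t x) \<and>
     (\<forall>t0\<ge>0. bounded ((\<lambda>(t, x). v t x) ` ({0..t0} \<times> UNIV))) \<and>
     (\<forall>t\<ge>0. \<forall>x. v t x + (LINT s:{0..t}|lborel. \<integral>y. \<psi> y (v (t - s) y) \<partial>P s x)
        = (\<integral>y. f y \<partial>P t x))"

definition cumulant_semigroup ::
  "(real \<Rightarrow> 'e::topological_space \<Rightarrow> 'e measure) \<Rightarrow> ('e \<Rightarrow> real \<Rightarrow> real) \<Rightarrow>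
   (real \<Rightarrow> ('e \<Rightarrow> real) \<Rightarrow> 'e \<Rightarrow> real) \<Rightarrow> bool" where
  "cumulant_semigroup P \<psi> V \<longleftrightarrow>
     (\<forall>f\<in>bdd_borel \<inter> nonneg_borel.
        cumulant_solution P \<psi> f (\<lambda>t. V t f) \<and>
        (\<forall>v. cumulant_solution P \<psi> f v \<longrightarrow> (\<forall>t\<ge>0. \<forall>x. v t x = V t f x)))"

text \<open>The space of right-continuous paths \<open>[0,\<infinity>) \<rightarrow> S\<close> with the \<open>\<sigma>\<close>-algebra generated by
  the coordinates.  Paths are elements of the product space over \<open>{0..}\<close>, hence extensional:
  the (irrelevant) value at negative times is \<open>undefined\<close>.\<close>

definition path_space :: "(real \<Rightarrow> 's::topological_space) measure" where
  "path_space = restrict_space (PiM {0..} (\<lambda>_. borel))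
     {\<omega>. \<forall>t\<ge>0. continuous (at_right t) \<omega>}"

text \<open>Laws \<open>\<mu> \<mapsto> Pr \<mu>\<close>, on path space, of the superprocess with transition semigroup \<open>Q\<close> and
  Laplace functionals given by \<open>V\<close>.  The process is conservative, so its lifetime is \<open>\<infinity>\<close>.\<close>

definition superprocess ::
  "(real \<Rightarrow> ('e::topological_space \<Rightarrow> real) \<Rightarrow> 'e \<Rightarrow> real) \<Rightarrow>
   (real \<Rightarrow> 'e fin_measure \<Rightarrow> 'e fin_measure measure) \<Rightarrow>
   ('e fin_measure \<Rightarrow> (real \<Rightarrow> 'e fin_measure) measure) \<Rightarrow> bool" where
  "superprocess V Q Pr \<longleftrightarrow>
     borel_right_process path_space (\<lambda>t \<omega>. \<omega> t) (\<lambda>_. \<infinity>) Pr Q \<and>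
     (\<forall>\<mu>. \<forall>t\<ge>0. \<forall>f\<in>bdd_borel \<inter> nonneg_borel.
        (\<integral>\<eta>. exp (- integ \<eta> f) \<partial>Q t \<mu>) = exp (- integ \<mu> (V t f)))"


section \<open>Mean semigroup and the standing assumptions on it\<close>

definition mean_semigroup ::
  "(real \<Rightarrow> 'w \<Rightarrow> 'e) \<Rightarrow> ('w \<Rightarrow> ereal) \<Rightarrow> ('e \<Rightarrow> 'w measure) \<Rightarrow> ('e \<Rightarrow> real) \<Rightarrow>
   real \<Rightarrow> ('e \<Rightarrow> real) \<Rightarrow> 'e \<Rightarrow> ennreal" where
  "mean_semigroup \<xi> \<zeta> Law \<beta> t f x =
     (\<integral>\<^sup>+\<omega>. ennreal (exp (LINT s:{0..t}|lborel. \<beta> (\<xi> s \<omega>)) * f (\<xi> t \<omega>))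
        * indicator {\<omega>. ereal t < \<zeta> \<omega>} \<omega> \<partial>Law x)"

definition principal_eigen ::
  "(real \<Rightarrow> ('e::topological_space \<Rightarrow> real) \<Rightarrow> 'e \<Rightarrow> ennreal) \<Rightarrow> real \<Rightarrow> ('e \<Rightarrow> real) \<Rightarrow>
   'e fin_measure \<Rightarrow> bool" where
  "principal_eigen T lam \<phi> \<nu> \<longleftrightarrow>
     \<phi> \<in> bdd_borel \<and> (\<forall>x. 0 < \<phi> x) \<and>
     prob_space (as_measure \<nu>) \<and>
     (\<forall>U. open U \<and> U \<noteq> {} \<longrightarrow> 0 < emeasure (as_measure \<nu>) U) \<and>
     integ \<nu> \<phi> = 1 \<and>
     (\<forall>t\<ge>0. \<forall>x. T t \<phi> x = ennreal (exp (lam * t) * \<phi> x)) \<and>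
     (\<forall>t\<ge>0. \<forall>f\<in>nonneg_borel. (\<integral>\<^sup>+x. T t f x \<partial>as_measure \<nu>)
        = ennreal (exp (lam * t)) * (\<integral>\<^sup>+x. ennreal (f x) \<partial>as_measure \<nu>))"

text \<open>The first clause is stated in the extended reals because \<open>ennreal\<close> would truncate a
  negative right-hand side to 0.\<close>

definition uniform_mean_asymptotics ::
  "(real \<Rightarrow> ('e::topological_space \<Rightarrow> real) \<Rightarrow> 'e \<Rightarrow> ennreal) \<Rightarrow> real \<Rightarrow> ('e \<Rightarrow> real) \<Rightarrow>
   'e fin_measure \<Rightarrow> bool" where
  "uniform_mean_asymptotics T lam \<phi> \<nu> \<longleftrightarrow>
     (\<exists>H :: real \<Rightarrow> ('e \<Rightarrow> real) \<Rightarrow> 'e \<Rightarrow> real.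
        (\<forall>t>0. \<forall>x. \<forall>f\<in>L1_plus \<nu>.
           enn2ereal (T t f x) = ereal (exp (lam * t) * \<phi> x * integ \<nu> f * (1 + H t f x))) \<and>
        (\<forall>t>0. (SUP x. SUP f\<in>L1_plus \<nu>. ennreal \<bar>H t f x\<bar>) < \<infinity>) \<and>
        ((\<lambda>t. SUP x. SUP f\<in>L1_plus \<nu>. ennreal \<bar>H t f x\<bar>) \<longlongrightarrow> 0) at_top)"


section \<open>Conditional laws and strong convergence\<close>

text \<open>The law of \<open>X\<^sub>t\<close> under \<open>P\<^sub>\<mu>\<close> conditioned on \<open>X\<^sub>t\<^sub>+\<^sub>r \<noteq> 0\<close>.\<close>

definition cond_law ::
  "('e::topological_space fin_measure \<Rightarrow> (real \<Rightarrow> 'e fin_measure) measure) \<Rightarrow>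
   'e fin_measure \<Rightarrow> real \<Rightarrow> real \<Rightarrow> 'e fin_measure measure" where
  "cond_law Pr \<mu> t r =
     distr (uniform_measure (Pr \<mu>) {\<omega> \<in> space (Pr \<mu>). \<omega> (t + r) \<noteq> 0}) borel (\<lambda>\<omega>. \<omega> t)"

definition strongly_converges ::
  "('i \<Rightarrow> 'a measure) \<Rightarrow> 'a measure \<Rightarrow> 'i filter \<Rightarrow> bool" where
  "strongly_converges N L F \<longleftrightarrow>
     (\<forall>f :: 'a \<Rightarrow> real. f \<in> borel_measurable L \<and> bounded (f ` space L) \<longrightarrow>
        ((\<lambda>i. \<integral>x. f x \<partial>N i) \<longlongrightarrow> (\<integral>x. f x \<partial>L)) F)"

end

theory Submission
  imports Defs
begin

text \<open>
  The limit is the transform of the law of \<open>X\<^sub>t\<close> by \<open>\<eta> \<mapsto> \<eta>(\<phi>)\<close>: with \<open>Q\<close> the transition semigroup of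
  the superprocess, it has density \<open>\<eta>(\<phi>) / (exp (\<lambda> t) \<mu>(\<phi>))\<close> with respect to \<open>Q\<^sub>t(\<mu>, \<cdot>)\<close>.  By the
  Markov property the conditional law has density \<open>S\<^sub>r(\<eta>) / S\<^sub>t\<^sub>+\<^sub>r(\<mu>)\<close> with respect to \<open>Q\<^sub>t(\<mu>, \<cdot>)\<close>,
  where \<open>S\<^sub>r(\<eta>) = 1 - exp (- \<eta>(v\<^sub>r))\<close> is the probability of survival up to time \<open>r\<close> from \<open>\<eta>\<close> and
  \<open>v\<^sub>r\<close> is the limit of \<open>V\<^sub>r n\<close> as \<open>n \<rightarrow> \<infinity>\<close>.  So it suffices that \<open>S\<^sub>r(\<eta>) / \<nu>(v\<^sub>r)\<close> tends to \<open>\<eta>(\<phi>)\<close>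
  (\<open>survival_asymptotics\<close>) and is dominated by a multiple of \<open>\<eta>(\<phi>)\<close> (\<open>survival_dominated\<close>); dominated
  convergence, applied to the numerator and to \<open>S\<^sub>t\<^sub>+\<^sub>r(\<mu>) = Q\<^sub>t S\<^sub>r(\<mu>)\<close>, gives strong convergence.

  The bridge from the branching mechanism to these estimates is the mean formula
  \<open>\<integral> \<eta>(f) Q\<^sub>t(\<mu>, d\<eta>) = \<mu>(T\<^sub>t f)\<close> (\<open>mean_formula\<close>).  The rescaled cumulants \<open>n V\<^sub>t(f/n)\<close> are bounded
  uniformly in \<open>n\<close> and converge to the left-hand side with \<open>\<mu>\<close> a Dirac mass; the non-linear part of
  the cumulant equation disappears in the limit, and what remains is a linear equation, whose
  bounded solution is \<open>T\<^sub>t f\<close> by the Feynman-Kac formula (\<open>feynman_kac\<close>).  The remaining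
  estimates follow from this formula and the branching property.

  Jensen's inequality gives \<open>V\<^sub>s f \<le> T\<^sub>s f\<close>, and for \<open>f \<le> \<epsilon> \<phi>\<close> the difference of \<open>\<mu>(T\<^sub>s f)\<close> and
  \<open>\<mu>(V\<^sub>s f)\<close> is \<open>o(\<epsilon>)\<close>, because \<open>X\<^sub>s(\<phi>)\<close> is integrable.  The uniform asymptotics of the mean yield
  \<open>v\<^sub>r \<le> C \<nu>(v\<^sub>r\<^sub>-\<^sub>1) \<phi>\<close>; hence \<open>v\<^sub>r\<^sub>+\<^sub>s = V\<^sub>s v\<^sub>r\<close> equals \<open>T\<^sub>s v\<^sub>r\<close> up to \<open>o(\<nu>(v\<^sub>r\<^sub>-\<^sub>1))\<close>, and
  \<open>T\<^sub>s v\<^sub>r\<close> is close to \<open>exp (\<lambda> s) \<nu>(v\<^sub>r) \<phi>\<close> for large \<open>s\<close>.  It remains to replace \<open>\<nu>(v\<^sub>r\<^sub>-\<^sub>1)\<close> by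
  \<open>\<nu>(v\<^sub>r)\<close>, that is, to exclude that \<open>\<nu>(v\<^sub>r)\<close> decays faster than geometrically (\<open>w_ratio\<close>).
\<close>

section \<open>Integrals against finite Borel measures\<close>

text \<open>The bounded non-negative Borel functions.\<close>

abbreviation bp_borel :: "('a::topological_space \<Rightarrow> real) set" where
  "bp_borel \<equiv> bdd_borel \<inter> nonneg_borel"

lemma sets_as_measure [simp, measurable_cong]: "sets (as_measure \<mu>) = sets borel"
  using as_measure[of \<mu>] by simp

lemma space_as_measure [simp]: "space (as_measure \<mu>) = UNIV"
  using sets_eq_imp_space_eq[OF sets_as_measure[of \<mu>]] by simp

lemma finite_as_measure: "finite_measure (as_measure \<mu>)"
  using as_measure[of \<mu>] by simp

lemma bdd_borel_measurable [measurable_dest]: "f \<in> bdd_borel \<Longrightarrow> f \<in> borel_measurable borel"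
  by (simp add: bdd_borel_def)

lemma nonneg_borel_measurable [measurable_dest]: "f \<in> nonneg_borel \<Longrightarrow> f \<in> borel_measurable borel"
  by (simp add: nonneg_borel_def)

lemma nonneg_borel_nonneg: "f \<in> nonneg_borel \<Longrightarrow> 0 \<le> f x"
  by (simp add: nonneg_borel_def)

lemma bdd_borel_bound:
  assumes "f \<in> bdd_borel"
  obtains K where "K > 0" "\<And>x. \<bar>f x\<bar> \<le> K"
proof -
  obtain K where "\<forall>y\<in>range f. norm y \<le> K"
    using assms by (auto simp: bdd_borel_def bounded_iff)
  then show thesis
    by (intro that[of "max K 1"]) (auto simp: le_max_iff_disj)
qed

lemma bdd_borelI: "f \<in> borel_measurable borel \<Longrightarrow> (\<And>x. \<bar>f x\<bar> \<le> K) \<Longrightarrow> f \<in> bdd_borel"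
  by (auto simp: bdd_borel_def bounded_iff)

lemma bp_borelI:
  "f \<in> borel_measurable borel \<Longrightarrow> (\<And>x. 0 \<le> f x) \<Longrightarrow> (\<And>x. f x \<le> K) \<Longrightarrow> f \<in> bp_borel"
  by (auto simp: nonneg_borel_def intro!: bdd_borelI[of _ K])

lemma integrable_integ: "f \<in> bdd_borel \<Longrightarrow> integrable (as_measure \<mu>) f"
proof -
  assume f: "f \<in> bdd_borel"
  interpret finite_measure "as_measure \<mu>" by (rule finite_as_measure)
  obtain K where "\<And>x. \<bar>f x\<bar> \<le> K" using bdd_borel_bound[OF f] by blast
  with f show ?thesis by (intro integrable_const_bound[of _ K]) auto
qed

lemma integ_nonneg: "f \<in> nonneg_borel \<Longrightarrow> 0 \<le> integ \<mu> f"
  by (simp add: integ_def nonneg_borel_nonneg)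

lemma integ_mono:
  "f \<in> bdd_borel \<Longrightarrow> g \<in> bdd_borel \<Longrightarrow> (\<And>x. f x \<le> g x) \<Longrightarrow> integ \<mu> f \<le> integ \<mu> g"
  unfolding integ_def by (intro integral_mono integrable_integ)

lemma integ_cmult: "integ \<mu> (\<lambda>x. c * f x) = c * integ \<mu> f"
  by (simp add: integ_def)

lemma cmult_bp_borel: "f \<in> bp_borel \<Longrightarrow> 0 \<le> c \<Longrightarrow> (\<lambda>x. c * f x) \<in> bp_borel"
proof -
  assume f: "f \<in> bp_borel" and c: "0 \<le> c"
  then obtain K where K: "\<And>x. \<bar>f x\<bar> \<le> K" using bdd_borel_bound by blast
  show ?thesis
    using f c abs_le_D1[OF K]
    by (intro bp_borelI[of _ "c * K"]) (auto intro!: mult_left_mono simp: nonneg_borel_nonneg)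
qed

lemma const_bp_borel: "0 \<le> c \<Longrightarrow> (\<lambda>_. c) \<in> bp_borel"
  by (intro bp_borelI[of _ c]) auto

lemma integ_eq_nn_integral:
  assumes "f \<in> bp_borel"
  shows "(\<integral>\<^sup>+x. ennreal (f x) \<partial>as_measure \<mu>) = ennreal (integ \<mu> f)"
  unfolding integ_def using assms
  by (intro nn_integral_eq_integral integrable_integ) (auto simp: nonneg_borel_nonneg)

lemma measurable_integ_continuous:
  assumes "continuous_on UNIV f" "bounded (range f)"
  shows "(\<lambda>\<mu>. integ \<mu> f) \<in> borel_measurable borel"
proof (rule borel_measurableI)
  fix U :: "real set" assume "open U"
  then have "open {\<mu>. integ \<mu> f \<in> U}"
    unfolding open_fin_measure_def using assms
    by (intro generate_topology.Basis) blast
  then show "(\<lambda>\<mu>. integ \<mu> f) -` U \<inter> space borel \<in> sets borel"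
    by (simp add: vimage_def)
qed

lemma measurable_emeasure_as_measure:
  fixes B :: "'a::metric_space set"
  assumes "B \<in> sets borel"
  shows "(\<lambda>\<mu>. emeasure (as_measure \<mu>) B) \<in> borel_measurable borel"
proof -
  have closed: "(\<lambda>\<mu>. emeasure (as_measure \<mu>) C) \<in> borel_measurable borel"
    if C: "closed C" for C :: "'a set"
  proof (cases "C = {}")
    case False
    define f where "f n x = max 0 (1 - real n * infdist x C)" for n :: nat and x :: 'a
    have f_meas: "f n \<in> borel_measurable borel" for n
      unfolding f_def by (intro borel_measurable_continuous_onI continuous_intros)
    have f_bd: "\<bar>f n x\<bar> \<le> 1" for n x
      by (simp add: f_def infdist_nonneg)
    have integ_meas: "(\<lambda>\<mu>. integ \<mu> (f n)) \<in> borel_measurable borel" for n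
    proof (rule measurable_integ_continuous)
      show "continuous_on UNIV (f n)" unfolding f_def by (intro continuous_intros)
      show "bounded (range (f n))" using f_bd[of n] by (auto simp: bounded_iff)
    qed
    have integ_lim: "(\<lambda>n. integ \<mu> (f n)) \<longlonglongrightarrow> measure (as_measure \<mu>) C" for \<mu>
    proof -
      interpret finite_measure "as_measure \<mu>" by (rule finite_as_measure)
      have "(\<lambda>n. f n x) \<longlonglongrightarrow> indicator C x" for x
      proof (cases "x \<in> C")
        case False
        then have pos: "infdist x C > 0"
          using C \<open>C \<noteq> {}\<close> by (metis infdist_pos_not_in_closed)
        then have "eventually (\<lambda>n. f n x = 0) sequentially"
        proof -
          obtain N :: nat where N: "1 / infdist x C < real N" using reals_Archimedean2 by blast
          have "f n x = 0" if "n \<ge> N" for n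
          proof -
            have "1 / infdist x C < real n" using N that by linarith
            then have "1 < real n * infdist x C" using pos by (simp add: divide_less_eq)
            then show ?thesis by (simp add: f_def)
          qed
          then show ?thesis by (auto simp: eventually_sequentially)
        qed
        with False show ?thesis by (simp add: tendsto_eventually)
      qed (simp add: f_def)
      note f_lim = this
      have C_meas: "C \<in> sets borel" using C by (rule borel_closed)
      have "(\<lambda>n. \<integral>x. f n x \<partial>as_measure \<mu>) \<longlonglongrightarrow> (\<integral>x. indicator C x \<partial>as_measure \<mu>)"
      proof (rule integral_dominated_convergence[where w = "\<lambda>_. 1"])
        show "AE x in as_measure \<mu>. (\<lambda>n. f n x) \<longlonglongrightarrow> indicator C x" by (simp add: f_lim)
        show "AE x in as_measure \<mu>. norm (f n x) \<le> 1" for n by (simp add: f_bd)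
        show "f n \<in> borel_measurable (as_measure \<mu>)" for n
          using f_meas[of n] by simp
        show "indicat_real C \<in> borel_measurable (as_measure \<mu>)"
          using C_meas by simp
      qed simp
      then show ?thesis using C by (simp add: integ_def)
    qed
    have "(\<lambda>\<mu>. measure (as_measure \<mu>) C) \<in> borel_measurable borel"
      by (rule borel_measurable_LIMSEQ_real[OF integ_lim integ_meas])
    moreover have "emeasure (as_measure \<mu>) C = ennreal (measure (as_measure \<mu>) C)" for \<mu>
      by (simp add: finite_measure.emeasure_eq_measure[OF finite_as_measure])
    ultimately show ?thesis by simp
  qed simp
  have "sets (borel :: 'a measure) = sigma_sets UNIV {C. closed C}"
    by (simp add: borel_eq_closed)
  then have "Int_stable {C :: 'a set. closed C}" "{C. closed C} \<subseteq> Pow (UNIV :: 'a set)"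
      "B \<in> sigma_sets UNIV {C. closed C}"
    using assms by (auto simp: Int_stable_def)
  then show ?thesis
  proof (induction rule: sigma_sets_induct_disjoint)
    case (basic A) then show ?case by (auto intro: closed)
  next
    case (compl A)
    have A: "A \<in> sets borel" using compl(1) by (simp add: borel_eq_closed)
    have "emeasure (as_measure \<mu>) (UNIV - A)
        = emeasure (as_measure \<mu>) UNIV - emeasure (as_measure \<mu>) A" for \<mu> :: "'a fin_measure"
      using A finite_measure.emeasure_finite[OF finite_as_measure, of \<mu> A]
      by (intro emeasure_Diff) auto
    with compl(2) closed[of UNIV] show ?case by simp
  next
    case (union A)
    have A: "range A \<subseteq> sets borel" using union(2) by (auto simp: borel_eq_closed)
    have "(\<Sum>i. emeasure (as_measure \<mu>) (A i)) = emeasure (as_measure \<mu>) (\<Union>(range A))"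
      for \<mu> :: "'a fin_measure"
      using A union(1) by (intro suminf_emeasure) auto
    moreover have "(\<lambda>\<mu>. \<Sum>i. emeasure (as_measure \<mu>) (A i)) \<in> borel_measurable borel"
      using union(3) by measurable
    ultimately show ?case by simp
  qed auto
qed

lemma measurable_nn_integral_as_measure:
  fixes f :: "'a::metric_space \<Rightarrow> ennreal"
  assumes "f \<in> borel_measurable borel"
  shows "(\<lambda>\<mu>. \<integral>\<^sup>+x. f x \<partial>as_measure \<mu>) \<in> borel_measurable borel"
  using assms
proof (induction rule: borel_measurable_induct)
  case (cong f g)
  then show ?case by (simp cong: nn_integral_cong)
next
  case (set A)
  then show ?case by (simp add: measurable_emeasure_as_measure)
next
  case (mult u c)
  then show ?case by (simp add: nn_integral_cmult)
next
  case (add u v)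
  then show ?case by (simp add: nn_integral_add)
next
  case (seq U)
  then have "(\<lambda>\<mu>. SUP i. \<integral>\<^sup>+x. U i x \<partial>as_measure \<mu>) \<in> borel_measurable borel" by measurable
  moreover have "(\<integral>\<^sup>+x. (SUP i. U i) x \<partial>as_measure \<mu>) = (SUP i. \<integral>\<^sup>+x. U i x \<partial>as_measure \<mu>)"
    for \<mu> :: "'a fin_measure"
    using seq by (simp add: nn_integral_monotone_convergence_SUP image_comp)
  ultimately show ?case by simp
qed

lemma measurable_integ [measurable]:
  fixes f :: "'a::metric_space \<Rightarrow> real"
  assumes f: "f \<in> nonneg_borel"
  shows "(\<lambda>\<mu>. integ \<mu> f) \<in> borel_measurable borel"
proof -
  have "integ \<mu> f = enn2real (\<integral>\<^sup>+x. ennreal (f x) \<partial>as_measure \<mu>)" for \<mu>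
    unfolding integ_def using f
    by (intro integral_eq_nn_integral) (auto simp: nonneg_borel_nonneg)
  moreover have "(\<lambda>\<mu>. \<integral>\<^sup>+x. ennreal (f x) \<partial>as_measure \<mu>) \<in> borel_measurable borel"
    using nonneg_borel_measurable[OF f] by (intro measurable_nn_integral_as_measure) measurable
  ultimately show ?thesis by simp
qed

text \<open>The Dirac mass at a point.\<close>

definition dirac :: "'a::topological_space \<Rightarrow> 'a fin_measure" where
  "dirac x = Fin_measure (return borel x)"

lemma as_measure_dirac [simp]: "as_measure (dirac x) = return borel x"
proof -
  interpret prob_space "return borel x" by (rule prob_space_return) simp
  show ?thesis unfolding dirac_def by (intro Fin_measure_inverse) (simp add: finite_measure_axioms)
qed

lemma integ_dirac: "f \<in> borel_measurable borel \<Longrightarrow> integ (dirac x) f = f x"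
  by (simp add: integ_def integral_return)

lemma as_measure_zero [simp]: "as_measure 0 = null_measure borel"
  unfolding zero_fin_measure_def by (intro Fin_measure_inverse) (auto intro!: finite_measureI)

lemma integ_zero [simp]: "integ 0 f = 0"
  by (simp add: integ_def)

lemma integ_pos:
  assumes "\<mu> \<noteq> 0" "f \<in> bdd_borel" "\<And>x. 0 < f x"
  shows "0 < integ \<mu> f"
proof (rule ccontr)
  assume "\<not> 0 < integ \<mu> f"
  moreover have "0 \<le> integ \<mu> f" unfolding integ_def by (simp add: assms(3) less_imp_le)
  ultimately have "(\<integral>x. f x \<partial>as_measure \<mu>) = 0" by (simp add: integ_def)
  then have "AE x in as_measure \<mu>. f x = 0"
    using integrable_integ[OF assms(2)] assms(3)
    by (subst (asm) integral_nonneg_eq_0_iff_AE) (auto simp: less_imp_le)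
  then have "AE x in as_measure \<mu>. False"
    by (rule AE_mp) (simp add: assms(3) less_imp_neq[symmetric])
  then have "emeasure (as_measure \<mu>) UNIV = 0"
    by (simp add: AE_iff_measurable[OF _ refl])
  then have "as_measure \<mu> = as_measure 0"
    by (intro measure_eqI) (auto intro: emeasure_eq_0[where N = UNIV])
  then show False using assms(1) by (metis as_measure_inject)
qed

lemma integ_one_eq_zero_iff: "integ \<mu> (\<lambda>_. 1) = 0 \<longleftrightarrow> \<mu> = 0"
  using integ_pos[of \<mu> "\<lambda>_. 1"] const_bp_borel[of 1] by fastforce

lemma sets_singleton_zero [measurable]: "{0 :: 'a::metric_space fin_measure} \<in> sets borel"
proof -
  have "(\<lambda>\<mu>. integ \<mu> (\<lambda>_. 1)) -` {0} \<inter> space borel \<in> sets (borel :: 'a fin_measure measure)"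
    using const_bp_borel[of 1] by (intro measurable_sets[OF measurable_integ]) auto
  moreover have "(\<lambda>\<mu>. integ \<mu> (\<lambda>_. 1)) -` {0} \<inter> space borel = {0 :: 'a fin_measure}"
    by (auto simp: integ_one_eq_zero_iff)
  ultimately show ?thesis by simp
qed

section \<open>Integrals of bounded functions on a time interval\<close>

lemma set_integrable_bounded:
  fixes f :: "real \<Rightarrow> real"
  assumes "f \<in> borel_measurable borel" "\<And>s. s \<in> S \<Longrightarrow> \<bar>f s\<bar> \<le> K" "S \<in> sets borel"
    "emeasure lborel S < \<infinity>"
  shows "set_integrable lborel S f"
  unfolding set_integrable_def
  by (rule Bochner_Integration.integrable_bound[where f = "\<lambda>s. K * indicator S s"])
    (use assms in \<open>auto split: split_indicator intro!: AE_I2 order_trans[OF _ abs_ge_self]\<close>)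

lemma set_integral_bound:
  fixes f :: "real \<Rightarrow> real"
  assumes "f \<in> borel_measurable borel" "\<And>s. s \<in> S \<Longrightarrow> \<bar>f s\<bar> \<le> K" "S \<in> sets borel"
    "emeasure lborel S < \<infinity>"
  shows "\<bar>LINT s:S|lborel. f s\<bar> \<le> K * measure lborel S"
proof -
  have int: "integrable lborel (\<lambda>s. indicator S s *\<^sub>R f s)"
    using set_integrable_bounded[OF assms] by (simp add: set_integrable_def)
  have "\<bar>\<integral>s. indicator S s *\<^sub>R f s \<partial>lborel\<bar> \<le> (\<integral>s. \<bar>indicator S s *\<^sub>R f s\<bar> \<partial>lborel)"
    using integral_norm_bound[of lborel "\<lambda>s. indicator S s *\<^sub>R f s"] by simp
  also have "\<dots> \<le> (\<integral>s. K * indicator S s \<partial>lborel)"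
    using int assms by (intro integral_mono) (auto split: split_indicator)
  finally show ?thesis using assms(3) by (simp add: set_lebesgue_integral_def)
qed

lemma exp_diff_le:
  fixes p q M :: real
  assumes "p \<le> M" "q \<le> M"
  shows "\<bar>exp p - exp q\<bar> \<le> \<bar>p - q\<bar> * exp M"
proof -
  have *: "exp p - exp q \<le> (p - q) * exp M" if "q \<le> p" "p \<le> M" for p q :: real
  proof -
    have "exp p * (1 + (q - p)) \<le> exp p * exp (q - p)"
      by (intro mult_left_mono exp_ge_add_one_self) simp
    then have "exp p - exp q \<le> (p - q) * exp p" by (simp add: exp_add[symmetric] algebra_simps)
    also have "\<dots> \<le> (p - q) * exp M" using that by (intro mult_left_mono) auto
    finally show ?thesis .
  qed
  show ?thesis
    using *[of q p] *[of p q] assms by (cases "q \<le> p") auto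
qed

text \<open>The fundamental theorem of calculus for \<open>exp \<circ> A\<close> when \<open>A\<close> is the integral of a bounded
  Borel function that need not be continuous: the increments of the difference of both sides are
  of second order, so that its derivative vanishes.\<close>

lemma integral_exp_integral:
  fixes a :: "real \<Rightarrow> real" and b t :: real
  assumes a [measurable]: "a \<in> borel_measurable borel" and b: "\<And>s. \<bar>a s\<bar> \<le> b" and t: "0 \<le> t"
  defines "A \<equiv> \<lambda>s. LINT u:{0..s}|lborel. a u"
  shows "(LINT s:{0..t}|lborel. a s * exp (A s)) = exp (A t) - 1"
proof -
  have b0: "0 \<le> b" using b[of 0] by linarith
  have A_meas [measurable]: "A \<in> borel_measurable borel"
    unfolding A_def set_lebesgue_integral_def indicator_def atLeastAtMost_iff by measurable
  have A_diff: "A v - A u = (LINT s:{u<..v}|lborel. a s)" if "0 \<le> u" "u \<le> v" for u v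
  proof -
    have "{0..v} = {0..u} \<union> {u<..v}" using that by auto
    then have "A v = A u + (LINT s:{u<..v}|lborel. a s)"
      unfolding A_def using that b
      by (simp, intro set_integral_Un set_integrable_bounded[of a _ b]) auto
    then show ?thesis by simp
  qed
  have A_lip: "\<bar>A v - A u\<bar> \<le> b * (v - u)" if "0 \<le> u" "u \<le> v" for u v
    using set_integral_bound[of a "{u<..v}" b] b that by (simp add: A_diff)
  have A_0: "A 0 = 0"
    using set_integral_bound[of a "{0..0}" b] b by (simp add: A_def)
  have A_le: "\<bar>A u\<bar> \<le> b * t" if "0 \<le> u" "u \<le> t" for u
  proof -
    have "b * u \<le> b * t" using that b0 by (intro mult_left_mono)
    with A_lip[of 0 u] that A_0 show ?thesis by simp
  qed
  define M where "M = b * t"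
  define \<Phi> where "\<Phi> v = exp (A v) - (LINT s:{0..v}|lborel. a s * exp (A s))" for v
  define K where "K = 2 * b\<^sup>2 * exp M"
  have K0: "0 \<le> K" by (simp add: K_def)
  have bd: "\<bar>a s * exp (A s)\<bar> \<le> b * exp M" if "s \<in> {0..t}" for s
    unfolding abs_mult using b b0 A_le[of s] that
    by (intro mult_mono) (auto simp: M_def)
  have \<Phi>_diff: "\<bar>\<Phi> v - \<Phi> u\<bar> \<le> K * (v - u)\<^sup>2" if uv: "0 \<le> u" "u \<le> v" "v \<le> t" for u v
  proof -
    define d where "d = A v - A u"
    have "{0..v} = {0..u} \<union> {u<..v}" using that by auto
    then have "(LINT s:{0..v}|lborel. a s * exp (A s))
        = (LINT s:{0..u}|lborel. a s * exp (A s)) + (LINT s:{u<..v}|lborel. a s * exp (A s))"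
      using that bd
      by (simp, intro set_integral_Un set_integrable_bounded[of _ _ "b * exp M"]) auto
    moreover have "(LINT s:{u<..v}|lborel. a s * exp (A s))
        = (LINT s:{u<..v}|lborel. a s * (exp (A s) - exp (A u))) + exp (A u) * d"
    proof -
      have "(LINT s:{u<..v}|lborel. a s * (exp (A s) - exp (A u)))
          = (LINT s:{u<..v}|lborel. a s * exp (A s)) - (LINT s:{u<..v}|lborel. exp (A u) * a s)"
      proof -
        have "set_integrable lborel {u<..v} (\<lambda>s. a s * exp (A s))"
          using that bd by (intro set_integrable_bounded[of _ _ "b * exp M"]) auto
        moreover have "set_integrable lborel {u<..v} (\<lambda>s. exp (A u) * a s)"
          using that b by (intro set_integrable_mult_right set_integrable_bounded[of _ _ b]) auto
        ultimately show ?thesis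
          by (subst set_integral_diff(2)[symmetric]) (auto simp: algebra_simps)
      qed
      then show ?thesis using A_diff[OF uv(1,2)] by (simp add: d_def)
    qed
    ultimately have eq: "\<Phi> v - \<Phi> u = (exp (A v) - exp (A u) - exp (A u) * d)
        - (LINT s:{u<..v}|lborel. a s * (exp (A s) - exp (A u)))"
      by (simp add: \<Phi>_def)
    have d_le: "\<bar>d\<bar> \<le> b * (v - u)" using A_lip that by (simp add: d_def)
    have AM: "A s \<le> M" if "0 \<le> s" "s \<le> t" for s using A_le[OF that] by (simp add: M_def)
    have e1: "\<bar>exp (A v) - exp (A u) - exp (A u) * d\<bar> \<le> b\<^sup>2 * exp M * (v - u)\<^sup>2"
    proof -
      have "0 \<le> exp (A v) - exp (A u) - exp (A u) * d"
      proof -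
        have "exp (A u) * (1 + d) \<le> exp (A u) * exp d"
          by (intro mult_left_mono exp_ge_add_one_self) simp
        then show ?thesis by (simp add: d_def exp_add[symmetric] algebra_simps)
      qed
      moreover have "exp (A v) - exp (A u) - exp (A u) * d \<le> d * (exp (A v) - exp (A u))"
      proof -
        have "exp (A v) * (1 + - d) \<le> exp (A v) * exp (- d)"
          by (intro mult_left_mono exp_ge_add_one_self) simp
        then show ?thesis by (simp add: d_def exp_add[symmetric] algebra_simps)
      qed
      moreover have "d * (exp (A v) - exp (A u)) \<le> \<bar>d\<bar> * (\<bar>d\<bar> * exp M)"
      proof -
        have "d * (exp (A v) - exp (A u)) \<le> \<bar>d\<bar> * \<bar>exp (A v) - exp (A u)\<bar>"
          by (metis abs_ge_self abs_mult)
        also have "\<dots> \<le> \<bar>d\<bar> * (\<bar>d\<bar> * exp M)"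
          using exp_diff_le[of "A v" M "A u"] AM that by (intro mult_left_mono) (auto simp: d_def)
        finally show ?thesis .
      qed
      moreover have "\<bar>d\<bar> * (\<bar>d\<bar> * exp M) \<le> (b * (v - u)) * ((b * (v - u)) * exp M)"
        using d_le that b0 by (intro mult_mono) auto
      moreover have "(b * (v - u)) * ((b * (v - u)) * exp M) = b\<^sup>2 * exp M * (v - u)\<^sup>2"
        by (simp add: power2_eq_square)
      ultimately show ?thesis by linarith
    qed
    have "\<bar>LINT s:{u<..v}|lborel. a s * (exp (A s) - exp (A u))\<bar>
        \<le> (b * (b * (v - u) * exp M)) * measure lborel {u<..v}"
    proof (rule set_integral_bound)
      fix s assume s: "s \<in> {u<..v}"
      have "\<bar>exp (A s) - exp (A u)\<bar> \<le> \<bar>A s - A u\<bar> * exp M"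
        using s that by (intro exp_diff_le AM) auto
      also have "\<dots> \<le> (b * (v - u)) * exp M"
      proof -
        have "b * (s - u) \<le> b * (v - u)" using s b0 by (intro mult_left_mono) auto
        with A_lip[of u s] s that show ?thesis by (intro mult_right_mono) auto
      qed
      finally show "\<bar>a s * (exp (A s) - exp (A u))\<bar> \<le> b * (b * (v - u) * exp M)"
        unfolding abs_mult using b b0 by (intro mult_mono) auto
    qed (use that in auto)
    then have e2: "\<bar>LINT s:{u<..v}|lborel. a s * (exp (A s) - exp (A u))\<bar> \<le> b\<^sup>2 * exp M * (v - u)\<^sup>2"
      using that by (simp add: power2_eq_square ac_simps)
    show ?thesis unfolding eq K_def using e1 e2 by (simp add: abs_le_iff)
  qed
  have \<Phi>_diff': "\<bar>\<Phi> v - \<Phi> u\<bar> \<le> K * (v - u)\<^sup>2" if "u \<in> {0..t}" "v \<in> {0..t}" for u v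
  proof (cases "u \<le> v")
    case False
    with \<Phi>_diff[of v u] that show ?thesis by (simp add: abs_minus_commute power2_commute)
  qed (use \<Phi>_diff that in auto)
  have "(\<Phi> has_field_derivative 0) (at u within {0..t})" if u: "u \<in> {0..t}" for u
    unfolding has_field_derivative_iff
  proof (rule tendsto_0_le[where K = 1])
    have "((\<lambda>v. K * (v - u)) \<longlongrightarrow> K * (u - u)) (at u within {0..t})"
      by (intro tendsto_intros)
    then show "((\<lambda>v. K * (v - u)) \<longlongrightarrow> 0) (at u within {0..t})" by simp
    show "eventually (\<lambda>v. norm ((\<Phi> v - \<Phi> u) / (v - u)) \<le> norm (K * (v - u)) * 1) (at u within {0..t})"
      unfolding eventually_at_filter
    proof (intro always_eventually allI impI)
      fix v assume v: "v \<noteq> u" "v \<in> {0..t}"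
      have "\<bar>\<Phi> v - \<Phi> u\<bar> \<le> K * \<bar>v - u\<bar> * \<bar>v - u\<bar>"
        using \<Phi>_diff'[OF u v(2)] by (simp add: power2_eq_square)
      then show "norm ((\<Phi> v - \<Phi> u) / (v - u)) \<le> norm (K * (v - u)) * 1"
        using v K0 by (simp add: abs_mult divide_le_eq)
    qed
  qed
  then obtain c where "\<And>u. u \<in> {0..t} \<Longrightarrow> \<Phi> u = c"
    using has_field_derivative_zero_constant[of "{0..t}" \<Phi>] by auto
  then have "\<Phi> t = \<Phi> 0" using t by simp
  moreover have "(LINT s:{0..0}|lborel. a s * exp (A s)) = 0"
    using set_integral_bound[of "\<lambda>s. a s * exp (A s)" "{0..0}" "b * exp M"] bd t by simp
  ultimately show ?thesis using A_0 by (simp add: \<Phi>_def)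
qed

lemma integral_restrict_lborel:
  fixes f :: "real \<Rightarrow> real"
  shows "(\<integral>s. f s \<partial>restrict_space lborel {0..t}) = (LINT s:{0..t}|lborel. f s)"
  by (simp add: integral_restrict_space set_lebesgue_integral_def)

lemma finite_restrict_lborel: "finite_measure (restrict_space lborel {0..t::real})"
  by (rule finite_measureI) (auto simp: emeasure_restrict_space space_restrict_space emeasure_lborel_Icc_eq)

lemma measurable_restrict_lborel:
  "f \<in> borel_measurable borel \<Longrightarrow> f \<in> borel_measurable (restrict_space lborel S)"
  by (rule measurable_restrict_space1) simp

lemma Fubini_bounded:
  fixes k :: "'a \<Rightarrow> 'b \<Rightarrow> real"
  assumes M: "finite_measure M" and N: "finite_measure N"
    and k: "(\<lambda>(x, y). k x y) \<in> borel_measurable (M \<Otimes>\<^sub>M N)"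
    and K: "\<And>x y. x \<in> space M \<Longrightarrow> y \<in> space N \<Longrightarrow> \<bar>k x y\<bar> \<le> K"
  shows "(\<integral>x. \<integral>y. k x y \<partial>N \<partial>M) = (\<integral>y. \<integral>x. k x y \<partial>M \<partial>N)"
proof -
  interpret M: finite_measure M by fact
  interpret N: finite_measure N by fact
  interpret MN: pair_sigma_finite M N ..
  have "finite_measure (M \<Otimes>\<^sub>M N)" by (rule finite_measure_pair_measure) fact+
  then have "integrable (M \<Otimes>\<^sub>M N) (\<lambda>(x, y). k x y)"
    using k K by (intro finite_measure.integrable_const_bound[of _ _ K] AE_I2) (auto simp: space_pair_measure)
  then show ?thesis by (rule MN.Fubini_integral[symmetric])
qed

section \<open>The spatial motion\<close>

text \<open>The integral of a jointly measurable function against a kernel; measurability in the first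
  argument, for real-valued functions.\<close>

lemma integral_measurable_subprob_algebra2:
  fixes f :: "'a \<Rightarrow> 'b \<Rightarrow> real"
  assumes f [measurable]: "(\<lambda>(x, y). f x y) \<in> borel_measurable (M \<Otimes>\<^sub>M N)"
    and L [measurable]: "L \<in> M \<rightarrow>\<^sub>M subprob_algebra N"
  shows "(\<lambda>x. \<integral>y. f x y \<partial>L x) \<in> borel_measurable M"
proof -
  note integral_measurable_subprob_algebra[measurable] measurable_distr2[measurable]
  have "(\<lambda>x. \<integral>p. (\<lambda>(x, y). f x y) p \<partial>distr (L x) (M \<Otimes>\<^sub>M N) (\<lambda>y. (x, y))) \<in> borel_measurable M"
    by measurable
  moreover have "(\<integral>p. (\<lambda>(x, y). f x y) p \<partial>distr (L x) (M \<Otimes>\<^sub>M N) (\<lambda>y. (x, y))) = (\<integral>y. f x y \<partial>L x)"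
    if "x \<in> space M" for x
  proof -
    have "sets (L x) = sets N" using measurable_space[OF L that] by (simp add: space_subprob_algebra)
    then have "(\<lambda>y. (x, y)) \<in> L x \<rightarrow>\<^sub>M M \<Otimes>\<^sub>M N"
      using that by (simp cong: measurable_cong_sets)
    then show ?thesis by (subst integral_distr[OF _ f]) simp_all
  qed
  ultimately show ?thesis by (simp cong: measurable_cong)
qed

text \<open>The spatial motion, a Borel right process with possibly finite lifetime.\<close>

locale right_motion =
  fixes W :: "'w measure"
    and \<xi> :: "real \<Rightarrow> 'w \<Rightarrow> 'e::polish_space"
    and \<zeta> :: "'w \<Rightarrow> ereal"
    and Law :: "'e \<Rightarrow> 'w measure"
    and P :: "real \<Rightarrow> 'e \<Rightarrow> 'e measure"
  assumes motion: "borel_right_process W \<xi> \<zeta> Law P"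
begin

lemma P_kernel [measurable]: "0 \<le> t \<Longrightarrow> P t \<in> borel \<rightarrow>\<^sub>M subprob_algebra borel"
  using motion by (auto simp: borel_right_process_def borel_semigroup_def)

lemma sets_P: "0 \<le> t \<Longrightarrow> sets (P t x) = sets borel"
  using measurable_space[OF P_kernel, of t x] by (simp add: space_subprob_algebra)

lemma subprob_P: "0 \<le> t \<Longrightarrow> subprob_space (P t x)"
  using measurable_space[OF P_kernel, of t x] by (simp add: space_subprob_algebra)

lemma Law_prob_kernel: "Law \<in> borel \<rightarrow>\<^sub>M prob_algebra W"
  using motion by (auto simp: borel_right_process_def)

lemma Law_kernel [measurable]: "Law \<in> borel \<rightarrow>\<^sub>M subprob_algebra W"
  using Law_prob_kernel by (rule measurable_prob_algebraD)

lemma sets_Law [simp, measurable_cong]: "sets (Law x) = sets W"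
  using measurable_space[OF Law_prob_kernel, of x] by (simp add: space_prob_algebra)

lemma space_Law [simp]: "space (Law x) = space W"
  by (rule sets_eq_imp_space_eq) simp

lemma prob_Law: "prob_space (Law x)"
  using measurable_space[OF Law_prob_kernel, of x] by (simp add: space_prob_algebra)

lemma proc_event_sets: "0 \<le> t \<Longrightarrow> B \<in> sets borel \<Longrightarrow> proc_event W \<xi> \<zeta> t B \<in> sets W"
  using motion by (auto simp: borel_right_process_def)

lemma right_continuous:
  "\<omega> \<in> space W \<Longrightarrow> 0 \<le> t \<Longrightarrow> ereal t < \<zeta> \<omega> \<Longrightarrow> ((\<lambda>s. \<xi> s \<omega>) \<longlongrightarrow> \<xi> t \<omega>) (at_right t)"
  using motion by (auto simp: borel_right_process_def continuous_within)

lemma start: "AE \<omega> in Law x. 0 < \<zeta> \<omega> \<and> \<xi> 0 \<omega> = x"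
  using motion by (auto simp: borel_right_process_def)

lemma markov:
  assumes "0 \<le> s" "0 \<le> t" "A \<in> sets (natural_filtration W \<xi> \<zeta> s)" "B \<in> sets borel"
  shows "emeasure (Law x) (A \<inter> proc_event W \<xi> \<zeta> (s + t) B) =
    (\<integral>\<^sup>+\<omega>. emeasure (P t (\<xi> s \<omega>)) B * indicator (A \<inter> proc_event W \<xi> \<zeta> s UNIV) \<omega> \<partial>Law x)"
  using motion assms by (auto simp: borel_right_process_def)

text \<open>The value of a function along the motion, put equal to \<open>0\<close> from the lifetime on.\<close>

definition kill :: "('e \<Rightarrow> 'b::zero) \<Rightarrow> real \<Rightarrow> 'w \<Rightarrow> 'b" where
  "kill g s \<omega> = (if ereal s < \<zeta> \<omega> then g (\<xi> s \<omega>) else 0)"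

lemma space_natural_filtration [simp]: "space (natural_filtration W \<xi> \<zeta> s) = space W"
  by (simp add: natural_filtration_def space_measure_of_conv)

lemma sets_natural_filtration:
  "sets (natural_filtration W \<xi> \<zeta> s) =
     sigma_sets (space W) {proc_event W \<xi> \<zeta> r B | r B. 0 \<le> r \<and> r \<le> s \<and> B \<in> sets borel}"
  unfolding natural_filtration_def by (rule sets_measure_of) (auto simp: proc_event_def)

lemma natural_filtration_subset: "sets (natural_filtration W \<xi> \<zeta> s) \<subseteq> sets W"
  unfolding sets_natural_filtration
  by (intro sets.sigma_sets_subset) (auto intro: proc_event_sets)

lemma proc_event_natural_filtration:
  "0 \<le> r \<Longrightarrow> r \<le> s \<Longrightarrow> B \<in> sets borel \<Longrightarrow>
    proc_event W \<xi> \<zeta> r B \<in> sets (natural_filtration W \<xi> \<zeta> s)"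
  unfolding sets_natural_filtration by auto

lemma measurable_natural_filtration:
  "f \<in> borel_measurable (natural_filtration W \<xi> \<zeta> s) \<Longrightarrow> f \<in> borel_measurable W"
  by (rule borel_measurable_subalgebra[OF natural_filtration_subset]) auto

lemma measurable_kill_at:
  fixes g :: "'e \<Rightarrow> 'b::{topological_space, zero}"
  assumes F: "space F = space W"
      "\<And>B. B \<in> sets borel \<Longrightarrow> proc_event W \<xi> \<zeta> r B \<in> sets F"
    and g [measurable]: "g \<in> borel_measurable borel"
  shows "kill g r \<in> borel_measurable F"
proof -
  have eq: "{\<omega> \<in> space F. ereal r < \<zeta> \<omega>} = proc_event W \<xi> \<zeta> r UNIV"
    by (simp add: proc_event_def F)
  have alive: "{\<omega> \<in> space F. ereal r < \<zeta> \<omega>} \<in> sets F"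
    unfolding eq by (rule F) simp
  have xi [measurable]: "\<xi> r \<in> restrict_space F {\<omega>. ereal r < \<zeta> \<omega>} \<rightarrow>\<^sub>M borel"
  proof (rule measurableI)
    fix B :: "'e set" assume "B \<in> sets borel"
    then have "proc_event W \<xi> \<zeta> r B \<in> sets F" by (rule F)
    moreover have "proc_event W \<xi> \<zeta> r B = {\<omega>. ereal r < \<zeta> \<omega>} \<inter> proc_event W \<xi> \<zeta> r B"
      by (auto simp: proc_event_def)
    moreover have "\<xi> r -` B \<inter> space (restrict_space F {\<omega>. ereal r < \<zeta> \<omega>}) = proc_event W \<xi> \<zeta> r B"
      by (auto simp: proc_event_def space_restrict_space F)
    ultimately show "\<xi> r -` B \<inter> space (restrict_space F {\<omega>. ereal r < \<zeta> \<omega>})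
        \<in> sets (restrict_space F {\<omega>. ereal r < \<zeta> \<omega>})"
      unfolding sets_restrict_space by auto
  qed simp
  show ?thesis
    unfolding kill_def measurable_If_restrict_space_iff[OF alive] by measurable
qed

text \<open>Joint measurability in time and path, for any \<open>\<sigma>\<close>-algebra that observes the motion up to
  time \<open>t\<close>: the motion at time \<open>s\<close> is the limit of the motion at discrete times decreasing
  to \<open>s\<close>, capped at \<open>t\<close>.\<close>

lemma measurable_kill_joint:
  fixes g :: "real \<Rightarrow> 'e \<Rightarrow> real"
  assumes F: "space F = space W"
      "\<And>r B. 0 \<le> r \<Longrightarrow> r \<le> t \<Longrightarrow> B \<in> sets borel \<Longrightarrow> proc_event W \<xi> \<zeta> r B \<in> sets F"
    and g [measurable]: "(\<lambda>(s, y). g s y) \<in> borel_measurable (borel \<Otimes>\<^sub>M borel)"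
    and t: "0 \<le> t"
  shows "(\<lambda>(s, \<omega>). if 0 \<le> s \<and> s \<le> t then kill (g s) s \<omega> else 0) \<in> borel_measurable (borel \<Otimes>\<^sub>M F)"
proof -
  let ?M = "(borel :: real measure) \<Otimes>\<^sub>M F"
  define J where "J U = {p \<in> space ?M. 0 \<le> fst p \<and> fst p \<le> t \<and> ereal (fst p) < \<zeta> (snd p)
      \<and> \<xi> (fst p) (snd p) \<in> U}" for U
  have J_open: "J U \<in> sets ?M" if "open U" for U
  proof -
    define d where "d y = (if U = UNIV then 1 else infdist y (- U))" for y
    have d_cont: "continuous_on UNIV d"
      unfolding d_def by (cases "U = UNIV") (auto intro!: continuous_intros)
    have d_meas: "d \<in> borel_measurable borel"
      by (rule borel_measurable_continuous_onI[OF d_cont])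
    have d_pos: "0 < d y \<longleftrightarrow> y \<in> U" for y
    proof (cases "U = UNIV")
      case False
      have "closed (- U)" using that by (simp add: closed_def)
      then have "y \<in> - U \<longleftrightarrow> infdist y (- U) = 0"
        using False by (intro in_closed_iff_infdist_zero) auto
      moreover have "d y = infdist y (- U)" using False by (simp add: d_def)
      ultimately show ?thesis using infdist_nonneg[of y "- U"] by force
    qed (simp add: d_def)
    \<comment> \<open>the discrete time following the \<open>i\<close>-th one, capped at \<open>t\<close>; the outer maximum only matters for
      the values of \<open>i\<close> that are not attained\<close>
    define \<tau> where "\<tau> n i = max 0 (min ((real_of_int i + 1) / (real n + 1)) t)" for n :: nat and i :: int
    define K where "K p = (if 0 \<le> fst p \<and> fst p \<le> t then kill d (fst p) (snd p) else 0)" for p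
    define Kn where "Kn n p = (if 0 \<le> fst p \<and> fst p \<le> t
        then kill d (\<tau> n \<lfloor>(real n + 1) * fst p\<rfloor>) (snd p) else 0)" for n p
    have "kill d (\<tau> n i) \<in> borel_measurable F" for n i
      using t by (intro measurable_kill_at F d_meas) (auto simp: \<tau>_def)
    note [measurable] = measurable_compose[OF measurable_snd this]
    have "(\<lambda>p. kill d (\<tau> n \<lfloor>(real n + 1) * fst p\<rfloor>) (snd p)) \<in> borel_measurable ?M" for n
    proof (rule measurable_compose_countable[where f = "\<lambda>i p. kill d (\<tau> n i) (snd p)"])
      show "(\<lambda>p. \<lfloor>(real n + 1) * fst p\<rfloor>) \<in> ?M \<rightarrow>\<^sub>M count_space UNIV" by measurable
    qed measurable
    then have Kn_meas: "Kn n \<in> borel_measurable ?M" for n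
      unfolding Kn_def by measurable
    have lim: "(\<lambda>n. Kn n p) \<longlonglongrightarrow> K p" if "p \<in> space ?M" for p
    proof (cases "0 \<le> fst p \<and> fst p \<le> t")
      case True
      define s \<omega> where "s = fst p" and "\<omega> = snd p"
      have s: "0 \<le> s" "s \<le> t" and \<omega>: "\<omega> \<in> space W"
        using True that by (auto simp: s_def \<omega>_def space_pair_measure F)
      define \<sigma> where "\<sigma> n = \<tau> n \<lfloor>(real n + 1) * s\<rfloor>" for n
      have above: "s < (real_of_int \<lfloor>(real n + 1) * s\<rfloor> + 1) / (real n + 1)" for n
        by (simp add: pos_less_divide_eq mult.commute)
      have below: "(real_of_int \<lfloor>(real n + 1) * s\<rfloor> + 1) / (real n + 1) \<le> s + 1 / (real n + 1)" for n
      proof -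
        have "real_of_int \<lfloor>(real n + 1) * s\<rfloor> \<le> (real n + 1) * s" by (rule of_int_floor_le)
        then have "(real_of_int \<lfloor>(real n + 1) * s\<rfloor> + 1) / (real n + 1)
            \<le> ((real n + 1) * s + 1) / (real n + 1)"
          by (intro divide_right_mono) auto
        also have "\<dots> = s + 1 / (real n + 1)" by (simp add: field_simps)
        finally show ?thesis .
      qed
      have "(\<lambda>n. kill d (\<sigma> n) \<omega>) \<longlonglongrightarrow> kill d s \<omega>"
      proof (cases "s = t")
        case True
        have "\<sigma> n = s" for n
          using above[of n] t unfolding \<sigma>_def \<tau>_def True by (simp add: min_absorb2)
        then show ?thesis by simp
      next
        case False
        then have st: "s < t" using s by simp
        have \<sigma>_gt: "s < \<sigma> n" for n
          using above[of n] st s unfolding \<sigma>_def \<tau>_def by (simp add: less_max_iff_disj)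
        have \<sigma>_le: "\<sigma> n \<le> s + 1 / (real n + 1)" for n
          using below[of n] s unfolding \<sigma>_def \<tau>_def by (auto simp: min_le_iff_disj)
        have "\<sigma> \<longlonglongrightarrow> s"
        proof (rule tendsto_sandwich[where f = "\<lambda>_. s" and h = "\<lambda>n. s + 1 / (real n + 1)"])
          show "(\<lambda>n. s + 1 / (real n + 1)) \<longlonglongrightarrow> s"
            using LIMSEQ_inverse_real_of_nat_add[of s] by (simp add: inverse_eq_divide add.commute)
          show "eventually (\<lambda>n. s \<le> \<sigma> n) sequentially"
            using \<sigma>_gt by (intro always_eventually allI less_imp_le)
          show "eventually (\<lambda>n. \<sigma> n \<le> s + 1 / (real n + 1)) sequentially"
            using \<sigma>_le by (intro always_eventually allI)
        qed (rule tendsto_const)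
        moreover have "eventually (\<lambda>n. \<sigma> n \<in> {s<..} \<and> \<sigma> n \<noteq> s) sequentially"
          using \<sigma>_gt less_imp_neq[OF \<sigma>_gt] by (intro always_eventually allI) auto
        ultimately have \<sigma>_right: "filterlim \<sigma> (at_right s) sequentially"
          unfolding filterlim_at by blast
        show ?thesis
        proof (cases "ereal s < \<zeta> \<omega>")
          case True
          obtain z where z: "s < z" "ereal z < \<zeta> \<omega>"
            using ereal_dense2[OF True] by auto
          have "eventually (\<lambda>n. \<sigma> n < z) sequentially"
            using \<open>\<sigma> \<longlonglongrightarrow> s\<close> z(1) by (rule order_tendstoD)
          then have "eventually (\<lambda>n. d (\<xi> (\<sigma> n) \<omega>) = kill d (\<sigma> n) \<omega>) sequentially"
          proof eventually_elim
            case (elim n)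
            then have "ereal (\<sigma> n) < \<zeta> \<omega>" using z(2) by (meson less_ereal.simps(1) order_less_trans)
            then show ?case by (simp add: kill_def)
          qed
          moreover have "(\<lambda>n. d (\<xi> (\<sigma> n) \<omega>)) \<longlonglongrightarrow> d (\<xi> s \<omega>)"
            using filterlim_compose[OF right_continuous[OF \<omega> s(1) True] \<sigma>_right] d_cont
            by (intro isCont_tendsto_compose[of _ d]) (auto simp: continuous_on_eq_continuous_at)
          ultimately show ?thesis
            using True by (simp add: kill_def[of d s] tendsto_cong)
        next
          case dead: False
          have "\<not> ereal (\<sigma> n) < \<zeta> \<omega>" for n
            using dead \<sigma>_gt[of n] by (meson less_ereal.simps(1) order_less_trans)
          with dead show ?thesis by (simp add: kill_def)
        qed
      qed
      with True show ?thesis by (simp add: K_def Kn_def s_def \<omega>_def \<sigma>_def)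
    next
      case False
      then have "K p = 0" "Kn n p = 0" for n by (auto simp: K_def Kn_def)
      then show ?thesis by simp
    qed
    have "K \<in> borel_measurable ?M"
      by (rule borel_measurable_LIMSEQ_real[OF lim Kn_meas])
    then have "K -` {0<..} \<inter> space ?M \<in> sets ?M" by (rule measurable_sets) simp
    also have "K -` {0<..} \<inter> space ?M = J U"
      by (auto simp: K_def J_def kill_def d_pos split: if_splits)
    finally show ?thesis .
  qed
  let ?\<Omega> = "{p. 0 \<le> fst p \<and> fst p \<le> t \<and> ereal (fst p) < \<zeta> (snd p)}"
  have J_UNIV: "{p \<in> space ?M. 0 \<le> fst p \<and> fst p \<le> t \<and> ereal (fst p) < \<zeta> (snd p)} = J UNIV"
    by (auto simp: J_def)
  have alive: "{p \<in> space ?M. 0 \<le> fst p \<and> fst p \<le> t \<and> ereal (fst p) < \<zeta> (snd p)} \<in> sets ?M"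
    unfolding J_UNIV by (rule J_open) simp
  have [measurable]: "(\<lambda>p. \<xi> (fst p) (snd p)) \<in> restrict_space ?M ?\<Omega> \<rightarrow>\<^sub>M borel"
  proof (rule borel_measurableI)
    fix U :: "'e set" assume "open U"
    then have "J U \<in> sets ?M" by (rule J_open)
    moreover have "J U = ?\<Omega> \<inter> J U" by (auto simp: J_def)
    moreover have "(\<lambda>p. \<xi> (fst p) (snd p)) -` U \<inter> space (restrict_space ?M ?\<Omega>) = J U"
      by (auto simp: J_def space_restrict_space)
    ultimately show "(\<lambda>p. \<xi> (fst p) (snd p)) -` U \<inter> space (restrict_space ?M ?\<Omega>)
        \<in> sets (restrict_space ?M ?\<Omega>)"
      unfolding sets_restrict_space by auto
  qed
  have [measurable]: "fst \<in> borel_measurable (restrict_space ?M ?\<Omega>)"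
    by (intro measurable_restrict_space1 measurable_fst)
  have "(\<lambda>p. (\<lambda>(s, y). g s y) (fst p, \<xi> (fst p) (snd p))) \<in> borel_measurable (restrict_space ?M ?\<Omega>)"
    by measurable
  then have "(\<lambda>p. if 0 \<le> fst p \<and> fst p \<le> t \<and> ereal (fst p) < \<zeta> (snd p)
      then g (fst p) (\<xi> (fst p) (snd p)) else 0) \<in> borel_measurable ?M"
    unfolding measurable_If_restrict_space_iff[OF alive] by simp
  moreover have "(\<lambda>p. if 0 \<le> fst p \<and> fst p \<le> t \<and> ereal (fst p) < \<zeta> (snd p)
      then g (fst p) (\<xi> (fst p) (snd p)) else 0)
    = (\<lambda>(s, \<omega>). if 0 \<le> s \<and> s \<le> t then kill (g s) s \<omega> else 0)"
    by (auto simp: kill_def fun_eq_iff)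
  ultimately show ?thesis by simp
qed

lemma measurable_kill_W:
  fixes g :: "'e \<Rightarrow> 'b::{topological_space, zero}"
  shows "0 \<le> r \<Longrightarrow> g \<in> borel_measurable borel \<Longrightarrow> kill g r \<in> borel_measurable W"
  by (intro measurable_kill_at proc_event_sets) auto

lemma measurable_kill_joint_W:
  fixes g :: "real \<Rightarrow> 'e \<Rightarrow> real"
  assumes "(\<lambda>(s, y). g s y) \<in> borel_measurable (borel \<Otimes>\<^sub>M borel)" "0 \<le> t"
  shows "(\<lambda>(s, \<omega>). if 0 \<le> s \<and> s \<le> t then kill (g s) s \<omega> else 0) \<in> borel_measurable (borel \<Otimes>\<^sub>M W)"
  using assms by (intro measurable_kill_joint proc_event_sets) auto

lemma kill_cmult: "kill (\<lambda>y. c * g y) s \<omega> = (c::'b::mult_zero) * kill g s \<omega>"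
  by (simp add: kill_def)

lemma kill_add: "kill (\<lambda>y. f y + g y) s \<omega> = kill f s \<omega> + (kill g s \<omega> :: 'b::monoid_add)"
  by (simp add: kill_def)

lemma kill_bound: "(\<And>y. \<bar>g y\<bar> \<le> K) \<Longrightarrow> \<bar>kill g s \<omega> :: real\<bar> \<le> K"
  by (auto simp: kill_def intro: order_trans[OF abs_ge_zero])

text \<open>The Markov property, extended from events to non-negative functions by two monotone class
  arguments.\<close>

lemma markov_nn:
  fixes Y :: "'w \<Rightarrow> ennreal" and g :: "'e \<Rightarrow> ennreal"
  assumes st: "0 \<le> s" "0 \<le> t"
    and Y: "Y \<in> borel_measurable (natural_filtration W \<xi> \<zeta> s)"
    and g: "g \<in> borel_measurable borel"
  shows "(\<integral>\<^sup>+\<omega>. Y \<omega> * kill g (s + t) \<omega> \<partial>Law x) =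
    (\<integral>\<^sup>+\<omega>. Y \<omega> * kill (\<lambda>y. \<integral>\<^sup>+z. g z \<partial>P t y) s \<omega> \<partial>Law x)"
proof -
  have kill_nn: "kill (\<lambda>y. \<integral>\<^sup>+z. h z \<partial>P t y) s \<in> borel_measurable W"
    if "h \<in> borel_measurable borel" for h :: "'e \<Rightarrow> ennreal"
    using st that
    by (intro measurable_kill_W measurable_compose[OF P_kernel nn_integral_measurable_subprob_algebra]) auto
  have kill_m: "kill h (s + t) \<in> borel_measurable W" if "h \<in> borel_measurable borel"
    for h :: "'e \<Rightarrow> ennreal"
    using st that by (intro measurable_kill_W) auto
  have on_sets: "(\<integral>\<^sup>+\<omega>. indicator A \<omega> * kill g (s + t) \<omega> \<partial>Law x) =
      (\<integral>\<^sup>+\<omega>. indicator A \<omega> * kill (\<lambda>y. \<integral>\<^sup>+z. g z \<partial>P t y) s \<omega> \<partial>Law x)"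
    if A: "A \<in> sets (natural_filtration W \<xi> \<zeta> s)" for A
  proof -
    have A_W: "A \<in> sets W" using A natural_filtration_subset by blast
    show ?thesis
      using g
    proof (induction rule: borel_measurable_induct)
      case (cong f g)
      then have "f = g" by auto
      with cong show ?case by simp
    next
      case (set B)
      have ev: "A \<inter> proc_event W \<xi> \<zeta> (s + t) B \<in> sets W"
        using set st A_W by (intro sets.Int proc_event_sets) auto
      have "(\<integral>\<^sup>+\<omega>. indicator A \<omega> * kill (indicator B) (s + t) \<omega> \<partial>Law x)
          = (\<integral>\<^sup>+\<omega>. indicator (A \<inter> proc_event W \<xi> \<zeta> (s + t) B) \<omega> \<partial>Law x)"
        by (intro nn_integral_cong) (auto simp: kill_def proc_event_def split: split_indicator)
      also have "\<dots> = emeasure (Law x) (A \<inter> proc_event W \<xi> \<zeta> (s + t) B)"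
        using ev by simp
      also have "\<dots> = (\<integral>\<^sup>+\<omega>. emeasure (P t (\<xi> s \<omega>)) B * indicator (A \<inter> proc_event W \<xi> \<zeta> s UNIV) \<omega> \<partial>Law x)"
        using set st A by (intro markov) auto
      also have "\<dots> = (\<integral>\<^sup>+\<omega>. indicator A \<omega> * kill (\<lambda>y. \<integral>\<^sup>+z. indicator B z \<partial>P t y) s \<omega> \<partial>Law x)"
        using set st
        by (intro nn_integral_cong)
          (auto simp: kill_def proc_event_def sets_P split: split_indicator)
      finally show ?case .
    next
      case (mult u c)
      have "(\<integral>\<^sup>+\<omega>. indicator A \<omega> * kill (\<lambda>z. c * u z) (s + t) \<omega> \<partial>Law x)
          = c * (\<integral>\<^sup>+\<omega>. indicator A \<omega> * kill u (s + t) \<omega> \<partial>Law x)"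
        using kill_m[OF mult(2)] A_W
        by (subst nn_integral_cmult[symmetric]) (auto simp: kill_cmult ac_simps)
      also have "\<dots> = c * (\<integral>\<^sup>+\<omega>. indicator A \<omega> * kill (\<lambda>y. \<integral>\<^sup>+z. u z \<partial>P t y) s \<omega> \<partial>Law x)"
        using mult by simp
      also have "\<dots> = (\<integral>\<^sup>+\<omega>. c * (indicator A \<omega> * kill (\<lambda>y. \<integral>\<^sup>+z. u z \<partial>P t y) s \<omega>) \<partial>Law x)"
        using kill_nn[OF mult(2)] A_W
        by (subst nn_integral_cmult) auto
      also have "\<dots> = (\<integral>\<^sup>+\<omega>. indicator A \<omega> * kill (\<lambda>y. \<integral>\<^sup>+z. c * u z \<partial>P t y) s \<omega> \<partial>Law x)"
        using mult(2) st
        by (intro nn_integral_cong) (simp add: kill_def nn_integral_cmult sets_P ac_simps cong: measurable_cong_sets)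
      finally show ?case .
    next
      case (add u v)
      have "(\<integral>\<^sup>+\<omega>. indicator A \<omega> * kill (\<lambda>z. v z + u z) (s + t) \<omega> \<partial>Law x)
          = (\<integral>\<^sup>+\<omega>. indicator A \<omega> * kill v (s + t) \<omega> \<partial>Law x) + (\<integral>\<^sup>+\<omega>. indicator A \<omega> * kill u (s + t) \<omega> \<partial>Law x)"
        using kill_m add A_W
        by (subst nn_integral_add[symmetric]) (auto simp: kill_add distrib_left)
      also have "\<dots> = (\<integral>\<^sup>+\<omega>. indicator A \<omega> * kill (\<lambda>y. \<integral>\<^sup>+z. v z \<partial>P t y) s \<omega>
          + indicator A \<omega> * kill (\<lambda>y. \<integral>\<^sup>+z. u z \<partial>P t y) s \<omega> \<partial>Law x)"
        using kill_nn add A_W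
        by (subst nn_integral_add) auto
      also have "\<dots> = (\<integral>\<^sup>+\<omega>. indicator A \<omega> * kill (\<lambda>y. \<integral>\<^sup>+z. v z + u z \<partial>P t y) s \<omega> \<partial>Law x)"
        using add st
        by (intro nn_integral_cong)
          (simp add: kill_def nn_integral_add sets_P distrib_left cong: measurable_cong_sets)
      finally show ?case .
    next
      case (seq U)
      have inc1: "incseq (\<lambda>i \<omega>. indicator A \<omega> * kill (U i) (s + t) \<omega>)"
        using seq(3) by (auto simp: incseq_def le_fun_def kill_def intro!: mult_left_mono)
      have inc2: "incseq (\<lambda>i \<omega>. indicator A \<omega> * kill (\<lambda>y. \<integral>\<^sup>+z. U i z \<partial>P t y) s \<omega>)"
        using seq(3)
        by (auto simp: incseq_def le_fun_def kill_def intro!: mult_left_mono nn_integral_mono)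
      have "(\<integral>\<^sup>+\<omega>. indicator A \<omega> * kill (SUP i. U i) (s + t) \<omega> \<partial>Law x)
          = (\<integral>\<^sup>+\<omega>. (SUP i. indicator A \<omega> * kill (U i) (s + t) \<omega>) \<partial>Law x)"
        by (intro nn_integral_cong) (auto simp: kill_def SUP_mult_left_ennreal image_comp split: split_indicator)
      also have "\<dots> = (SUP i. \<integral>\<^sup>+\<omega>. indicator A \<omega> * kill (U i) (s + t) \<omega> \<partial>Law x)"
        using kill_m seq(1) A_W
        by (intro nn_integral_monotone_convergence_SUP inc1) auto
      also have "\<dots> = (SUP i. \<integral>\<^sup>+\<omega>. indicator A \<omega> * kill (\<lambda>y. \<integral>\<^sup>+z. U i z \<partial>P t y) s \<omega> \<partial>Law x)"
        using seq by simp
      also have "\<dots> = (\<integral>\<^sup>+\<omega>. (SUP i. indicator A \<omega> * kill (\<lambda>y. \<integral>\<^sup>+z. U i z \<partial>P t y) s \<omega>) \<partial>Law x)"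
        using kill_nn seq(1) A_W
        by (intro nn_integral_monotone_convergence_SUP[symmetric] inc2) auto
      also have "\<dots> = (\<integral>\<^sup>+\<omega>. indicator A \<omega> * kill (\<lambda>y. \<integral>\<^sup>+z. (SUP i. U i) z \<partial>P t y) s \<omega> \<partial>Law x)"
      proof (intro nn_integral_cong)
        fix \<omega>
        have "(\<integral>\<^sup>+z. (SUP i. U i) z \<partial>P t y) = (SUP i. \<integral>\<^sup>+z. U i z \<partial>P t y)" for y
          using seq(1,3) st
          by (simp add: image_comp nn_integral_monotone_convergence_SUP sets_P cong: measurable_cong_sets)
        then show "(SUP i. indicator A \<omega> * kill (\<lambda>y. \<integral>\<^sup>+z. U i z \<partial>P t y) s \<omega>)
            = indicator A \<omega> * kill (\<lambda>y. \<integral>\<^sup>+z. (SUP i. U i) z \<partial>P t y) s \<omega>"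
          by (auto simp: kill_def SUP_mult_left_ennreal split: split_indicator)
      qed
      finally show ?case .
    qed
  qed
  note m = kill_m[OF g] kill_nn[OF g]
  show ?thesis
    using Y
  proof (induction rule: borel_measurable_induct)
    case (cong f f')
    have "(\<integral>\<^sup>+\<omega>. f \<omega> * k \<omega> \<partial>Law x) = (\<integral>\<^sup>+\<omega>. f' \<omega> * k \<omega> \<partial>Law x)" for k
      using cong(3) by (intro nn_integral_cong) simp
    with cong(4) show ?case by simp
  next
    case (set A)
    then show ?case by (rule on_sets)
  next
    case (mult u c)
    have u: "u \<in> borel_measurable W" using mult(2) by (rule measurable_natural_filtration)
    have "(\<integral>\<^sup>+\<omega>. c * u \<omega> * k \<omega> \<partial>Law x) = c * (\<integral>\<^sup>+\<omega>. u \<omega> * k \<omega> \<partial>Law x)"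
      if "k \<in> borel_measurable W" for k
      using u that by (subst nn_integral_cmult[symmetric]) (auto simp: ac_simps)
    with m mult show ?case by simp
  next
    case (add u v)
    have uv: "u \<in> borel_measurable W" "v \<in> borel_measurable W"
      using add by (auto intro: measurable_natural_filtration)
    have "(\<integral>\<^sup>+\<omega>. (v \<omega> + u \<omega>) * k \<omega> \<partial>Law x)
        = (\<integral>\<^sup>+\<omega>. v \<omega> * k \<omega> \<partial>Law x) + (\<integral>\<^sup>+\<omega>. u \<omega> * k \<omega> \<partial>Law x)"
      if "k \<in> borel_measurable W" for k
      using uv that by (subst nn_integral_add[symmetric]) (auto simp: distrib_right)
    with m add show ?case by simp
  next
    case (seq U)
    have U: "U i \<in> borel_measurable W" for i
      using seq(1) by (rule measurable_natural_filtration)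
    have "(\<integral>\<^sup>+\<omega>. (SUP i. U i) \<omega> * k \<omega> \<partial>Law x) = (SUP i. \<integral>\<^sup>+\<omega>. U i \<omega> * k \<omega> \<partial>Law x)"
      if k: "k \<in> borel_measurable W" for k
    proof -
      have "(\<integral>\<^sup>+\<omega>. (SUP i. U i) \<omega> * k \<omega> \<partial>Law x) = (\<integral>\<^sup>+\<omega>. (SUP i. U i \<omega> * k \<omega>) \<partial>Law x)"
        by (simp add: SUP_mult_right_ennreal image_comp)
      also have "\<dots> = (SUP i. \<integral>\<^sup>+\<omega>. U i \<omega> * k \<omega> \<partial>Law x)"
        using U k seq(3)
        by (intro nn_integral_monotone_convergence_SUP)
          (auto simp: incseq_def le_fun_def intro!: mult_right_mono)
      finally show ?thesis .
    qed
    with m seq show ?case by simp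
  qed
qed

lemma integral_P_bound:
  fixes g :: "'e \<Rightarrow> real"
  assumes "0 \<le> t" "g \<in> borel_measurable borel" "\<And>y. \<bar>g y\<bar> \<le> K"
  shows "\<bar>\<integral>z. g z \<partial>P t x\<bar> \<le> K" and "integrable (P t x) g"
proof -
  interpret subprob_space "P t x" using assms(1) by (rule subprob_P)
  have K: "0 \<le> K" using assms(3) abs_ge_zero order_trans by blast
  show int: "integrable (P t x) g"
    using assms by (intro integrable_const_bound[of _ K]) (auto simp: sets_P cong: measurable_cong_sets)
  have "\<bar>\<integral>z. g z \<partial>P t x\<bar> \<le> (\<integral>z. \<bar>g z\<bar> \<partial>P t x)"
    using integral_norm_bound[of "P t x" g] by simp
  also have "\<dots> \<le> (\<integral>z. K \<partial>P t x)"
    using int assms(3) by (intro integral_mono) auto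
  also have "\<dots> \<le> K"
    using K subprob_measure_le_1[of "space (P t x)"] by (simp add: mult_left_le mult.commute)
  finally show "\<bar>\<integral>z. g z \<partial>P t x\<bar> \<le> K" .
qed

lemma measurable_integral_P:
  "0 \<le> t \<Longrightarrow> g \<in> borel_measurable borel \<Longrightarrow> (\<lambda>y. \<integral>z. g z \<partial>P t y :: real) \<in> borel_measurable borel"
  by (rule measurable_compose[OF P_kernel integral_measurable_subprob_algebra])

lemma markov_nonneg:
  fixes Y :: "'w \<Rightarrow> real" and g :: "'e \<Rightarrow> real"
  assumes st: "0 \<le> s" "0 \<le> t"
    and Y: "Y \<in> borel_measurable (natural_filtration W \<xi> \<zeta> s)" "\<And>\<omega>. 0 \<le> Y \<omega>"
    and g: "g \<in> borel_measurable borel" "\<And>y. 0 \<le> g y" "\<And>y. \<bar>g y\<bar> \<le> d"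
  shows "(\<integral>\<omega>. Y \<omega> * kill g (s + t) \<omega> \<partial>Law x) =
    (\<integral>\<omega>. Y \<omega> * kill (\<lambda>y. \<integral>z. g z \<partial>P t y) s \<omega> \<partial>Law x :: real)"
proof -
  have YW: "Y \<in> borel_measurable W" using Y(1) by (rule measurable_natural_filtration)
  have k1: "kill g (s + t) \<in> borel_measurable W"
    using st g by (intro measurable_kill_W) auto
  have k2: "kill (\<lambda>y. \<integral>z. g z \<partial>P t y) s \<in> borel_measurable W"
    using st g by (intro measurable_kill_W measurable_integral_P) auto
  have kill_ennreal: "ennreal (kill h r \<omega>) = kill (\<lambda>y. ennreal (h y)) r \<omega>" for h :: "'e \<Rightarrow> real" and r \<omega>
    by (simp add: kill_def)
  have P_nn: "ennreal (\<integral>z. g z \<partial>P t y) = (\<integral>\<^sup>+z. ennreal (g z) \<partial>P t y)" for y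
    using integral_P_bound(2)[OF st(2) g(1,3)]
    by (rule nn_integral_eq_integral[symmetric]) (simp add: g(2))
  have "(\<integral>\<^sup>+\<omega>. ennreal (Y \<omega> * kill g (s + t) \<omega>) \<partial>Law x)
      = (\<integral>\<^sup>+\<omega>. ennreal (Y \<omega>) * kill (\<lambda>y. ennreal (g y)) (s + t) \<omega> \<partial>Law x)"
    using Y by (intro nn_integral_cong) (simp add: ennreal_mult' kill_ennreal)
  also have "\<dots> = (\<integral>\<^sup>+\<omega>. ennreal (Y \<omega>) * kill (\<lambda>y. \<integral>\<^sup>+z. ennreal (g z) \<partial>P t y) s \<omega> \<partial>Law x)"
    using st Y g by (intro markov_nn) auto
  also have "\<dots> = (\<integral>\<^sup>+\<omega>. ennreal (Y \<omega> * kill (\<lambda>y. \<integral>z. g z \<partial>P t y) s \<omega>) \<partial>Law x)"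
    using Y by (intro nn_integral_cong) (simp add: ennreal_mult' kill_ennreal P_nn)
  finally have eq: "(\<integral>\<^sup>+\<omega>. ennreal (Y \<omega> * kill g (s + t) \<omega>) \<partial>Law x)
      = (\<integral>\<^sup>+\<omega>. ennreal (Y \<omega> * kill (\<lambda>y. \<integral>z. g z \<partial>P t y) s \<omega>) \<partial>Law x)" .
  have "0 \<le> kill g (s + t) \<omega>" "0 \<le> kill (\<lambda>y. \<integral>z. g z \<partial>P t y) s \<omega>" for \<omega>
    using g by (auto simp: kill_def)
  then show ?thesis
    using eq YW k1 k2 Y(2) by (subst (1 2) integral_eq_nn_integral) auto
qed

lemma integrable_Law:
  fixes f :: "'w \<Rightarrow> real"
  assumes "f \<in> borel_measurable W" "\<And>\<omega>. \<bar>f \<omega>\<bar> \<le> K"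
  shows "integrable (Law x) f"
proof -
  interpret prob_space "Law x" by (rule prob_Law)
  show ?thesis using assms by (intro integrable_const_bound[of _ K]) auto
qed

text \<open>The Markov property for bounded functionals of the past.\<close>

lemma markov_bounded:
  fixes Y :: "'w \<Rightarrow> real" and g :: "'e \<Rightarrow> real"
  assumes st: "0 \<le> s" "0 \<le> t"
    and Y: "Y \<in> borel_measurable (natural_filtration W \<xi> \<zeta> s)" "\<And>\<omega>. \<bar>Y \<omega>\<bar> \<le> c"
    and g: "g \<in> borel_measurable borel" "\<And>y. \<bar>g y\<bar> \<le> d"
  shows "(\<integral>\<omega>. Y \<omega> * kill g (s + t) \<omega> \<partial>Law x) =
    (\<integral>\<omega>. Y \<omega> * kill (\<lambda>y. \<integral>z. g z \<partial>P t y) s \<omega> \<partial>Law x :: real)"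
proof -
  have prod_int: "integrable (Law x) (\<lambda>\<omega>. Z \<omega> * kill h r \<omega>)"
    if "0 \<le> r" "Z \<in> borel_measurable (natural_filtration W \<xi> \<zeta> s)" "\<And>\<omega>. \<bar>Z \<omega>\<bar> \<le> c'"
      "h \<in> borel_measurable borel" "\<And>y. \<bar>h y\<bar> \<le> d'" for Z :: "'w \<Rightarrow> real" and h r c' d'
  proof (rule integrable_Law)
    show "(\<lambda>\<omega>. Z \<omega> * kill h r \<omega>) \<in> borel_measurable W"
      using that by (intro borel_measurable_times measurable_natural_filtration measurable_kill_W)
    show "\<bar>Z \<omega> * kill h r \<omega>\<bar> \<le> c' * d'" for \<omega>
      unfolding abs_mult using that kill_bound[of h d' r \<omega>] abs_ge_zero[of "Z \<omega>"]
      by (intro mult_mono) (auto intro: order_trans[OF abs_ge_zero])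
  qed
  \<comment> \<open>signs are removed by adding a constant, first to the function and then to the functional\<close>
  have nonneg: "(\<integral>\<omega>. Z \<omega> * kill g (s + t) \<omega> \<partial>Law x) =
    (\<integral>\<omega>. Z \<omega> * kill (\<lambda>y. \<integral>z. g z \<partial>P t y) s \<omega> \<partial>Law x)"
    if Z: "Z \<in> borel_measurable (natural_filtration W \<xi> \<zeta> s)" "\<And>\<omega>. 0 \<le> Z \<omega>" "\<And>\<omega>. \<bar>Z \<omega>\<bar> \<le> c'" for Z :: "'w \<Rightarrow> real" and c'
  proof -
    define g' where "g' y = g y + d" for y
    have g'_meas: "g' \<in> borel_measurable borel" using g(1) unfolding g'_def by simp
    have g'_nn: "0 \<le> g' y" for y using g(2)[of y] by (simp add: g'_def)
    have g'_bd: "\<bar>g' y\<bar> \<le> 2 * d" for y using g(2)[of y] by (simp add: g'_def)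
    have d: "0 \<le> d" using g(2) abs_ge_zero order_trans by blast
    have "kill g r \<omega> = kill g' r \<omega> - kill (\<lambda>_. d) r \<omega>" for r \<omega> by (simp add: kill_def g'_def)
    then have "(\<integral>\<omega>. Z \<omega> * kill g (s + t) \<omega> \<partial>Law x)
        = (\<integral>\<omega>. Z \<omega> * kill g' (s + t) \<omega> - Z \<omega> * kill (\<lambda>_. d) (s + t) \<omega> \<partial>Law x)"
      by (simp add: right_diff_distrib)
    also have "\<dots> = (\<integral>\<omega>. Z \<omega> * kill g' (s + t) \<omega> \<partial>Law x) - (\<integral>\<omega>. Z \<omega> * kill (\<lambda>_. d) (s + t) \<omega> \<partial>Law x)"
      using st Z g'_meas g'_bd d
      by (intro Bochner_Integration.integral_diff prod_int[of _ _ _ _ "2 * d"] prod_int[of _ _ _ _ d]) auto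
    also have "\<dots> = (\<integral>\<omega>. Z \<omega> * kill (\<lambda>y. \<integral>z. g' z \<partial>P t y) s \<omega> \<partial>Law x)
        - (\<integral>\<omega>. Z \<omega> * kill (\<lambda>y. \<integral>z. d \<partial>P t y) s \<omega> \<partial>Law x)"
      using markov_nonneg[OF st Z(1,2) g'_meas g'_nn g'_bd, of x]
        markov_nonneg[OF st Z(1,2), of "\<lambda>_. d" d x] d by simp
    also have "\<dots> = (\<integral>\<omega>. Z \<omega> * kill (\<lambda>y. \<integral>z. g' z \<partial>P t y) s \<omega>
        - Z \<omega> * kill (\<lambda>y. \<integral>z. d \<partial>P t y) s \<omega> \<partial>Law x)"
      using st Z g'_meas g'_bd d
      by (intro Bochner_Integration.integral_diff[symmetric] prod_int[of _ _ _ _ "2 * d"]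
          prod_int[of _ _ _ _ d] measurable_integral_P integral_P_bound(1)) auto
    also have "\<dots> = (\<integral>\<omega>. Z \<omega> * kill (\<lambda>y. \<integral>z. g z \<partial>P t y) s \<omega> \<partial>Law x)"
    proof -
      have "(\<integral>z. g' z \<partial>P t y) - (\<integral>z. d \<partial>P t y) = (\<integral>z. g z \<partial>P t y)" for y
        using st g'_meas g'_bd d
        by (subst Bochner_Integration.integral_diff[symmetric])
          (auto intro: integral_P_bound(2)[where K = "2 * d"] integral_P_bound(2)[where K = d] simp: g'_def)
      then have "kill (\<lambda>y. \<integral>z. g' z \<partial>P t y) s \<omega> - kill (\<lambda>y. \<integral>z. d \<partial>P t y) s \<omega>
          = kill (\<lambda>y. \<integral>z. g z \<partial>P t y) s \<omega>" for \<omega>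
        by (simp add: kill_def)
      then show ?thesis by (simp add: right_diff_distrib[symmetric])
    qed
    finally show ?thesis .
  qed
  have c: "0 \<le> c" using Y(2) abs_ge_zero order_trans by blast
  have Y0: "0 \<le> Y \<omega> + c" "\<bar>Y \<omega> + c\<bar> \<le> 2 * c" for \<omega> using Y(2)[of \<omega>] by auto
  have split: "(\<integral>\<omega>. Y \<omega> * kill h r \<omega> \<partial>Law x)
      = (\<integral>\<omega>. (Y \<omega> + c) * kill h r \<omega> \<partial>Law x) - (\<integral>\<omega>. c * kill h r \<omega> \<partial>Law x)"
    if "0 \<le> r" "h \<in> borel_measurable borel" "\<And>y. \<bar>h y\<bar> \<le> d" for h r
  proof -
    have "integrable (Law x) (\<lambda>\<omega>. (Y \<omega> + c) * kill h r \<omega>)"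
      using that Y Y0 by (intro prod_int[of _ _ "2 * c" _ d]) auto
    moreover have "integrable (Law x) (\<lambda>\<omega>. c * kill h r \<omega>)"
      using that c by (intro prod_int[of _ _ c _ d]) auto
    ultimately show ?thesis
      by (subst Bochner_Integration.integral_diff[symmetric]) (auto simp: algebra_simps)
  qed
  have eq1: "(\<integral>\<omega>. (Y \<omega> + c) * kill g (s + t) \<omega> \<partial>Law x)
      = (\<integral>\<omega>. (Y \<omega> + c) * kill (\<lambda>y. \<integral>z. g z \<partial>P t y) s \<omega> \<partial>Law x)"
    using Y(1) Y0 by (intro nonneg[of _ "2 * c"]) auto
  have eq2: "(\<integral>\<omega>. c * kill g (s + t) \<omega> \<partial>Law x)
      = (\<integral>\<omega>. c * kill (\<lambda>y. \<integral>z. g z \<partial>P t y) s \<omega> \<partial>Law x)"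
    using c by (intro nonneg[of _ c]) auto
  show ?thesis
    using split[of "s + t" g] split[OF st(1) measurable_integral_P[OF st(2) g(1)] integral_P_bound(1)[OF st(2) g]]
      st g unfolding eq1 eq2 by simp
qed

lemma integral_P_eq_Law:
  fixes g :: "'e \<Rightarrow> real"
  assumes "0 \<le> t" "g \<in> borel_measurable borel" "\<And>y. \<bar>g y\<bar> \<le> K"
  shows "(\<integral>z. g z \<partial>P t x) = (\<integral>\<omega>. kill g t \<omega> \<partial>Law x)"
proof -
  interpret prob_space "Law x" by (rule prob_Law)
  have "(\<integral>\<omega>. kill g t \<omega> \<partial>Law x) = (\<integral>\<omega>. kill (\<lambda>y. \<integral>z. g z \<partial>P t y) 0 \<omega> \<partial>Law x)"
    using markov_bounded[of 0 t "\<lambda>_. 1" 1 g K x] assms by simp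
  also have "\<dots> = (\<integral>\<omega>. (\<integral>z. g z \<partial>P t x) \<partial>Law x)"
  proof (rule integral_cong_AE)
    show "kill (\<lambda>y. \<integral>z. g z \<partial>P t y) 0 \<in> borel_measurable (Law x)"
      using measurable_kill_W[OF order_refl measurable_integral_P[OF assms(1,2)]] by simp
    show "AE \<omega> in Law x. kill (\<lambda>y. \<integral>z. g z \<partial>P t y) 0 \<omega> = (\<integral>z. g z \<partial>P t x)"
      using start[of x] by eventually_elim (simp add: kill_def zero_ereal_def)
  qed simp
  finally show ?thesis using prob_space by simp
qed

section \<open>The Feynman-Kac formula\<close>

lemma measurable_kill_param:
  fixes g :: "'x \<Rightarrow> 'e \<Rightarrow> real"
  assumes s: "0 \<le> s"
    and g [measurable]: "(\<lambda>(r, y). g r y) \<in> borel_measurable (N \<Otimes>\<^sub>M borel)"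
  shows "(\<lambda>(r, \<omega>). kill (g r) s \<omega>) \<in> borel_measurable (N \<Otimes>\<^sub>M W)"
proof -
  let ?M = "N \<Otimes>\<^sub>M W"
  have ev: "{p \<in> space ?M. ereal s < \<zeta> (snd p) \<and> \<xi> s (snd p) \<in> B} \<in> sets ?M" if "B \<in> sets borel" for B
  proof -
    have "space N \<times> proc_event W \<xi> \<zeta> s B \<in> sets ?M"
      using that s by (intro pair_measureI proc_event_sets) auto
    also have "space N \<times> proc_event W \<xi> \<zeta> s B
        = {p \<in> space ?M. ereal s < \<zeta> (snd p) \<and> \<xi> s (snd p) \<in> B}"
      by (auto simp: proc_event_def space_pair_measure)
    finally show ?thesis .
  qed
  have alive: "{p \<in> space ?M. ereal s < \<zeta> (snd p)} \<in> sets ?M"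
    using ev[of UNIV] by simp
  have [measurable]: "(\<lambda>p. \<xi> s (snd p)) \<in> restrict_space ?M {p. ereal s < \<zeta> (snd p)} \<rightarrow>\<^sub>M borel"
  proof (rule measurableI)
    fix B :: "'e set" assume "B \<in> sets borel"
    then have "{p \<in> space ?M. ereal s < \<zeta> (snd p) \<and> \<xi> s (snd p) \<in> B} \<in> sets ?M" by (rule ev)
    moreover have "{p \<in> space ?M. ereal s < \<zeta> (snd p) \<and> \<xi> s (snd p) \<in> B}
        = {p. ereal s < \<zeta> (snd p)} \<inter> {p \<in> space ?M. ereal s < \<zeta> (snd p) \<and> \<xi> s (snd p) \<in> B}"
      by auto
    moreover have "(\<lambda>p. \<xi> s (snd p)) -` B \<inter> space (restrict_space ?M {p. ereal s < \<zeta> (snd p)})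
        = {p \<in> space ?M. ereal s < \<zeta> (snd p) \<and> \<xi> s (snd p) \<in> B}"
      by (auto simp: space_restrict_space)
    ultimately show "(\<lambda>p. \<xi> s (snd p)) -` B \<inter> space (restrict_space ?M {p. ereal s < \<zeta> (snd p)})
        \<in> sets (restrict_space ?M {p. ereal s < \<zeta> (snd p)})"
      unfolding sets_restrict_space by auto
  qed simp
  have [measurable]: "fst \<in> restrict_space ?M {p. ereal s < \<zeta> (snd p)} \<rightarrow>\<^sub>M N"
    by (intro measurable_restrict_space1 measurable_fst)
  have "(\<lambda>p. (\<lambda>(r, y). g r y) (fst p, \<xi> s (snd p)))
      \<in> borel_measurable (restrict_space ?M {p. ereal s < \<zeta> (snd p)})"
    by measurable
  then have "(\<lambda>p. if ereal s < \<zeta> (snd p) then g (fst p) (\<xi> s (snd p)) else 0) \<in> borel_measurable ?M"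
    unfolding measurable_If_restrict_space_iff[OF alive] by simp
  then show ?thesis by (simp add: kill_def split_beta')
qed

text \<open>Measurability in time and space of the integrals against the transition kernels, which is
  where the right-continuity of the paths enters.\<close>

lemma measurable_integral_P_joint:
  fixes g :: "real \<Rightarrow> 'e \<Rightarrow> real"
  assumes g: "(\<lambda>(r, y). g r y) \<in> borel_measurable (borel \<Otimes>\<^sub>M borel)"
    and K: "\<And>r y. \<bar>g r y\<bar> \<le> K" and t: "0 \<le> t"
  shows "(\<lambda>(r, y). if 0 \<le> r \<and> r \<le> t then \<integral>z. g r z \<partial>P r y else 0) \<in> borel_measurable (borel \<Otimes>\<^sub>M borel)"
proof -
  have K0: "0 \<le> K" using K abs_ge_zero order_trans by blast
  have "(\<lambda>p. \<integral>\<omega>. (if 0 \<le> fst p \<and> fst p \<le> t then kill (g (fst p)) (fst p) \<omega> else 0) \<partial>Law (snd p))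
      \<in> borel_measurable (borel \<Otimes>\<^sub>M borel)"
  proof (rule integral_measurable_subprob_algebra2[where N = W])
    have "(\<lambda>q. (\<lambda>(s, \<omega>). if 0 \<le> s \<and> s \<le> t then kill (g s) s \<omega> else 0) (fst (fst q), snd q))
        \<in> borel_measurable ((borel \<Otimes>\<^sub>M borel) \<Otimes>\<^sub>M W)"
      by (rule measurable_compose[OF _ measurable_kill_joint_W[OF g t]]) measurable
    then show "(\<lambda>(p, \<omega>). if 0 \<le> fst p \<and> fst p \<le> t then kill (g (fst p)) (fst p) \<omega> else 0)
        \<in> borel_measurable ((borel \<Otimes>\<^sub>M borel) \<Otimes>\<^sub>M W)"
      by (simp add: split_beta' cong: if_cong)
  qed measurable
  moreover have "(\<integral>\<omega>. (if 0 \<le> fst p \<and> fst p \<le> t then kill (g (fst p)) (fst p) \<omega> else 0) \<partial>Law (snd p))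
      = (\<lambda>(r, y). if 0 \<le> r \<and> r \<le> t then \<integral>z. g r z \<partial>P r y else 0) p" for p
  proof (cases "0 \<le> fst p \<and> fst p \<le> t")
    case True
    have "g (fst p) \<in> borel_measurable borel"
      using measurable_compose[OF measurable_Pair1' g, of "fst p"] by simp
    with True K show ?thesis
      by (simp add: integral_P_eq_Law[where K = K] split_beta')
  qed (auto simp: split_beta')
  ultimately show ?thesis by simp
qed

text \<open>The Feynman-Kac formula: the bounded solution of the linear equation with potential \<open>\<beta>\<close> is
  the expectation of \<open>f\<close> along the motion weighted by \<open>exp (\<integral> \<beta>)\<close>.  The equation is inserted at
  the position of the motion at time \<open>s\<close> and integrated over \<open>s\<close> against \<open>\<beta> exp (\<integral>\<^sub>0\<^sup>s \<beta>)\<close>; after an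
  exchange of integrals everything but the claim cancels.\<close>

proposition feynman_kac:
  fixes m :: "real \<Rightarrow> 'e \<Rightarrow> real"
  assumes t: "0 \<le> t" and \<beta>: "\<beta> \<in> bdd_borel" and f: "f \<in> bdd_borel"
    and m: "(\<lambda>(s, y). m s y) \<in> borel_measurable (borel \<Otimes>\<^sub>M borel)"
    and m_bound: "\<And>s y. \<bar>m s y\<bar> \<le> K"
    and eq: "\<And>s y. 0 \<le> s \<Longrightarrow> s \<le> t \<Longrightarrow>
      m s y = (\<integral>z. f z \<partial>P s y) + (LINT r:{0..s}|lborel. \<integral>z. \<beta> z * m (s - r) z \<partial>P r y)"
  shows "m t x = (\<integral>\<omega>. exp (LINT s:{0..t}|lborel. \<beta> (\<xi> s \<omega>)) * kill f t \<omega> \<partial>Law x)"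
    and "integrable (Law x) (\<lambda>\<omega>. exp (LINT s:{0..t}|lborel. \<beta> (\<xi> s \<omega>)) * kill f t \<omega>)"
proof -
  interpret prob_space "Law x" by (rule prob_Law)
  interpret sigma_finite_measure "Law x" ..
  obtain b where b: "0 < b" "\<And>y. \<bar>\<beta> y\<bar> \<le> b" using bdd_borel_bound[OF \<beta>] by blast
  obtain c where c: "0 < c" "\<And>y. \<bar>f y\<bar> \<le> c" using bdd_borel_bound[OF f] by blast
  have K0: "0 \<le> K" using m_bound abs_ge_zero order_trans by blast
  have \<beta>_meas [measurable]: "\<beta> \<in> borel_measurable borel" and f_meas [measurable]: "f \<in> borel_measurable borel"
    using \<beta> f by (auto intro: bdd_borel_measurable)
  have m_meas [measurable]: "(\<lambda>p. m (fst p) (snd p)) \<in> borel_measurable (borel \<Otimes>\<^sub>M borel)"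
    using m by (simp add: split_beta')
  have m_sec [measurable]: "m s \<in> borel_measurable borel" for s
    using measurable_compose[OF measurable_Pair1' m, of s] by simp
  let ?L = "restrict_space lborel {0..t}"
  \<comment> \<open>along the motion: the potential \<open>a\<close>, its integral \<open>A\<close>, the integrand \<open>\<gamma>\<close> of the equation, the
    terminal value \<open>F\<close> and the derivative \<open>Y\<close> of \<open>exp A\<close>\<close>
  define g where "g s y = \<beta> y * m (t - s) y" for s y
  have g_meas: "(\<lambda>(s, y). g s y) \<in> borel_measurable (borel \<Otimes>\<^sub>M borel)"
  proof -
    have "(\<lambda>p. (\<lambda>p. m (fst p) (snd p)) (t - fst p, snd p)) \<in> borel_measurable (borel \<Otimes>\<^sub>M borel)"
      by (rule measurable_compose[OF _ m_meas]) measurable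
    then show ?thesis unfolding g_def split_beta' by simp
  qed
  have g_sec: "g s \<in> borel_measurable borel" for s unfolding g_def by measurable
  have g_bound: "\<bar>g s y\<bar> \<le> b * K" for s y
    unfolding g_def abs_mult using b m_bound by (intro mult_mono) auto
  have bK: "0 \<le> b * K" using b K0 by simp
  define a where "a s \<omega> = (if 0 \<le> s \<and> s \<le> t then kill \<beta> s \<omega> else 0)" for s \<omega>
  define A where "A s \<omega> = (LINT u:{0..s}|lborel. a u \<omega>)" for s \<omega>
  define \<gamma> where "\<gamma> s \<omega> = (if 0 \<le> s \<and> s \<le> t then kill (g s) s \<omega> else 0)" for s \<omega>
  define F where "F = kill f t"
  define Y where "Y s \<omega> = (if 0 \<le> s \<and> s \<le> t then exp (A s \<omega>) * a s \<omega> else 0)" for s \<omega>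
  define B where "B = exp (b * t) * b"
  have B0: "0 \<le> B" using b by (simp add: B_def)
  have a_meas: "(\<lambda>(s, \<omega>). a s \<omega>) \<in> borel_measurable (borel \<Otimes>\<^sub>M W)"
    unfolding a_def using t by (intro measurable_kill_joint_W) auto
  have a_meas' [measurable (raw)]: "(\<lambda>x. a (p x) (q x)) \<in> borel_measurable N"
    if "p \<in> borel_measurable N" "q \<in> N \<rightarrow>\<^sub>M W" for N :: "'n measure" and p q
    using measurable_compose[OF measurable_Pair[OF that] a_meas] by simp
  have \<gamma>_meas: "(\<lambda>(s, \<omega>). \<gamma> s \<omega>) \<in> borel_measurable (borel \<Otimes>\<^sub>M W)"
    using measurable_kill_joint_W[OF g_meas t] by (simp add: \<gamma>_def)
  have F_meas [measurable]: "F \<in> borel_measurable W"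
    unfolding F_def using t by (intro measurable_kill_W) auto
  have a_path: "(\<lambda>s. a s \<omega>) \<in> borel_measurable borel" if "\<omega> \<in> space W" for \<omega>
    using measurable_compose[OF measurable_Pair2'[OF that] a_meas] by simp
  have a_bound: "\<bar>a s \<omega>\<bar> \<le> b" for s \<omega>
    using b kill_bound[of \<beta> b s \<omega>] by (simp add: a_def)
  have A_meas: "(\<lambda>(s, \<omega>). A s \<omega>) \<in> borel_measurable (borel \<Otimes>\<^sub>M W)"
    unfolding A_def set_lebesgue_integral_def indicator_def atLeastAtMost_iff split_beta'
    by measurable
  have A_bound: "\<bar>A s \<omega>\<bar> \<le> b * t" if "0 \<le> s" "s \<le> t" "\<omega> \<in> space W" for s \<omega>
  proof -
    have "\<bar>A s \<omega>\<bar> \<le> b * measure lborel {0..s}"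
      unfolding A_def using that a_bound by (intro set_integral_bound a_path) auto
    also have "\<dots> \<le> b * t" using that b by (simp add: mult_left_mono)
    finally show ?thesis .
  qed
  have Y_meas: "(\<lambda>(s, \<omega>). Y s \<omega>) \<in> borel_measurable (borel \<Otimes>\<^sub>M W)"
    using A_meas a_meas unfolding Y_def split_beta' by measurable
  have Y_bound: "\<bar>Y s \<omega>\<bar> \<le> B" if "\<omega> \<in> space W" for s \<omega>
  proof (cases "0 \<le> s \<and> s \<le> t")
    case True
    with A_bound[of s \<omega>] that have "exp (A s \<omega>) \<le> exp (b * t)" by simp
    with True a_bound[of s \<omega>] show ?thesis
      unfolding Y_def B_def by (auto simp: abs_mult intro: mult_mono)
  next
    case False
    then have "Y s \<omega> = 0" by (auto simp: Y_def)
    then show ?thesis using B0 by simp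
  qed
  have \<gamma>_bound: "\<bar>\<gamma> s \<omega>\<bar> \<le> b * K" for s \<omega>
    using kill_bound[of "g s" "b * K" s \<omega>] g_bound bK by (simp add: \<gamma>_def)
  have F_bound: "\<bar>F \<omega>\<bar> \<le> c" for \<omega> unfolding F_def using c by (intro kill_bound)
  have A_adapted: "A s \<in> borel_measurable (natural_filtration W \<xi> \<zeta> s)" if s: "0 \<le> s" "s \<le> t" for s
  proof -
    have "(\<lambda>(u, \<omega>). if 0 \<le> u \<and> u \<le> s then kill \<beta> u \<omega> else 0)
        \<in> borel_measurable (borel \<Otimes>\<^sub>M natural_filtration W \<xi> \<zeta> s)"
      using s by (intro measurable_kill_joint proc_event_natural_filtration) auto
    then have [measurable]: "(\<lambda>p. if 0 \<le> fst p \<and> fst p \<le> s then kill \<beta> (fst p) (snd p) else 0)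
        \<in> borel_measurable (borel \<Otimes>\<^sub>M natural_filtration W \<xi> \<zeta> s)"
      by (simp add: split_beta')
    have "(\<lambda>p. (\<lambda>p. if 0 \<le> fst p \<and> fst p \<le> s then kill \<beta> (fst p) (snd p) else 0) (snd p, fst p))
        \<in> borel_measurable (natural_filtration W \<xi> \<zeta> s \<Otimes>\<^sub>M lborel)"
      by measurable
    then have "(\<lambda>\<omega>. \<integral>u. (if 0 \<le> u \<and> u \<le> s then kill \<beta> u \<omega> else 0) \<partial>lborel)
        \<in> borel_measurable (natural_filtration W \<xi> \<zeta> s)"
      by (intro lborel.borel_measurable_lebesgue_integral) (simp add: split_beta' cong: if_cong)
    moreover have "A s \<omega> = (\<integral>u. (if 0 \<le> u \<and> u \<le> s then kill \<beta> u \<omega> else 0) \<partial>lborel)" for \<omega>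
      unfolding A_def set_lebesgue_integral_def a_def
      using s by (intro Bochner_Integration.integral_cong) (auto split: split_indicator)
    ultimately show ?thesis by (simp cong: measurable_cong)
  qed
  have Y_adapted: "Y s \<in> borel_measurable (natural_filtration W \<xi> \<zeta> s)" if s: "0 \<le> s" "s \<le> t" for s
  proof -
    have "kill \<beta> s \<in> borel_measurable (natural_filtration W \<xi> \<zeta> s)"
      using s by (intro measurable_kill_at proc_event_natural_filtration) auto
    then show ?thesis
      unfolding Y_def a_def using A_adapted[OF s] s by simp
  qed
  have raw [measurable (raw)]:
    "(\<lambda>x. \<gamma> (p x) (q x)) \<in> borel_measurable N" "(\<lambda>x. A (p x) (q x)) \<in> borel_measurable N"
    "(\<lambda>x. Y (p x) (q x)) \<in> borel_measurable N"
    if "p \<in> borel_measurable N" "q \<in> N \<rightarrow>\<^sub>M W" for N :: "'n measure" and p q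
    using measurable_compose[OF measurable_Pair[OF that] \<gamma>_meas]
      measurable_compose[OF measurable_Pair[OF that] A_meas]
      measurable_compose[OF measurable_Pair[OF that] Y_meas] by simp_all
  have L_fin: "finite_measure ?L" by (rule finite_restrict_lborel)
  have Law_fin: "finite_measure (Law x)" by unfold_locales
  have space_L: "space ?L = {0..t}" by (simp add: space_restrict_space)
  have id_L [measurable]: "(\<lambda>s. s) \<in> borel_measurable ?L"
    by (rule measurable_restrict_lborel) simp
  have YF_bound: "\<bar>Y s \<omega> * F \<omega>\<bar> \<le> B * c" if "\<omega> \<in> space W" for s \<omega>
    unfolding abs_mult using Y_bound[OF that] F_bound B0 by (intro mult_mono) auto
  have Y\<gamma>_bound: "\<bar>Y s \<omega> * \<gamma> r \<omega>\<bar> \<le> B * (b * K)" if "\<omega> \<in> space W" for s r \<omega>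
    unfolding abs_mult using Y_bound[OF that] \<gamma>_bound B0 by (intro mult_mono) auto
  have E_bound: "\<bar>\<integral>\<omega>. h \<omega> \<partial>Law x\<bar> \<le> C" "integrable (Law x) h"
    if "h \<in> borel_measurable W" "\<And>\<omega>. \<omega> \<in> space W \<Longrightarrow> \<bar>h \<omega>\<bar> \<le> C" for h :: "'w \<Rightarrow> real" and C
  proof -
    show int: "integrable (Law x) h"
      using that by (intro integrable_const_bound[of _ C] AE_I2) auto
    have "\<bar>\<integral>\<omega>. h \<omega> \<partial>Law x\<bar> \<le> (\<integral>\<omega>. \<bar>h \<omega>\<bar> \<partial>Law x)"
      using integral_norm_bound[of "Law x" h] by simp
    also have "\<dots> \<le> (\<integral>\<omega>. C \<partial>Law x)" using int that(2) by (intro integral_mono) auto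
    finally show "\<bar>\<integral>\<omega>. h \<omega> \<partial>Law x\<bar> \<le> C" using prob_space by simp
  qed
  have e\<gamma>_bound: "\<bar>exp (A s \<omega>) * \<gamma> s \<omega>\<bar> \<le> exp (b * t) * (b * K)"
    if "0 \<le> s" "s \<le> t" "\<omega> \<in> space W" for s \<omega>
  proof -
    have "exp (A s \<omega>) \<le> exp (b * t)" using A_bound[OF that] by simp
    then show ?thesis unfolding abs_mult using \<gamma>_bound by (intro mult_mono) auto
  qed
  define k where "k s r \<omega> = (if s \<le> r then Y s \<omega> * \<gamma> r \<omega> else 0)" for s r \<omega>
  have k_bound: "\<bar>k s r \<omega>\<bar> \<le> B * (b * K)" if "\<omega> \<in> space W" for s r \<omega>
    using Y\<gamma>_bound[OF that, of s r] B0 bK by (simp add: k_def)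

  \<comment> \<open>the linear equation at the position of the motion at time \<open>s\<close>\<close>
  have step: "(\<integral>\<omega>. exp (A s \<omega>) * \<gamma> s \<omega> \<partial>Law x)
      = (\<integral>\<omega>. Y s \<omega> * F \<omega> \<partial>Law x) + (\<integral>r. \<integral>\<omega>. k s r \<omega> \<partial>Law x \<partial>?L)"
    if s: "0 \<le> s" "s \<le> t" for s
  proof -
    let ?L' = "restrict_space lborel {0..t - s}"
    have g'_meas: "(\<lambda>(r, y). g (s + r) y) \<in> borel_measurable (borel \<Otimes>\<^sub>M borel)"
    proof -
      have "(\<lambda>p. (\<lambda>(r, y). g r y) (s + fst p, snd p)) \<in> borel_measurable (borel \<Otimes>\<^sub>M borel)"
        by (rule measurable_compose[OF _ g_meas]) measurable
      then show ?thesis by (simp add: split_beta')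
    qed
    define h where "h r y = (if 0 \<le> r \<and> r \<le> t - s then \<integral>z. g (s + r) z \<partial>P r y else 0)" for r y
    have h_meas: "(\<lambda>(r, y). h r y) \<in> borel_measurable (borel \<Otimes>\<^sub>M borel)"
      unfolding h_def using s g_bound by (intro measurable_integral_P_joint[OF g'_meas]) auto
    have h_bound: "\<bar>h r y\<bar> \<le> b * K" for r y
      using integral_P_bound(1)[of r "g (s + r)" "b * K" y] g_sec g_bound bK by (simp add: h_def)
    have kh_meas: "(\<lambda>(r, \<omega>). kill (h r) s \<omega>) \<in> borel_measurable (borel \<Otimes>\<^sub>M W)"
      by (rule measurable_kill_param[OF s(1) h_meas])
    have Pf_meas: "(\<lambda>y. \<integral>z. f z \<partial>P (t - s) y) \<in> borel_measurable borel"
      using s by (intro measurable_integral_P) auto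
    have Pf_bound: "\<bar>\<integral>z. f z \<partial>P (t - s) y\<bar> \<le> c" for y
      using s c by (intro integral_P_bound(1)) auto
    have path: "exp (A s \<omega>) * \<gamma> s \<omega> - Y s \<omega> * kill (\<lambda>y. \<integral>z. f z \<partial>P (t - s) y) s \<omega>
        = (\<integral>r. Y s \<omega> * kill (h r) s \<omega> \<partial>?L')" for \<omega>
    proof -
      have "m (t - s) y = (\<integral>z. f z \<partial>P (t - s) y) + (\<integral>r. h r y \<partial>?L')" for y
      proof -
        have "(\<integral>r. h r y \<partial>?L') = (\<integral>r. (\<integral>z. \<beta> z * m (t - s - r) z \<partial>P r y) \<partial>?L')"
          by (intro Bochner_Integration.integral_cong)
            (auto simp: h_def g_def[abs_def] space_restrict_space diff_diff_eq)
        then show ?thesis using eq[of "t - s" y] s by (simp add: integral_restrict_lborel)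
      qed
      then show ?thesis
        using s by (simp add: \<gamma>_def Y_def a_def g_def kill_def algebra_simps)
    qed
    have Y_meas_s: "Y s \<in> borel_measurable W"
      using Y_adapted[OF s] by (rule measurable_natural_filtration)
    have i1: "integrable (Law x) (\<lambda>\<omega>. exp (A s \<omega>) * \<gamma> s \<omega>)"
    proof (rule E_bound(2))
      show "(\<lambda>\<omega>. exp (A s \<omega>) * \<gamma> s \<omega>) \<in> borel_measurable W" by measurable
    qed (rule e\<gamma>_bound[OF s])
    have i2: "integrable (Law x) (\<lambda>\<omega>. Y s \<omega> * kill (\<lambda>y. \<integral>z. f z \<partial>P (t - s) y) s \<omega>)"
    proof (rule E_bound(2)[of _ "B * c"])
      show "(\<lambda>\<omega>. Y s \<omega> * kill (\<lambda>y. \<integral>z. f z \<partial>P (t - s) y) s \<omega>) \<in> borel_measurable W"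
        using measurable_kill_W[OF s(1) Pf_meas] Y_meas_s by simp
      show "\<bar>Y s \<omega> * kill (\<lambda>y. \<integral>z. f z \<partial>P (t - s) y) s \<omega>\<bar> \<le> B * c" if "\<omega> \<in> space W" for \<omega>
        unfolding abs_mult using Y_bound[OF that] kill_bound[OF Pf_bound] B0 by (intro mult_mono) auto
    qed
    have Yh_meas: "(\<lambda>(\<omega>, r). Y s \<omega> * kill (h r) s \<omega>) \<in> borel_measurable (Law x \<Otimes>\<^sub>M ?L')"
    proof -
      have [measurable]: "(\<lambda>s. s) \<in> borel_measurable ?L'"
        by (rule measurable_restrict_lborel) simp
      have "(\<lambda>q. (\<lambda>(r, \<omega>). kill (h r) s \<omega>) (snd q, fst q)) \<in> borel_measurable (Law x \<Otimes>\<^sub>M ?L')"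
        by (rule measurable_compose[OF _ kh_meas]) measurable
      then show ?thesis using Y_meas_s by (simp add: split_beta')
    qed
    \<comment> \<open>\<open>Y\<close> is bounded on the sample space only; the truncation \<open>Y'\<close> is bounded everywhere\<close>
    define Y' where "Y' \<omega> = max (- B) (min B (Y s \<omega>))" for \<omega>
    have Y'_eq: "Y' \<omega> = Y s \<omega>" if "\<omega> \<in> space W" for \<omega>
      using Y_bound[OF that, of s] by (auto simp: Y'_def)
    have Y'_adapted: "Y' \<in> borel_measurable (natural_filtration W \<xi> \<zeta> s)"
      unfolding Y'_def using Y_adapted[OF s] by simp
    have Y'_bound: "\<bar>Y' \<omega>\<bar> \<le> B" for \<omega> using B0 by (auto simp: Y'_def)
    have mk: "(\<integral>\<omega>. Y s \<omega> * kill q (s + r) \<omega> \<partial>Law x)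
        = (\<integral>\<omega>. Y s \<omega> * kill (\<lambda>y. \<integral>z. q z \<partial>P r y) s \<omega> \<partial>Law x)"
      if "0 \<le> r" "q \<in> borel_measurable borel" "\<And>y. \<bar>q y\<bar> \<le> C" for q r C
    proof -
      have "(\<integral>\<omega>. Y s \<omega> * u \<omega> \<partial>Law x) = (\<integral>\<omega>. Y' \<omega> * u \<omega> \<partial>Law x)" for u
        by (intro Bochner_Integration.integral_cong) (auto simp: Y'_eq)
      then show ?thesis
        using markov_bounded[OF s(1) that(1) Y'_adapted Y'_bound that(2,3)] by simp
    qed
    have "(\<integral>\<omega>. exp (A s \<omega>) * \<gamma> s \<omega> \<partial>Law x)
        - (\<integral>\<omega>. Y s \<omega> * kill (\<lambda>y. \<integral>z. f z \<partial>P (t - s) y) s \<omega> \<partial>Law x)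
        = (\<integral>\<omega>. \<integral>r. Y s \<omega> * kill (h r) s \<omega> \<partial>?L' \<partial>Law x)"
      using i1 i2 by (simp only: Bochner_Integration.integral_diff[symmetric] path)
    also have "\<dots> = (\<integral>r. \<integral>\<omega>. Y s \<omega> * kill (h r) s \<omega> \<partial>Law x \<partial>?L')"
    proof (rule Fubini_bounded[OF Law_fin finite_restrict_lborel Yh_meas])
      show "\<bar>Y s \<omega> * kill (h r) s \<omega>\<bar> \<le> B * (b * K)" if "\<omega> \<in> space (Law x)" for \<omega> r
        unfolding abs_mult using Y_bound[of \<omega> s] kill_bound[OF h_bound] B0 that
        by (intro mult_mono) auto
    qed
    also have "\<dots> = (\<integral>r. \<integral>\<omega>. Y s \<omega> * \<gamma> (s + r) \<omega> \<partial>Law x \<partial>?L')"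
    proof (rule Bochner_Integration.integral_cong[OF refl])
      fix r assume "r \<in> space ?L'"
      then have r: "0 \<le> r" "r \<le> t - s" by (auto simp: space_restrict_space)
      then show "(\<integral>\<omega>. Y s \<omega> * kill (h r) s \<omega> \<partial>Law x) = (\<integral>\<omega>. Y s \<omega> * \<gamma> (s + r) \<omega> \<partial>Law x)"
        using mk[of r "g (s + r)" "b * K"] g_sec g_bound s by (simp add: h_def[abs_def] \<gamma>_def)
    qed
    also have "\<dots> = (\<integral>r. indicator {0..t - s} r * (\<integral>\<omega>. Y s \<omega> * \<gamma> (s + r) \<omega> \<partial>Law x) \<partial>lborel)"
      by (simp add: integral_restrict_space)
    also have "\<dots> = (\<integral>r. indicator {0..t} r * (\<integral>\<omega>. k s r \<omega> \<partial>Law x) \<partial>lborel)"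
      using s by (subst (2) lborel_integral_real_affine[where c = 1 and t = s])
        (auto intro!: Bochner_Integration.integral_cong simp: k_def[abs_def] split: split_indicator)
    also have "\<dots> = (\<integral>r. \<integral>\<omega>. k s r \<omega> \<partial>Law x \<partial>?L)"
      by (simp add: integral_restrict_space)
    finally show ?thesis
      using mk[of "t - s" f c] s c by (simp add: F_def)
  qed

  \<comment> \<open>integration over \<open>s\<close>\<close>
  have FTC: "(\<integral>s. (if s \<le> r then Y s \<omega> else 0) \<partial>?L) = exp (A r \<omega>) - 1"
    if r: "0 \<le> r" "r \<le> t" and \<omega>: "\<omega> \<in> space W" for r \<omega>
  proof -
    have "(\<integral>s. (if s \<le> r then Y s \<omega> else 0) \<partial>?L) = (LINT s:{0..r}|lborel. a s \<omega> * exp (A s \<omega>))"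
      unfolding integral_restrict_lborel set_lebesgue_integral_def
      using r by (intro Bochner_Integration.integral_cong) (auto simp: Y_def split: split_indicator)
    also have "\<dots> = exp (A r \<omega>) - 1"
      unfolding A_def by (rule integral_exp_integral[OF a_path[OF \<omega>] a_bound r(1)])
    finally show ?thesis .
  qed
  define \<Phi> where "\<Phi> s = (\<integral>\<omega>. exp (A s \<omega>) * \<gamma> s \<omega> \<partial>Law x)" for s
  have L_int: "integrable ?L h"
    if "h \<in> borel_measurable borel" "\<And>s. s \<in> {0..t} \<Longrightarrow> \<bar>h s\<bar> \<le> C" for h :: "real \<Rightarrow> real" and C
    using that by (intro finite_measure.integrable_const_bound[OF L_fin, of _ C] AE_I2)
      (auto simp: space_restrict_space intro: measurable_restrict_lborel)
  have \<Phi>_int: "integrable ?L \<Phi>"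
  proof (rule L_int[of _ "exp (b * t) * (b * K)"])
    show "\<Phi> \<in> borel_measurable borel" unfolding \<Phi>_def by measurable
    show "\<bar>\<Phi> s\<bar> \<le> exp (b * t) * (b * K)" if "s \<in> {0..t}" for s
      unfolding \<Phi>_def
    proof (rule E_bound(1))
      show "(\<lambda>\<omega>. exp (A s \<omega>) * \<gamma> s \<omega>) \<in> borel_measurable W" by measurable
    qed (rule e\<gamma>_bound, use that in auto)
  qed
  have \<gamma>_int: "integrable ?L (\<lambda>r. \<integral>\<omega>. \<gamma> r \<omega> \<partial>Law x)"
    by (rule L_int[of _ "b * K"], measurable, rule E_bound(1)) (auto simp: \<gamma>_bound)
  have YF_int: "integrable ?L (\<lambda>s. \<integral>\<omega>. Y s \<omega> * F \<omega> \<partial>Law x)"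
    by (rule L_int[of _ "B * c"], measurable, rule E_bound(1)) (auto simp: YF_bound)
  have k_int: "integrable ?L (\<lambda>s. \<integral>r. \<integral>\<omega>. k s r \<omega> \<partial>Law x \<partial>?L)"
  proof -
    have "integrable ?L (\<lambda>s. \<Phi> s - (\<integral>\<omega>. Y s \<omega> * F \<omega> \<partial>Law x))"
      using \<Phi>_int YF_int by simp
    then show ?thesis
      by (rule Bochner_Integration.integrable_cong[THEN iffD1, rotated 2])
        (auto simp: \<Phi>_def step space_restrict_space)
  qed
  have int_\<Phi>: "(\<integral>s. \<Phi> s \<partial>?L) = (\<integral>s. \<integral>\<omega>. Y s \<omega> * F \<omega> \<partial>Law x \<partial>?L)
      + (\<integral>s. \<integral>r. \<integral>\<omega>. k s r \<omega> \<partial>Law x \<partial>?L \<partial>?L)"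
  proof -
    have "(\<integral>s. \<Phi> s \<partial>?L) = (\<integral>s. (\<integral>\<omega>. Y s \<omega> * F \<omega> \<partial>Law x) + (\<integral>r. \<integral>\<omega>. k s r \<omega> \<partial>Law x \<partial>?L) \<partial>?L)"
      by (rule Bochner_Integration.integral_cong[OF refl]) (simp add: \<Phi>_def step space_restrict_space)
    then show ?thesis using YF_int k_int by simp
  qed
  have int_YF: "(\<integral>s. \<integral>\<omega>. Y s \<omega> * F \<omega> \<partial>Law x \<partial>?L) = (\<integral>\<omega>. (exp (A t \<omega>) - 1) * F \<omega> \<partial>Law x)"
  proof -
    have "(\<lambda>(s, \<omega>). Y s \<omega> * F \<omega>) \<in> borel_measurable (?L \<Otimes>\<^sub>M Law x)"
      unfolding split_beta' by measurable
    then have "(\<integral>s. \<integral>\<omega>. Y s \<omega> * F \<omega> \<partial>Law x \<partial>?L) = (\<integral>\<omega>. \<integral>s. Y s \<omega> * F \<omega> \<partial>?L \<partial>Law x)"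
      by (rule Fubini_bounded[OF L_fin Law_fin]) (auto intro: YF_bound)
    also have "\<dots> = (\<integral>\<omega>. (exp (A t \<omega>) - 1) * F \<omega> \<partial>Law x)"
    proof (rule Bochner_Integration.integral_cong[OF refl])
      fix \<omega> assume "\<omega> \<in> space (Law x)"
      then have "(\<integral>s. (if s \<le> t then Y s \<omega> else 0) \<partial>?L) = exp (A t \<omega>) - 1"
        using FTC[of t \<omega>] t by simp
      moreover have "(\<integral>s. (if s \<le> t then Y s \<omega> else 0) \<partial>?L) = (\<integral>s. Y s \<omega> \<partial>?L)"
        by (intro Bochner_Integration.integral_cong) (auto simp: space_restrict_space)
      ultimately show "(\<integral>s. Y s \<omega> * F \<omega> \<partial>?L) = (exp (A t \<omega>) - 1) * F \<omega>" by simp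
    qed
    finally show ?thesis .
  qed
  have int_k: "(\<integral>s. \<integral>r. \<integral>\<omega>. k s r \<omega> \<partial>Law x \<partial>?L \<partial>?L)
      = (\<integral>s. \<Phi> s \<partial>?L) - (\<integral>r. \<integral>\<omega>. \<gamma> r \<omega> \<partial>Law x \<partial>?L)"
  proof -
    have k_meas: "(\<lambda>(p, \<omega>). k (fst p) (snd p) \<omega>) \<in> borel_measurable ((?L \<Otimes>\<^sub>M ?L) \<Otimes>\<^sub>M Law x)"
      unfolding split_beta' k_def by measurable
    have "(\<lambda>(s, r). \<integral>\<omega>. k s r \<omega> \<partial>Law x) \<in> borel_measurable (?L \<Otimes>\<^sub>M ?L)"
      using borel_measurable_lebesgue_integral[OF k_meas] by (simp add: split_beta')
    then have "(\<integral>s. \<integral>r. \<integral>\<omega>. k s r \<omega> \<partial>Law x \<partial>?L \<partial>?L) = (\<integral>r. \<integral>s. \<integral>\<omega>. k s r \<omega> \<partial>Law x \<partial>?L \<partial>?L)"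
    proof (rule Fubini_bounded[OF L_fin L_fin])
      show "\<bar>\<integral>\<omega>. k s r \<omega> \<partial>Law x\<bar> \<le> B * (b * K)" for s r
      proof (rule E_bound(1))
        show "(\<lambda>\<omega>. k s r \<omega>) \<in> borel_measurable W" unfolding k_def by measurable
      qed (rule k_bound)
    qed
    also have "\<dots> = (\<integral>r. \<Phi> r - (\<integral>\<omega>. \<gamma> r \<omega> \<partial>Law x) \<partial>?L)"
    proof (rule Bochner_Integration.integral_cong[OF refl])
      fix r assume "r \<in> space ?L"
      then have r: "0 \<le> r" "r \<le> t" by (auto simp: space_restrict_space)
      have "(\<lambda>(s, \<omega>). k s r \<omega>) \<in> borel_measurable (?L \<Otimes>\<^sub>M Law x)"
        unfolding split_beta' k_def by measurable
      then have "(\<integral>s. \<integral>\<omega>. k s r \<omega> \<partial>Law x \<partial>?L) = (\<integral>\<omega>. \<integral>s. k s r \<omega> \<partial>?L \<partial>Law x)"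
        by (rule Fubini_bounded[OF L_fin Law_fin]) (auto intro: k_bound)
      also have "\<dots> = (\<integral>\<omega>. exp (A r \<omega>) * \<gamma> r \<omega> - \<gamma> r \<omega> \<partial>Law x)"
      proof (rule Bochner_Integration.integral_cong[OF refl])
        fix \<omega> assume \<omega>: "\<omega> \<in> space (Law x)"
        have "(\<integral>s. k s r \<omega> \<partial>?L) = (\<integral>s. (if s \<le> r then Y s \<omega> else 0) * \<gamma> r \<omega> \<partial>?L)"
          by (intro Bochner_Integration.integral_cong) (auto simp: k_def)
        also have "\<dots> = (exp (A r \<omega>) - 1) * \<gamma> r \<omega>"
          using FTC[OF r, of \<omega>] \<omega> by simp
        finally show "(\<integral>s. k s r \<omega> \<partial>?L) = exp (A r \<omega>) * \<gamma> r \<omega> - \<gamma> r \<omega>"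
          by (simp add: algebra_simps)
      qed
      also have "\<dots> = \<Phi> r - (\<integral>\<omega>. \<gamma> r \<omega> \<partial>Law x)"
        unfolding \<Phi>_def
      proof (rule Bochner_Integration.integral_diff)
        show "integrable (Law x) (\<gamma> r)" by (rule E_bound(2)) (auto intro: \<gamma>_bound)
        show "integrable (Law x) (\<lambda>\<omega>. exp (A r \<omega>) * \<gamma> r \<omega>)"
        proof (rule E_bound(2))
          show "(\<lambda>\<omega>. exp (A r \<omega>) * \<gamma> r \<omega>) \<in> borel_measurable W" by measurable
        qed (rule e\<gamma>_bound[OF r])
      qed
      finally show "(\<integral>s. \<integral>\<omega>. k s r \<omega> \<partial>Law x \<partial>?L) = \<Phi> r - (\<integral>\<omega>. \<gamma> r \<omega> \<partial>Law x)" .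
    qed
    also have "\<dots> = (\<integral>s. \<Phi> s \<partial>?L) - (\<integral>r. \<integral>\<omega>. \<gamma> r \<omega> \<partial>Law x \<partial>?L)"
      using \<Phi>_int \<gamma>_int by (rule Bochner_Integration.integral_diff)
    finally show ?thesis .
  qed
  \<comment> \<open>the integral of \<open>\<Phi>\<close> drops out of the equation\<close>
  have cancel: "(\<integral>r. \<integral>\<omega>. \<gamma> r \<omega> \<partial>Law x \<partial>?L) = (\<integral>\<omega>. (exp (A t \<omega>) - 1) * F \<omega> \<partial>Law x)"
    using int_\<Phi> int_YF int_k by simp
  have eF_int: "integrable (Law x) (\<lambda>\<omega>. exp (A t \<omega>) * F \<omega>)"
  proof (rule E_bound(2)[of _ "exp (b * t) * c"])
    fix \<omega> assume "\<omega> \<in> space W"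
    then have "exp (A t \<omega>) \<le> exp (b * t)" using A_bound[of t \<omega>] t by simp
    then show "\<bar>exp (A t \<omega>) * F \<omega>\<bar> \<le> exp (b * t) * c"
      unfolding abs_mult using F_bound by (intro mult_mono) auto
  qed measurable
  have F_int: "integrable (Law x) F" by (rule E_bound(2)) (auto intro: F_bound)
  have "m t x = (\<integral>\<omega>. F \<omega> \<partial>Law x) + (\<integral>r. \<integral>\<omega>. \<gamma> r \<omega> \<partial>Law x \<partial>?L)"
  proof -
    have "(\<integral>r. \<integral>z. \<beta> z * m (t - r) z \<partial>P r x \<partial>?L) = (\<integral>r. \<integral>\<omega>. \<gamma> r \<omega> \<partial>Law x \<partial>?L)"
    proof (rule Bochner_Integration.integral_cong[OF refl])
      fix r assume "r \<in> space ?L"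
      then show "(\<integral>z. \<beta> z * m (t - r) z \<partial>P r x) = (\<integral>\<omega>. \<gamma> r \<omega> \<partial>Law x)"
        using integral_P_eq_Law[of r "g r" "b * K" x] g_sec[of r] g_bound[of r]
        by (simp add: space_restrict_space \<gamma>_def g_def[abs_def])
    qed
    moreover have "(\<integral>z. f z \<partial>P t x) = (\<integral>\<omega>. F \<omega> \<partial>Law x)"
      unfolding F_def using t c by (intro integral_P_eq_Law) auto
    ultimately show ?thesis
      using eq[of t x] t by (simp add: integral_restrict_lborel)
  qed
  also have "\<dots> = (\<integral>\<omega>. exp (A t \<omega>) * F \<omega> \<partial>Law x)"
    unfolding cancel left_diff_distrib using eF_int F_int by simp
  finally have mtx: "m t x = (\<integral>\<omega>. exp (A t \<omega>) * F \<omega> \<partial>Law x)" .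
  have weight: "exp (A t \<omega>) * F \<omega> = exp (LINT s:{0..t}|lborel. \<beta> (\<xi> s \<omega>)) * kill f t \<omega>" for \<omega>
  proof (cases "ereal t < \<zeta> \<omega>")
    case True
    then have "a s \<omega> = \<beta> (\<xi> s \<omega>)" if "s \<in> {0..t}" for s
      using that by (auto simp: a_def kill_def order_le_less_trans[of "ereal s" "ereal t"])
    then have "A t \<omega> = (LINT s:{0..t}|lborel. \<beta> (\<xi> s \<omega>))"
      unfolding A_def by (intro set_lebesgue_integral_cong) auto
    then show ?thesis by (simp add: F_def)
  qed (simp add: F_def kill_def)
  show "m t x = (\<integral>\<omega>. exp (LINT s:{0..t}|lborel. \<beta> (\<xi> s \<omega>)) * kill f t \<omega> \<partial>Law x)"
    and "integrable (Law x) (\<lambda>\<omega>. exp (LINT s:{0..t}|lborel. \<beta> (\<xi> s \<omega>)) * kill f t \<omega>)"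
    using mtx eF_int by (simp_all add: weight)
qed

end

section \<open>The branching mechanism\<close>

lemma exp_remainder:
  fixes y :: real
  assumes "0 \<le> y"
  shows "0 \<le> exp (- y) - 1 + y" "exp (- y) - 1 + y \<le> y" "exp (- y) - 1 + y \<le> y\<^sup>2"
proof -
  show "0 \<le> exp (- y) - 1 + y" using exp_ge_add_one_self[of "- y"] by simp
  show "exp (- y) - 1 + y \<le> y" using assms by simp
  have "exp (- y) * (1 + y) \<le> exp (- y) * exp y"
    by (intro mult_left_mono exp_ge_add_one_self) simp
  then have "exp (- y) - 1 + y \<le> y * (1 - exp (- y))"
    by (simp add: exp_minus_inverse algebra_simps mult_exp_exp)
  also have "\<dots> \<le> y * y" using assms exp_ge_add_one_self[of "- y"] by (intro mult_left_mono) auto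
  finally show "exp (- y) - 1 + y \<le> y\<^sup>2" by (simp add: power2_eq_square)
qed

lemma exp_remainder_mono:
  fixes y z :: real
  assumes "0 \<le> y" "y \<le> z"
  shows "exp (- y) - 1 + y \<le> exp (- z) - 1 + z"
  using exp_diff_le[of "- y" 0 "- z"] assms by simp

lemma exp_rescaled_limit:
  fixes w :: "nat \<Rightarrow> real"
  assumes "\<And>n. 0 \<le> w n" "\<And>n. w n \<le> K"
  shows "(\<lambda>n. w n - (real n + 1) * (1 - exp (- (w n / (real n + 1))))) \<longlonglongrightarrow> 0"
proof (rule tendsto_sandwich[where f = "\<lambda>_. 0" and h = "\<lambda>n. K\<^sup>2 / (real n + 1)"])
  have eq: "w n - (real n + 1) * (1 - exp (- (w n / (real n + 1))))
      = (real n + 1) * (exp (- (w n / (real n + 1))) - 1 + w n / (real n + 1))" for n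
    by (simp add: field_simps)
  show "eventually (\<lambda>n. 0 \<le> w n - (real n + 1) * (1 - exp (- (w n / (real n + 1))))) sequentially"
    unfolding eq using assms(1) exp_remainder(1)
    by (intro always_eventually allI mult_nonneg_nonneg) auto
  show "eventually (\<lambda>n. w n - (real n + 1) * (1 - exp (- (w n / (real n + 1)))) \<le> K\<^sup>2 / (real n + 1)) sequentially"
  proof (intro always_eventually allI)
    fix n
    have "(real n + 1) * (exp (- (w n / (real n + 1))) - 1 + w n / (real n + 1))
        \<le> (real n + 1) * (w n / (real n + 1))\<^sup>2"
      using assms(1)[of n] by (intro mult_left_mono exp_remainder(3)) auto
    also have "\<dots> = (w n)\<^sup>2 / (real n + 1)" by (simp add: power2_eq_square)
    also have "\<dots> \<le> K\<^sup>2 / (real n + 1)"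
      using assms by (intro divide_right_mono power_mono) auto
    finally show "w n - (real n + 1) * (1 - exp (- (w n / (real n + 1)))) \<le> K\<^sup>2 / (real n + 1)"
      unfolding eq .
  qed
  show "(\<lambda>n. K\<^sup>2 / (real n + 1)) \<longlonglongrightarrow> 0"
    using tendsto_mult_right_zero[OF LIMSEQ_inverse_real_of_nat, of "K\<^sup>2"]
    by (simp add: divide_inverse add.commute)
qed simp

text \<open>The parameters of the branching mechanism.\<close>

locale branching =
  fixes \<beta> \<sigma> :: "'e::polish_space \<Rightarrow> real" and \<pi> :: "'e \<Rightarrow> real measure"
  assumes branching: "branching_data \<beta> \<sigma> \<pi>"
begin

lemma \<beta>_bdd: "\<beta> \<in> bdd_borel" and \<sigma>_bdd: "\<sigma> \<in> bdd_borel"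
  using branching by (auto simp: branching_data_def)

lemma sets_\<pi> [measurable_cong]: "sets (\<pi> x) = sets (restrict_space borel {0<..})"
  using branching unfolding branching_data_def by blast

lemma space_\<pi>: "space (\<pi> x) = {0<..}"
  using sets_eq_imp_space_eq[OF sets_\<pi>] by (simp add: space_restrict_space)

lemma measurable_\<pi>: "k \<in> borel_measurable borel \<Longrightarrow> k \<in> borel_measurable (\<pi> x)"
  by (subst measurable_cong_sets[OF sets_\<pi> refl]) (rule measurable_restrict_space1)

text \<open>The contribution of the jumps to the branching mechanism, and its whole non-linear part.\<close>

definition jump :: "'e \<Rightarrow> real \<Rightarrow> real" where
  "jump x z = (\<integral>u. (exp (- z * u) - 1 + z * u) \<partial>\<pi> x)"

definition psi0 :: "'e \<Rightarrow> real \<Rightarrow> real" where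
  "psi0 x z = (\<sigma> x)\<^sup>2 * z\<^sup>2 + jump x z"

lemma branching_mechanism_eq: "branching_mechanism \<beta> \<sigma> \<pi> x z = - \<beta> x * z + psi0 x z"
  by (simp add: branching_mechanism_def psi0_def jump_def)

lemma min_moment:
  obtains C where "0 \<le> C" "\<And>x. integrable (\<pi> x) (\<lambda>u. min u (u\<^sup>2))"
    "\<And>x. (\<integral>u. min u (u\<^sup>2) \<partial>\<pi> x) \<le> C"
proof -
  define S where "S = (SUP x. \<integral>\<^sup>+u. ennreal (min u (u\<^sup>2)) \<partial>\<pi> x)"
  have S: "S < \<infinity>" using branching by (simp add: branching_data_def S_def)
  have le: "(\<integral>\<^sup>+u. ennreal (min u (u\<^sup>2)) \<partial>\<pi> x) \<le> S" for x
    unfolding S_def by (rule SUP_upper) simp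
  have nonneg: "AE u in \<pi> x. 0 \<le> min u (u\<^sup>2)" for x
    by (rule AE_I2) (simp add: space_\<pi>)
  have meas: "(\<lambda>u. min u (u\<^sup>2)) \<in> borel_measurable (\<pi> x)" for x
    by (rule measurable_\<pi>) simp
  have int: "integrable (\<pi> x) (\<lambda>u. min u (u\<^sup>2))" for x
    using le[of x] S nonneg meas by (intro integrableI_nonneg) auto
  have "(\<integral>u. min u (u\<^sup>2) \<partial>\<pi> x) \<le> enn2real S" for x
  proof -
    have "ennreal (\<integral>u. min u (u\<^sup>2) \<partial>\<pi> x) \<le> S"
      using le[of x] nn_integral_eq_integral[OF int nonneg] by simp
    also have "S = ennreal (enn2real S)" using S by simp
    finally show ?thesis by (simp add: ennreal_le_iff)
  qed
  with int show thesis by (intro that[of "enn2real S"]) auto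
qed

lemma remainder_le_min:
  assumes "0 \<le> z" "0 < (u::real)"
  shows "exp (- z * u) - 1 + z * u \<le> max z (z\<^sup>2) * min u (u\<^sup>2)"
proof (cases "u \<le> u\<^sup>2")
  case True
  have "exp (- (z * u)) - 1 + z * u \<le> z * u" using assms by (intro exp_remainder) simp
  also have "\<dots> \<le> max z (z\<^sup>2) * u" using assms by (intro mult_right_mono) auto
  finally show ?thesis using True by simp
next
  case False
  have "exp (- (z * u)) - 1 + z * u \<le> (z * u)\<^sup>2" using assms by (intro exp_remainder) simp
  also have "\<dots> \<le> max z (z\<^sup>2) * u\<^sup>2" by (simp add: power_mult_distrib mult_right_mono)
  finally show ?thesis using False by simp
qed

lemma integrable_remainder:
  assumes z: "0 \<le> z"
  shows "integrable (\<pi> x) (\<lambda>u. exp (- z * u) - 1 + z * u)"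
proof -
  obtain C where "integrable (\<pi> x) (\<lambda>u. min u (u\<^sup>2))" using min_moment by metis
  then have int: "integrable (\<pi> x) (\<lambda>u. max z (z\<^sup>2) * min u (u\<^sup>2))" by simp
  show ?thesis
  proof (rule Bochner_Integration.integrable_bound[OF int])
    show "AE u in \<pi> x. norm (exp (- z * u) - 1 + z * u) \<le> norm (max z (z\<^sup>2) * min u (u\<^sup>2))"
    proof (rule AE_I2)
      fix u assume "u \<in> space (\<pi> x)"
      then have u: "0 < u" by (simp add: space_\<pi>)
      have "0 \<le> exp (- z * u) - 1 + z * u" using exp_remainder(1)[of "z * u"] z u by simp
      with remainder_le_min[OF z u]
      show "norm (exp (- z * u) - 1 + z * u) \<le> norm (max z (z\<^sup>2) * min u (u\<^sup>2))" by simp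
    qed
  qed (rule measurable_\<pi>, measurable)
qed

lemma jump_nonneg: "0 \<le> z \<Longrightarrow> 0 \<le> jump x z"
  unfolding jump_def by (rule integral_nonneg_AE, rule AE_I2) (use exp_remainder(1) in \<open>simp add: space_\<pi>\<close>)

lemma psi0_nonneg: "0 \<le> z \<Longrightarrow> 0 \<le> psi0 x z"
  by (simp add: psi0_def jump_nonneg)

lemma jump_mono: "0 \<le> z \<Longrightarrow> z \<le> z' \<Longrightarrow> jump x z \<le> jump x z'"
  unfolding jump_def
proof (intro integral_mono_AE integrable_remainder AE_I2)
  fix u assume z: "0 \<le> z" "z \<le> z'" and "u \<in> space (\<pi> x)"
  then have "0 < u" by (simp add: space_\<pi>)
  with exp_remainder_mono[of "z * u" "z' * u"] z
  show "exp (- z * u) - 1 + z * u \<le> exp (- z' * u) - 1 + z' * u"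
    by (simp add: mult_right_mono)
qed auto

lemma psi0_mono: "0 \<le> z \<Longrightarrow> z \<le> z' \<Longrightarrow> psi0 x z \<le> psi0 x z'"
  unfolding psi0_def by (rule add_mono[OF mult_left_mono[OF power_mono] jump_mono]) simp_all

lemma jump_measurable_fixed:
  assumes z: "0 \<le> z"
  shows "(\<lambda>x. jump x z) \<in> borel_measurable borel"
proof -
  have nn: "(\<lambda>x. \<integral>\<^sup>+u. k u \<partial>\<pi> x) \<in> borel_measurable borel"
    if "k \<in> borel_measurable (restrict_space borel {0<..})" for k
    using that
  proof (induction rule: borel_measurable_induct)
    case (cong f g)
    then have "(\<integral>\<^sup>+u. f u \<partial>\<pi> x) = (\<integral>\<^sup>+u. g u \<partial>\<pi> x)" for x
      by (intro nn_integral_cong) (simp add: space_\<pi> space_restrict_space)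
    with cong show ?case by simp
  next
    case (set A)
    then show ?case using branching by (simp add: branching_data_def sets_\<pi>)
  next
    case (mult u c)
    then show ?case by (simp add: nn_integral_cmult)
  next
    case (add u v)
    then show ?case by (simp add: nn_integral_add)
  next
    case (seq U)
    then have "(\<lambda>x. SUP i. \<integral>\<^sup>+u. U i u \<partial>\<pi> x) \<in> borel_measurable borel" by measurable
    moreover have "(\<integral>\<^sup>+u. (SUP i. U i) u \<partial>\<pi> x) = (SUP i. \<integral>\<^sup>+u. U i u \<partial>\<pi> x)" for x
      using seq by (simp add: nn_integral_monotone_convergence_SUP image_comp)
    ultimately show ?case by simp
  qed
  have "jump x z = enn2real (\<integral>\<^sup>+u. ennreal (exp (- z * u) - 1 + z * u) \<partial>\<pi> x)" for x
    unfolding jump_def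
  proof (rule integral_eq_nn_integral)
    show "AE u in \<pi> x. 0 \<le> exp (- z * u) - 1 + z * u"
      using z exp_remainder(1) by (intro AE_I2) (simp add: space_\<pi>)
  qed (rule measurable_\<pi>, measurable)
  moreover have "(\<lambda>x. \<integral>\<^sup>+u. ennreal (exp (- z * u) - 1 + z * u) \<partial>\<pi> x) \<in> borel_measurable borel"
    by (rule nn, rule measurable_restrict_space1, measurable)
  ultimately show ?thesis by simp
qed

text \<open>\<open>jump\<close> is measurable in \<open>x\<close> and continuous in \<open>z\<close>, hence jointly measurable.\<close>

lemma psi0_measurable:
  "(\<lambda>(x, z). if 0 \<le> z then psi0 x z else 0) \<in> borel_measurable (borel \<Otimes>\<^sub>M borel)"
proof -
  define \<tau> where "\<tau> n i = max 0 (real_of_int i / (real n + 1))" for n :: nat and i :: int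
  define J where "J n p = (if 0 \<le> snd p then jump (fst p) (\<tau> n \<lfloor>(real n + 1) * snd p\<rfloor>) else 0)"
    for n and p :: "'e \<times> real"
  have J_meas: "J n \<in> borel_measurable (borel \<Otimes>\<^sub>M borel)" for n
  proof -
    have [measurable]: "(\<lambda>p. jump (fst p) (\<tau> n i)) \<in> borel_measurable (borel \<Otimes>\<^sub>M borel)" for i
      by (rule measurable_compose[OF measurable_fst jump_measurable_fixed]) (simp add: \<tau>_def)
    have "(\<lambda>p. jump (fst p) (\<tau> n \<lfloor>(real n + 1) * snd p\<rfloor>)) \<in> borel_measurable (borel \<Otimes>\<^sub>M borel)"
      by (rule measurable_compose_countable[where f = "\<lambda>i p. jump (fst p) (\<tau> n i)"]) measurable
    then show ?thesis unfolding J_def by measurable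
  qed
  have J_lim: "(\<lambda>n. J n p) \<longlonglongrightarrow> (if 0 \<le> snd p then jump (fst p) (snd p) else 0)" for p
  proof (cases "0 \<le> snd p")
    case True
    define z where "z = snd p"
    define \<sigma> where "\<sigma> n = \<tau> n \<lfloor>(real n + 1) * z\<rfloor>" for n
    have z: "0 \<le> z" using True by (simp add: z_def)
    have le: "\<sigma> n \<le> z" and ge: "z - 1 / (real n + 1) \<le> \<sigma> n" for n
    proof -
      have "real_of_int \<lfloor>(real n + 1) * z\<rfloor> \<le> (real n + 1) * z" by (rule of_int_floor_le)
      then show "\<sigma> n \<le> z"
        using z by (simp add: \<sigma>_def \<tau>_def divide_le_eq mult.commute)
      have "(real n + 1) * z - 1 \<le> real_of_int \<lfloor>(real n + 1) * z\<rfloor>" by linarith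
      then have "((real n + 1) * z - 1) / (real n + 1) \<le> real_of_int \<lfloor>(real n + 1) * z\<rfloor> / (real n + 1)"
        by (intro divide_right_mono) auto
      moreover have "((real n + 1) * z - 1) / (real n + 1) = z - 1 / (real n + 1)"
        by (simp add: field_simps)
      ultimately show "z - 1 / (real n + 1) \<le> \<sigma> n"
        unfolding \<sigma>_def \<tau>_def by simp
    qed
    have nn: "0 \<le> \<sigma> n" for n by (simp add: \<sigma>_def \<tau>_def)
    have "\<sigma> \<longlonglongrightarrow> z"
    proof (rule tendsto_sandwich[where f = "\<lambda>n. z - 1 / (real n + 1)" and h = "\<lambda>_. z"])
      show "(\<lambda>n. z - 1 / (real n + 1)) \<longlonglongrightarrow> z"
        using tendsto_diff[OF tendsto_const[of z] LIMSEQ_inverse_real_of_nat]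
        by (simp add: inverse_eq_divide add.commute)
      show "eventually (\<lambda>n. z - 1 / (real n + 1) \<le> \<sigma> n) sequentially"
        using ge by (intro always_eventually allI)
      show "eventually (\<lambda>n. \<sigma> n \<le> z) sequentially"
        using le by (intro always_eventually allI)
    qed (rule tendsto_const)
    then have lim: "(\<lambda>n. exp (- \<sigma> n * u) - 1 + \<sigma> n * u) \<longlonglongrightarrow> exp (- z * u) - 1 + z * u" for u
      by (intro tendsto_intros)
    have "(\<lambda>n. jump (fst p) (\<sigma> n)) \<longlonglongrightarrow> jump (fst p) z"
      unfolding jump_def
    proof (rule integral_dominated_convergence[where w = "\<lambda>u. exp (- z * u) - 1 + z * u"])
      show "AE u in \<pi> (fst p). norm (exp (- \<sigma> n * u) - 1 + \<sigma> n * u) \<le> exp (- z * u) - 1 + z * u" for n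
      proof (rule AE_I2)
        fix u assume "u \<in> space (\<pi> (fst p))"
        then have "0 < u" by (simp add: space_\<pi>)
        then show "norm (exp (- \<sigma> n * u) - 1 + \<sigma> n * u) \<le> exp (- z * u) - 1 + z * u"
          using exp_remainder(1)[of "\<sigma> n * u"] exp_remainder_mono[of "\<sigma> n * u" "z * u"] nn[of n] le[of n]
          by (simp add: mult_right_mono)
      qed
      show "AE u in \<pi> (fst p). (\<lambda>n. exp (- \<sigma> n * u) - 1 + \<sigma> n * u) \<longlonglongrightarrow> exp (- z * u) - 1 + z * u"
        by (rule AE_I2) (rule lim)
      show "integrable (\<pi> (fst p)) (\<lambda>u. exp (- z * u) - 1 + z * u)"
        by (rule integrable_remainder[OF z])
      show "(\<lambda>u. exp (- z * u) - 1 + z * u) \<in> borel_measurable (\<pi> (fst p))"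
        by (rule measurable_\<pi>) measurable
      show "(\<lambda>u. exp (- \<sigma> n * u) - 1 + \<sigma> n * u) \<in> borel_measurable (\<pi> (fst p))" for n
        by (rule measurable_\<pi>) measurable
    qed
    moreover have "J n p = jump (fst p) (\<sigma> n)" for n
      using True by (simp add: J_def \<sigma>_def z_def)
    ultimately show ?thesis using True by (simp add: z_def)
  qed (simp add: J_def)
  have [measurable]: "(\<lambda>p. if 0 \<le> snd p then jump (fst p) (snd p) else 0) \<in> borel_measurable (borel \<Otimes>\<^sub>M borel)"
    by (rule borel_measurable_LIMSEQ_real[OF J_lim J_meas])
  have [measurable]: "\<sigma> \<in> borel_measurable borel" using \<sigma>_bdd by measurable
  have "(\<lambda>p. if 0 \<le> snd p then (\<sigma> (fst p))\<^sup>2 * (snd p)\<^sup>2 + (if 0 \<le> snd p then jump (fst p) (snd p) else 0) else 0)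
      \<in> borel_measurable (borel \<Otimes>\<^sub>M borel)"
    by measurable
  then show ?thesis by (simp add: psi0_def split_beta' cong: if_cong)
qed

text \<open>At scale \<open>n\<close> the non-linear part vanishes in the limit, boundedly but not uniformly in the
  position: only \<open>min u u\<^sup>2\<close> is assumed to have a bounded integral, not uniformly integrable tails.\<close>

lemma psi0_scaled:
  assumes K: "0 \<le> K"
  obtains D where "\<And>n x. (real n + 1) * psi0 x (K / (real n + 1)) \<le> D"
    "\<And>x. (\<lambda>n. (real n + 1) * psi0 x (K / (real n + 1))) \<longlonglongrightarrow> 0"
proof -
  obtain s where s: "0 < s" "\<And>x. \<bar>\<sigma> x\<bar> \<le> s" using bdd_borel_bound[OF \<sigma>_bdd] by blast
  obtain C where C: "0 \<le> C" "\<And>x. integrable (\<pi> x) (\<lambda>u. min u (u\<^sup>2))"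
    "\<And>x. (\<integral>u. min u (u\<^sup>2) \<partial>\<pi> x) \<le> C" using min_moment by metis
  define N where "N n = real n + 1" for n
  have N: "1 \<le> N n" for n by (simp add: N_def)
  have inv_lim: "(\<lambda>n. c / N n) \<longlonglongrightarrow> 0" for c
    using tendsto_mult_right_zero[OF LIMSEQ_inverse_real_of_nat, of c]
    by (simp add: N_def divide_inverse add.commute)
  define h where "h n u = N n * (exp (- (K / N n) * u) - 1 + (K / N n) * u)" for n u
  have h_nonneg: "0 \<le> h n u" if "0 < u" for n u
    unfolding h_def using exp_remainder(1)[of "K / N n * u"] N[of n] K that
    by (intro mult_nonneg_nonneg) auto
  have h_sq: "h n u \<le> K\<^sup>2 * u\<^sup>2 / N n" if "0 < u" for n u
  proof -
    have "h n u \<le> N n * (K / N n * u)\<^sup>2"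
      unfolding h_def using exp_remainder(3)[of "K / N n * u"] N[of n] K that
      by (intro mult_left_mono) auto
    also have "\<dots> = K\<^sup>2 * u\<^sup>2 / N n" using N[of n] by (simp add: power2_eq_square)
    finally show ?thesis .
  qed
  have h_le: "h n u \<le> max K (K\<^sup>2) * min u (u\<^sup>2)" if u: "0 < u" for n u
  proof -
    have "h n u \<le> N n * (max (K / N n) ((K / N n)\<^sup>2) * min u (u\<^sup>2))"
      unfolding h_def using N[of n] K u by (intro mult_left_mono remainder_le_min) auto
    also have "\<dots> = max K (K\<^sup>2 / N n) * min u (u\<^sup>2)"
      using N[of n] by (simp add: max_mult_distrib_left power2_eq_square)
    also have "\<dots> \<le> max K (K\<^sup>2) * min u (u\<^sup>2)"
    proof (rule mult_right_mono)
      have "K\<^sup>2 / N n \<le> K\<^sup>2" using N[of n] by (simp add: divide_le_eq mult_le_cancel_left1)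
      then show "max K (K\<^sup>2 / N n) \<le> max K (K\<^sup>2)" by auto
    qed (use u in auto)
    finally show ?thesis .
  qed
  have h_meas: "h n \<in> borel_measurable (\<pi> x)" for n x
    unfolding h_def by (rule measurable_\<pi>) measurable
  have jump_h: "N n * jump x (K / N n) = (\<integral>u. h n u \<partial>\<pi> x)" for n x
    unfolding jump_def h_def by simp
  have dom: "AE u in \<pi> x. norm (h n u) \<le> max K (K\<^sup>2) * min u (u\<^sup>2)" for n x
    using h_nonneg h_le by (intro AE_I2) (simp add: space_\<pi>)
  have dom_int: "integrable (\<pi> x) (\<lambda>u. max K (K\<^sup>2) * min u (u\<^sup>2))" for x using C by simp
  have jump_le: "N n * jump x (K / N n) \<le> max K (K\<^sup>2) * C" for n x
  proof -
    have "(\<integral>u. h n u \<partial>\<pi> x) \<le> (\<integral>u. max K (K\<^sup>2) * min u (u\<^sup>2) \<partial>\<pi> x)"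
    proof (rule integral_mono_AE)
      show "integrable (\<pi> x) (h n)"
        using dom[of n x] by (intro Bochner_Integration.integrable_bound[OF dom_int h_meas]) auto
      show "AE u in \<pi> x. h n u \<le> max K (K\<^sup>2) * min u (u\<^sup>2)"
        using h_le by (intro AE_I2) (simp add: space_\<pi>)
    qed (rule dom_int)
    also have "\<dots> \<le> max K (K\<^sup>2) * C" using C K by (auto intro!: mult_left_mono)
    finally show ?thesis by (simp add: jump_h)
  qed
  have jump_lim: "(\<lambda>n. N n * jump x (K / N n)) \<longlonglongrightarrow> 0" for x
  proof -
    have "(\<lambda>n. \<integral>u. h n u \<partial>\<pi> x) \<longlonglongrightarrow> (\<integral>u. 0 \<partial>\<pi> x)"
    proof (rule integral_dominated_convergence[OF _ h_meas dom_int _ dom])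
      show "AE u in \<pi> x. (\<lambda>n. h n u) \<longlonglongrightarrow> 0"
      proof (rule AE_I2)
        fix u assume "u \<in> space (\<pi> x)"
        then have u: "0 < u" by (simp add: space_\<pi>)
        show "(\<lambda>n. h n u) \<longlonglongrightarrow> 0"
        proof (rule tendsto_sandwich[where f = "\<lambda>_. 0" and h = "\<lambda>n. K\<^sup>2 * u\<^sup>2 / N n"])
          show "eventually (\<lambda>n. 0 \<le> h n u) sequentially"
            using h_nonneg[OF u] by (intro always_eventually allI)
          show "eventually (\<lambda>n. h n u \<le> K\<^sup>2 * u\<^sup>2 / N n) sequentially"
            using h_sq[OF u] by (intro always_eventually allI)
        qed (auto intro: inv_lim)
      qed
    qed simp
    then show ?thesis by (simp add: jump_h)
  qed
  have sig: "N n * ((\<sigma> x)\<^sup>2 * (K / N n)\<^sup>2) = ((\<sigma> x)\<^sup>2 * K\<^sup>2) / N n" for n x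
    using N[of n] by (simp add: power2_eq_square)
  have eq: "N n * psi0 x (K / N n) = ((\<sigma> x)\<^sup>2 * K\<^sup>2) / N n + N n * jump x (K / N n)" for n x
    unfolding psi0_def distrib_left sig ..
  show thesis
  proof (rule that[of "s\<^sup>2 * K\<^sup>2 + max K (K\<^sup>2) * C"])
    fix n x
    have "((\<sigma> x)\<^sup>2 * K\<^sup>2) / N n \<le> ((\<sigma> x)\<^sup>2 * K\<^sup>2) / 1"
      using N[of n] by (intro divide_left_mono) auto
    also have "\<dots> = (\<sigma> x)\<^sup>2 * K\<^sup>2" by simp
    also have "\<dots> \<le> s\<^sup>2 * K\<^sup>2"
    proof (rule mult_right_mono)
      have "\<bar>\<sigma> x\<bar>\<^sup>2 \<le> s\<^sup>2" by (rule power_mono[OF s(2)]) simp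
      then show "(\<sigma> x)\<^sup>2 \<le> s\<^sup>2" by simp
    qed simp
    finally show "(real n + 1) * psi0 x (K / (real n + 1)) \<le> s\<^sup>2 * K\<^sup>2 + max K (K\<^sup>2) * C"
      using eq[of n x] jump_le[of n x] unfolding N_def by linarith
  next
    fix x
    have "(\<lambda>n. N n * psi0 x (K / N n)) \<longlonglongrightarrow> 0 + 0"
      unfolding eq by (rule tendsto_add[OF inv_lim jump_lim])
    then show "(\<lambda>n. (real n + 1) * psi0 x (K / (real n + 1))) \<longlonglongrightarrow> 0" by (simp add: N_def)
  qed
qed

end

section \<open>The superprocess and its mean\<close>

text \<open>The superprocess over the motion, with cumulants \<open>V\<close>, transition semigroup \<open>Q\<close> and laws \<open>Pr\<close> on
  path space.\<close>

locale superproc =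
  right_motion W \<xi> \<zeta> Law P + branching \<beta> \<sigma> \<pi>
  for W :: "'w measure"
    and \<xi> :: "real \<Rightarrow> 'w \<Rightarrow> 'e::polish_space"
    and \<zeta> :: "'w \<Rightarrow> ereal"
    and Law :: "'e \<Rightarrow> 'w measure"
    and P :: "real \<Rightarrow> 'e \<Rightarrow> 'e measure"
    and \<beta> \<sigma> :: "'e \<Rightarrow> real"
    and \<pi> :: "'e \<Rightarrow> real measure" +
  fixes V :: "real \<Rightarrow> ('e \<Rightarrow> real) \<Rightarrow> 'e \<Rightarrow> real"
    and Q :: "real \<Rightarrow> 'e fin_measure \<Rightarrow> 'e fin_measure measure"
    and Pr :: "'e fin_measure \<Rightarrow> (real \<Rightarrow> 'e fin_measure) measure"
  assumes cumulant: "cumulant_semigroup P (branching_mechanism \<beta> \<sigma> \<pi>) V"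
    and super: "superprocess V Q Pr"
begin

lemma super_right: "borel_right_process path_space (\<lambda>t \<omega>. \<omega> t) (\<lambda>_. \<infinity>) Pr Q"
  using super unfolding superprocess_def by (rule conjunct1)

lemma Q_borel_semigroup: "borel_semigroup Q"
  using super_right unfolding borel_right_process_def by (rule conjunct1)

lemma Q_kernel: "0 \<le> t \<Longrightarrow> Q t \<in> borel \<rightarrow>\<^sub>M subprob_algebra borel"
  using Q_borel_semigroup by (simp add: borel_semigroup_def)

lemma Q_semigroup: "0 \<le> s \<Longrightarrow> 0 \<le> t \<Longrightarrow> Q (s + t) \<mu> = Q s \<mu> \<bind> Q t"
  using Q_borel_semigroup by (simp add: borel_semigroup_def)

lemma sets_Q: "0 \<le> t \<Longrightarrow> sets (Q t \<mu>) = sets borel"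
  using measurable_space[OF Q_kernel, of t \<mu>] by (simp add: space_subprob_algebra)

lemma space_Q: "0 \<le> t \<Longrightarrow> space (Q t \<mu>) = UNIV"
  using sets_eq_imp_space_eq[OF sets_Q] by simp

lemma prob_Pr: "prob_space (Pr \<mu>)" and sets_Pr: "sets (Pr \<mu>) = sets path_space"
proof -
  have "Pr \<in> borel \<rightarrow>\<^sub>M prob_algebra path_space"
    using super_right by (simp add: borel_right_process_def)
  from measurable_space[OF this, of \<mu>] show "prob_space (Pr \<mu>)" "sets (Pr \<mu>) = sets path_space"
    by (simp_all add: space_prob_algebra)
qed

lemma space_Pr: "space (Pr \<mu>) = space path_space"
  using sets_eq_imp_space_eq[OF sets_Pr] .

lemma coordinate_event:
  assumes "0 \<le> t" "B \<in> sets borel"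
  shows "{\<omega> \<in> space path_space. \<omega> t \<in> (B :: 'e fin_measure set)} \<in> sets path_space"
proof -
  have "proc_event path_space (\<lambda>t \<omega>. \<omega> t) (\<lambda>_. \<infinity>) t B \<in> sets path_space"
    using super_right assms unfolding borel_right_process_def by blast
  then show ?thesis by (simp add: proc_event_def)
qed

lemma Pr_start: "AE \<omega> in Pr \<mu>. \<omega> 0 = \<mu>"
proof -
  have "AE \<omega> in Pr \<mu>. 0 < (\<infinity> :: ereal) \<and> \<omega> 0 = \<mu>"
    using super_right unfolding borel_right_process_def by blast
  then show ?thesis by simp
qed

lemma Pr_markov:
  assumes "0 \<le> s" "0 \<le> t" "A \<in> sets borel" "B \<in> sets borel"
  shows "emeasure (Pr \<mu>) {\<omega> \<in> space path_space. \<omega> s \<in> A \<and> \<omega> (s + t) \<in> B} =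
    (\<integral>\<^sup>+\<omega>. emeasure (Q t (\<omega> s)) B * indicator {\<omega> \<in> space path_space. \<omega> s \<in> A} \<omega> \<partial>Pr \<mu>)"
proof -
  let ?F = "natural_filtration path_space (\<lambda>t \<omega>. \<omega> t) (\<lambda>_. \<infinity>) s"
  have pe: "proc_event path_space (\<lambda>t \<omega>. \<omega> t) (\<lambda>_. \<infinity>) r C = {\<omega> \<in> space path_space. \<omega> r \<in> C}"
    for r and C :: "'e fin_measure set"
    by (simp add: proc_event_def)
  have "sets ?F = sigma_sets (space path_space)
      {proc_event path_space (\<lambda>t \<omega>. \<omega> t) (\<lambda>_. \<infinity>) r B | r B. 0 \<le> r \<and> r \<le> s \<and> B \<in> sets borel}"
    unfolding natural_filtration_def by (rule sets_measure_of) (auto simp: proc_event_def)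
  then have "proc_event path_space (\<lambda>t \<omega>. \<omega> t) (\<lambda>_. \<infinity>) s A \<in> sets ?F"
    using assms by auto
  then have "emeasure (Pr \<mu>) (proc_event path_space (\<lambda>t \<omega>. \<omega> t) (\<lambda>_. \<infinity>) s A
        \<inter> proc_event path_space (\<lambda>t \<omega>. \<omega> t) (\<lambda>_. \<infinity>) (s + t) B) =
      (\<integral>\<^sup>+\<omega>. emeasure (Q t (\<omega> s)) B * indicator (proc_event path_space (\<lambda>t \<omega>. \<omega> t) (\<lambda>_. \<infinity>) s A
        \<inter> proc_event path_space (\<lambda>t \<omega>. \<omega> t) (\<lambda>_. \<infinity>) s UNIV) \<omega> \<partial>Pr \<mu>)"
    using super_right assms unfolding borel_right_process_def by blast
  moreover have "{\<omega> \<in> space path_space. \<omega> s \<in> A} \<inter> {\<omega> \<in> space path_space. \<omega> (s + t) \<in> B}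
      = {\<omega> \<in> space path_space. \<omega> s \<in> A \<and> \<omega> (s + t) \<in> B}"
    "{\<omega> \<in> space path_space. \<omega> s \<in> A} \<inter> {\<omega> \<in> space path_space. \<omega> s \<in> UNIV}
      = {\<omega> \<in> space path_space. \<omega> s \<in> A}" by auto
  ultimately show ?thesis unfolding pe by simp
qed

lemma Q_eq_Pr:
  assumes t: "0 \<le> t" and B: "B \<in> sets borel"
  shows "emeasure (Pr \<mu>) {\<omega> \<in> space path_space. \<omega> t \<in> B} = emeasure (Q t \<mu>) B"
proof -
  interpret prob_space "Pr \<mu>" by (rule prob_Pr)
  have "emeasure (Pr \<mu>) {\<omega> \<in> space path_space. \<omega> t \<in> B}
      = (\<integral>\<^sup>+\<omega>. emeasure (Q t (\<omega> 0)) B * indicator {\<omega> \<in> space path_space. \<omega> 0 \<in> UNIV} \<omega> \<partial>Pr \<mu>)"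
    using Pr_markov[of 0 t UNIV B \<mu>] t B by simp
  also have "\<dots> = (\<integral>\<^sup>+\<omega>. emeasure (Q t \<mu>) B \<partial>Pr \<mu>)"
  proof (rule nn_integral_cong_AE)
    show "AE \<omega> in Pr \<mu>. emeasure (Q t (\<omega> 0)) B * indicator {\<omega> \<in> space path_space. \<omega> 0 \<in> UNIV} \<omega>
        = emeasure (Q t \<mu>) B"
      using Pr_start AE_space by eventually_elim (simp add: space_Pr)
  qed
  finally show ?thesis by (simp add: emeasure_space_1)
qed

lemma prob_Q: "0 \<le> t \<Longrightarrow> prob_space (Q t \<mu>)"
proof (rule prob_spaceI)
  assume t: "0 \<le> t"
  have "{\<omega> \<in> space path_space. \<omega> t \<in> (UNIV :: 'e fin_measure set)} = space (Pr \<mu>)"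
    by (simp add: space_Pr)
  then show "emeasure (Q t \<mu>) (space (Q t \<mu>)) = 1"
    using Q_eq_Pr[OF t, of UNIV \<mu>] prob_space.emeasure_space_1[OF prob_Pr, of \<mu>] t
    by (simp add: space_Q)
qed

lemma laplace:
  "0 \<le> t \<Longrightarrow> f \<in> bp_borel \<Longrightarrow> (\<integral>\<eta>. exp (- integ \<eta> f) \<partial>Q t \<mu>) = exp (- integ \<mu> (V t f))"
  using super[unfolded superprocess_def, THEN conjunct2] by simp

lemma V_solution:
  assumes f: "f \<in> bp_borel"
  shows "cumulant_solution P (branching_mechanism \<beta> \<sigma> \<pi>) f (\<lambda>t. V t f)"
  using bspec[OF cumulant[unfolded cumulant_semigroup_def] f] by (rule conjunct1)

lemma V_nonneg:
  assumes "f \<in> bp_borel" "0 \<le> t"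
  shows "0 \<le> V t f x"
  using V_solution[OF assms(1)] assms(2) by (simp add: cumulant_solution_def)

lemma V_bounded:
  assumes "f \<in> bp_borel" "0 \<le> t"
  obtains K where "0 \<le> K" "\<And>s x. 0 \<le> s \<Longrightarrow> s \<le> t \<Longrightarrow> V s f x \<le> K"
proof -
  have "bounded ((\<lambda>(t, x). V t f x) ` ({0..t} \<times> UNIV))"
    using V_solution[OF assms(1)] assms(2) by (simp add: cumulant_solution_def)
  then obtain K where K: "\<And>s x. 0 \<le> s \<Longrightarrow> s \<le> t \<Longrightarrow> \<bar>V s f x\<bar> \<le> K"
    by (force simp: bounded_iff)
  then have "0 \<le> K" using K[of 0] assms(2) abs_ge_zero order_trans by blast
  with K show thesis by (intro that[of K]) (auto dest: abs_le_D1)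
qed

lemma V_measurable_joint:
  assumes f: "f \<in> bp_borel"
  shows "(\<lambda>(s, y). if 0 \<le> s then V s f y else 0) \<in> borel_measurable (borel \<Otimes>\<^sub>M borel)"
proof -
  have "(\<lambda>(s, y). V s f y) \<in> borel_measurable (restrict_space borel ({0..} \<times> UNIV))"
    using V_solution[OF f] by (simp add: cumulant_solution_def)
  then have "(\<lambda>p. if 0 \<le> fst p then (\<lambda>(s, y). V s f y) p else 0) \<in> borel_measurable (borel :: (real \<times> 'e) measure)"
  proof (subst measurable_If_restrict_space_iff)
    have "closed ({p. 0 \<le> fst p} :: (real \<times> 'e) set)"
      by (intro closed_Collect_le continuous_intros)
    then show "{p \<in> space borel. 0 \<le> fst p} \<in> sets (borel :: (real \<times> 'e) measure)" by simp
    have "{p :: real \<times> 'e. 0 \<le> fst p} = {0..} \<times> UNIV" by auto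
    then show "(\<lambda>(s, y). V s f y) \<in> borel_measurable (restrict_space borel ({0..} \<times> UNIV)) \<Longrightarrow>
        (\<lambda>(s, y). V s f y) \<in> borel_measurable (restrict_space borel {p. 0 \<le> fst p}) \<and>
        (\<lambda>p. 0 :: real) \<in> borel_measurable (restrict_space borel {p. \<not> 0 \<le> fst p})"
      by simp
  qed
  then show ?thesis by (simp add: borel_prod split_beta' cong: if_cong)
qed

lemma V_bp: "f \<in> bp_borel \<Longrightarrow> 0 \<le> t \<Longrightarrow> V t f \<in> bp_borel"
proof -
  assume f: "f \<in> bp_borel" and t: "0 \<le> t"
  have "V t f \<in> borel_measurable borel"
    using measurable_compose[OF measurable_Pair1' V_measurable_joint[OF f], of t] t by simp
  moreover obtain K where "\<And>s x. 0 \<le> s \<Longrightarrow> s \<le> t \<Longrightarrow> V s f x \<le> K"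
    by (rule V_bounded[OF f t]) blast
  then have "V t f x \<le> K" for x using t by blast
  ultimately show "V t f \<in> bp_borel"
    using V_nonneg[OF f t] by (intro bp_borelI[of _ K])
qed

text \<open>The rescaled cumulants \<open>n V\<^sub>s(f/n)\<close>, whose limit is the mean; \<open>n + 1\<close> stands in for \<open>n\<close>.\<close>

definition scaled :: "('e \<Rightarrow> real) \<Rightarrow> nat \<Rightarrow> real \<Rightarrow> 'e \<Rightarrow> real" where
  "scaled f n s y = (real n + 1) * V s (\<lambda>z. f z / (real n + 1)) y"

lemma scale_bp: "f \<in> bp_borel \<Longrightarrow> (\<lambda>z. f z / (real n + 1)) \<in> bp_borel"
  using cmult_bp_borel[of f "1 / (real n + 1)"] by simp

lemma scaled_nonneg: "f \<in> bp_borel \<Longrightarrow> 0 \<le> s \<Longrightarrow> 0 \<le> scaled f n s y"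
  unfolding scaled_def by (rule mult_nonneg_nonneg[OF _ V_nonneg[OF scale_bp]]) simp_all

lemma scaled_measurable_joint:
  "f \<in> bp_borel \<Longrightarrow> (\<lambda>(s, y). if 0 \<le> s then scaled f n s y else 0) \<in> borel_measurable (borel \<Otimes>\<^sub>M borel)"
proof -
  assume "f \<in> bp_borel"
  then have "(\<lambda>(s, y). if 0 \<le> s then V s (\<lambda>z. f z / (real n + 1)) y else 0) \<in> borel_measurable (borel \<Otimes>\<^sub>M borel)"
    by (intro V_measurable_joint scale_bp)
  then have "(\<lambda>p. (real n + 1) * (\<lambda>(s, y). if 0 \<le> s then V s (\<lambda>z. f z / (real n + 1)) y else 0) p)
      \<in> borel_measurable (borel \<Otimes>\<^sub>M borel)"
    by (rule borel_measurable_times[OF borel_measurable_const])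
  also have "(\<lambda>p. (real n + 1) * (\<lambda>(s, y). if 0 \<le> s then V s (\<lambda>z. f z / (real n + 1)) y else 0) p)
      = (\<lambda>(s, y). if 0 \<le> s then scaled f n s y else 0)"
    by (auto simp: scaled_def fun_eq_iff)
  finally show ?thesis .
qed

text \<open>The integrand of the integral equation that the rescaled cumulants satisfy.\<close>

definition force :: "('e \<Rightarrow> real) \<Rightarrow> nat \<Rightarrow> real \<Rightarrow> 'e \<Rightarrow> real" where
  "force f n s y = \<beta> y * scaled f n s y - (real n + 1) * psi0 y (scaled f n s y / (real n + 1))"

lemma force_measurable_joint:
  assumes f: "f \<in> bp_borel"
  shows "(\<lambda>(r, y). if 0 \<le> r \<and> r \<le> s then force f n (s - r) y else 0) \<in> borel_measurable (borel \<Otimes>\<^sub>M borel)"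
proof -
  let ?M = "(borel :: real measure) \<Otimes>\<^sub>M (borel :: 'e measure)"
  define u where "u p = (if 0 \<le> s - fst p then scaled f n (s - fst p) (snd p) else 0)" for p
  have "(\<lambda>p. (\<lambda>(s, y). if 0 \<le> s then scaled f n s y else 0) (s - fst p, snd p)) \<in> borel_measurable ?M"
    by (rule measurable_compose[OF _ scaled_measurable_joint[OF f]]) measurable
  then have u [measurable]: "u \<in> borel_measurable ?M" by (simp add: u_def[abs_def])
  have [measurable]: "\<beta> \<in> borel_measurable borel" using \<beta>_bdd by measurable
  have [measurable]: "(\<lambda>p. (\<lambda>(x, z). if 0 \<le> z then psi0 x z else 0) (snd p, u p / (real n + 1))) \<in> borel_measurable ?M"
    by (rule measurable_compose[OF _ psi0_measurable]) measurable
  have "(\<lambda>p. if 0 \<le> fst p \<and> fst p \<le> s then \<beta> (snd p) * u p - (real n + 1)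
      * (\<lambda>(x, z). if 0 \<le> z then psi0 x z else 0) (snd p, u p / (real n + 1)) else 0) \<in> borel_measurable ?M"
    by measurable
  moreover have "(if 0 \<le> fst p \<and> fst p \<le> s then \<beta> (snd p) * u p - (real n + 1)
      * (\<lambda>(x, z). if 0 \<le> z then psi0 x z else 0) (snd p, u p / (real n + 1)) else 0)
      = (\<lambda>(r, y). if 0 \<le> r \<and> r \<le> s then force f n (s - r) y else 0) p" for p
    using scaled_nonneg[OF f, of "s - fst p" n "snd p"] by (auto simp: u_def force_def split_beta')
  ultimately show ?thesis by simp
qed

lemma scaled_equation:
  assumes f: "f \<in> bp_borel" and s: "0 \<le> s"
  shows "scaled f n s y = (\<integral>z. f z \<partial>P s y) + (LINT r:{0..s}|lborel. \<integral>z. force f n (s - r) z \<partial>P r y)"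
proof -
  let ?N = "real n + 1" and ?v = "\<lambda>t. V t (\<lambda>z. f z / (real n + 1))"
  have "?v s y + (LINT r:{0..s}|lborel. \<integral>z. branching_mechanism \<beta> \<sigma> \<pi> z (?v (s - r) z) \<partial>P r y)
      = (\<integral>z. f z / ?N \<partial>P s y)"
    using V_solution[OF scale_bp[OF f]] s by (simp add: cumulant_solution_def)
  then have "?N * ?v s y = ?N * (\<integral>z. f z / ?N \<partial>P s y)
      - ?N * (LINT r:{0..s}|lborel. \<integral>z. branching_mechanism \<beta> \<sigma> \<pi> z (?v (s - r) z) \<partial>P r y)"
    unfolding eq_diff_eq distrib_left[symmetric] by (rule arg_cong)
  also have "?N * (\<integral>z. f z / ?N \<partial>P s y) = (\<integral>z. f z \<partial>P s y)" by simp
  also have "?N * (LINT r:{0..s}|lborel. \<integral>z. branching_mechanism \<beta> \<sigma> \<pi> z (?v (s - r) z) \<partial>P r y)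
      = (LINT r:{0..s}|lborel. - (\<integral>z. force f n (s - r) z \<partial>P r y))"
  proof -
    have "?N * branching_mechanism \<beta> \<sigma> \<pi> z (?v r z) = - force f n r z" for r z
    proof -
      have "scaled f n r z / ?N = ?v r z" by (simp add: scaled_def)
      moreover have "c * (- b * v + w) = - (b * (c * v) - c * w)" for b c v w :: real
        by (simp add: algebra_simps)
      ultimately show ?thesis
        unfolding force_def branching_mechanism_eq by (simp only: scaled_def)
    qed
    note scaled_mechanism = this
    have "?N * (\<integral>z. branching_mechanism \<beta> \<sigma> \<pi> z (?v (s - r) z) \<partial>P r y)
        = - (\<integral>z. force f n (s - r) z \<partial>P r y)" for r
    proof -
      have "?N * (\<integral>z. branching_mechanism \<beta> \<sigma> \<pi> z (?v (s - r) z) \<partial>P r y)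
          = (\<integral>z. ?N * branching_mechanism \<beta> \<sigma> \<pi> z (?v (s - r) z) \<partial>P r y)"
        by (rule Bochner_Integration.integral_mult_right_zero[symmetric])
      also have "\<dots> = (\<integral>z. - force f n (s - r) z \<partial>P r y)"
        unfolding scaled_mechanism ..
      finally show ?thesis by simp
    qed
    note integral_mechanism = this
    have "?N * (LINT r:{0..s}|lborel. \<integral>z. branching_mechanism \<beta> \<sigma> \<pi> z (?v (s - r) z) \<partial>P r y)
        = (LINT r:{0..s}|lborel. ?N * (\<integral>z. branching_mechanism \<beta> \<sigma> \<pi> z (?v (s - r) z) \<partial>P r y))"
      by (rule set_integral_mult_right[symmetric])
    then show ?thesis unfolding integral_mechanism .
  qed
  also have "(LINT r:{0..s}|lborel. - (\<integral>z. force f n (s - r) z \<partial>P r y))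
      = - (LINT r:{0..s}|lborel. \<integral>z. force f n (s - r) z \<partial>P r y)"
    by (simp add: set_lebesgue_integral_def)
  finally show ?thesis unfolding scaled_def diff_minus_eq_add .
qed

lemma integral_P_le_const:
  fixes g :: "'e \<Rightarrow> real"
  assumes "0 \<le> r" "\<And>z. g z \<le> C" "0 \<le> C"
  shows "(\<integral>z. g z \<partial>P r y) \<le> C"
proof (cases "integrable (P r y) g")
  case True
  interpret subprob_space "P r y" using assms(1) by (rule subprob_P)
  have "(\<integral>z. g z \<partial>P r y) \<le> (\<integral>z. C \<partial>P r y)"
    using True assms(2) by (intro integral_mono) auto
  also have "\<dots> \<le> C"
    using assms(3) subprob_measure_le_1[of "space (P r y)"] by (simp add: mult_left_le mult.commute)
  finally show ?thesis .
qed (use assms in \<open>simp add: not_integrable_integral_eq\<close>)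

text \<open>A bound on the rescaled cumulants that is uniform in the scale, from the equation and the
  sign of \<open>psi0\<close>; the supremum is weighted by \<open>exp (- 2 b s)\<close> so that the equation contracts.\<close>

lemma scaled_bound:
  assumes f: "f \<in> bp_borel" and Kf: "\<And>y. f y \<le> Kf" and b: "0 < b" "\<And>y. \<bar>\<beta> y\<bar> \<le> b"
    and s: "0 \<le> s" "s \<le> t"
  shows "scaled f n s y \<le> 2 * Kf * exp (2 * b * t)"
proof -
  have Kf0: "0 \<le> Kf" using nonneg_borel_nonneg[of f undefined] f Kf[of undefined] by auto
  have t: "0 \<le> t" using s by simp
  obtain K0 where K0: "0 \<le> K0" "\<And>s x. 0 \<le> s \<Longrightarrow> s \<le> t \<Longrightarrow> V s (\<lambda>z. f z / (real n + 1)) x \<le> K0"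
    by (rule V_bounded[OF scale_bp[OF f, of n] t]) blast
  \<comment> \<open>finite, since the cumulant at a fixed scale is bounded, but a priori not uniformly in \<open>n\<close>\<close>
  define S where "S = {exp (- (2 * b * s)) * scaled f n s y | s y. 0 \<le> s \<and> s \<le> t}"
  define A where "A = Sup S"
  have bdd: "bdd_above S"
  proof (rule bdd_aboveI)
    fix a assume "a \<in> S"
    then obtain s y where a: "a = exp (- (2 * b * s)) * scaled f n s y" "0 \<le> s" "s \<le> t"
      by (auto simp: S_def)
    have "a \<le> 1 * ((real n + 1) * K0)"
      unfolding a(1) scaled_def
    proof (rule mult_mono)
      show "exp (- (2 * b * s)) \<le> 1" using b a by simp
      show "(real n + 1) * V s (\<lambda>z. f z / (real n + 1)) y \<le> (real n + 1) * K0"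
        using K0(2)[OF a(2,3)] by (intro mult_left_mono) auto
      show "0 \<le> (real n + 1) * V s (\<lambda>z. f z / (real n + 1)) y"
        using scaled_nonneg[OF f a(2), of n y] by (simp add: scaled_def)
    qed simp
    then show "a \<le> (real n + 1) * K0" by simp
  qed
  have le_A: "scaled f n s y \<le> A * exp (2 * b * s)" if "0 \<le> s" "s \<le> t" for s y
  proof -
    have "exp (- (2 * b * s)) * scaled f n s y \<le> A"
      unfolding A_def using that by (intro cSup_upper bdd) (auto simp: S_def)
    then have "(exp (- (2 * b * s)) * scaled f n s y) * exp (2 * b * s) \<le> A * exp (2 * b * s)"
      by (rule mult_right_mono) simp
    then show ?thesis by (simp add: exp_minus field_simps)
  qed
  have A0: "0 \<le> A"
    using le_A[of 0 undefined] scaled_nonneg[OF f, of 0 n undefined] t by simp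
  have step: "exp (- (2 * b * s)) * scaled f n s y \<le> Kf + A / 2" if s: "0 \<le> s" "s \<le> t" for s y
  proof -
    define q where "q r = b * A * exp (2 * b * s) * exp (- (2 * b) * r)" for r
    have q0: "0 \<le> q r" for r using b A0 by (simp add: q_def)
    have force_le: "(\<integral>z. force f n (s - r) z \<partial>P r y) \<le> q r" if r: "r \<in> {0..s}" for r
    proof (rule integral_P_le_const)
      fix z
      have sr: "0 \<le> s - r" "s - r \<le> t" using r s by auto
      have "force f n (s - r) z \<le> \<beta> z * scaled f n (s - r) z"
        using psi0_nonneg[of "scaled f n (s - r) z / (real n + 1)" z] scaled_nonneg[OF f sr(1), of n z]
        by (simp add: force_def)
      also have "\<dots> \<le> b * scaled f n (s - r) z"
        using b(2)[of z] scaled_nonneg[OF f sr(1)] by (intro mult_right_mono) auto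
      also have "\<dots> \<le> b * (A * exp (2 * b * (s - r)))"
        using b le_A[OF sr] by (intro mult_left_mono) auto
      also have "\<dots> = q r" by (simp add: q_def mult_exp_exp right_diff_distrib)
      finally show "force f n (s - r) z \<le> q r" .
    qed (use r q0 in auto)
    have q_meas: "q \<in> borel_measurable borel" unfolding q_def by measurable
    have q_int: "set_integrable lborel {0..s} q"
    proof (rule set_integrable_bounded[where K = "b * A * exp (2 * b * s)"])
      fix r assume "r \<in> {0..s}"
      then have "exp (- (2 * b) * r) \<le> 1" using b by simp
      then have "q r \<le> b * A * exp (2 * b * s) * 1"
        unfolding q_def using b A0 by (intro mult_left_mono) auto
      then show "\<bar>q r\<bar> \<le> b * A * exp (2 * b * s)" using q0[of r] by simp
    qed (use q_meas s in auto)
    have "(LINT r:{0..s}|lborel. \<integral>z. force f n (s - r) z \<partial>P r y) \<le> (LINT r:{0..s}|lborel. q r)"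
    proof (cases "set_integrable lborel {0..s} (\<lambda>r. \<integral>z. force f n (s - r) z \<partial>P r y)")
      case True
      then show ?thesis using q_int force_le by (rule set_integral_mono)
    next
      case False
      then have "(LINT r:{0..s}|lborel. \<integral>z. force f n (s - r) z \<partial>P r y) = 0"
        by (simp add: set_integrable_def set_lebesgue_integral_def not_integrable_integral_eq)
      moreover have "0 \<le> (LINT r:{0..s}|lborel. q r)"
        unfolding set_lebesgue_integral_def using q0 by (intro Bochner_Integration.integral_nonneg) simp
      ultimately show ?thesis by simp
    qed
    also have "(LINT r:{0..s}|lborel. q r) = A / 2 * exp (2 * b * s) * (1 - exp (- (2 * b) * s))"
    proof -
      have exponent: "(LINT u:{0..r}|lborel. - (2 * b)) = - (2 * b) * r" if "0 \<le> r" for r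
        using that by (simp add: set_integral_const)
      have "(LINT r:{0..s}|lborel. - (2 * b) * exp (- (2 * b) * r))
          = (LINT r:{0..s}|lborel. - (2 * b) * exp (LINT u:{0..r}|lborel. - (2 * b)))"
        by (rule set_lebesgue_integral_cong) (auto simp only: exponent atLeastAtMost_iff sets_lborel borel_closed closed_atLeastAtMost)
      also have "\<dots> = exp (LINT u:{0..s}|lborel. - (2 * b)) - 1"
        by (rule integral_exp_integral[where b = "2 * b"]) (use b s in auto)
      also have "\<dots> = exp (- (2 * b) * s) - 1"
        using exponent[OF s(1)] by simp
      finally have "(LINT r:{0..s}|lborel. - (2 * b) * exp (- (2 * b) * r)) = exp (- (2 * b) * s) - 1" .
      then have "(- A / 2 * exp (2 * b * s)) * (LINT r:{0..s}|lborel. - (2 * b) * exp (- (2 * b) * r))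
          = (- A / 2 * exp (2 * b * s)) * (exp (- (2 * b) * s) - 1)"
        by (rule arg_cong)
      also have "\<dots> = A / 2 * exp (2 * b * s) * (1 - exp (- (2 * b) * s))"
        by (simp add: right_diff_distrib)
      finally have "(- A / 2 * exp (2 * b * s)) * (LINT r:{0..s}|lborel. - (2 * b) * exp (- (2 * b) * r))
          = A / 2 * exp (2 * b * s) * (1 - exp (- (2 * b) * s))" .
      moreover have "(- A / 2 * exp (2 * b * s)) * (LINT r:{0..s}|lborel. - (2 * b) * exp (- (2 * b) * r))
          = (LINT r:{0..s}|lborel. q r)"
      proof -
        have "q = (\<lambda>r. (- A / 2 * exp (2 * b * s)) * (- (2 * b) * exp (- (2 * b) * r)))"
          by (simp add: q_def fun_eq_iff)
        then show ?thesis by (simp only: set_integral_mult_right)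
      qed
      ultimately show ?thesis by simp
    qed
    also have "\<dots> \<le> A / 2 * exp (2 * b * s)"
      using A0 by (intro mult_left_le) auto
    finally have "scaled f n s y \<le> Kf + A / 2 * exp (2 * b * s)"
      using integral_P_le_const[of s f Kf y] Kf Kf0 s scaled_equation[OF f s(1), of n y] by simp
    then have "exp (- (2 * b * s)) * scaled f n s y
        \<le> exp (- (2 * b * s)) * (Kf + A / 2 * exp (2 * b * s))"
      by (rule mult_left_mono) simp
    also have "\<dots> = exp (- (2 * b * s)) * Kf + A / 2"
      by (simp add: distrib_left exp_minus field_simps)
    also have "\<dots> \<le> Kf + A / 2"
      using b s Kf0 by (simp add: mult_le_cancel_right1 mult_left_le_one_le)
    finally show ?thesis .
  qed
  have "A \<le> Kf + A / 2"
    unfolding A_def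
  proof (rule cSup_least)
    show "S \<noteq> {}" using t by (auto simp: S_def)
    show "a \<le> Kf + Sup S / 2" if "a \<in> S" for a
      using that step unfolding A_def[symmetric] by (auto simp: S_def)
  qed
  then have "A \<le> 2 * Kf" by simp
  have "scaled f n s y \<le> A * exp (2 * b * s)" by (rule le_A[OF s])
  also have "\<dots> \<le> 2 * Kf * exp (2 * b * t)"
    using \<open>A \<le> 2 * Kf\<close> A0 s b by (intro mult_mono) auto
  finally show ?thesis .
qed

text \<open>The rescaled cumulants converge to the mean: \<open>n (1 - exp (- \<eta>(f)/n))\<close> increases to \<open>\<eta>(f)\<close>, and
  Fatou's lemma with the uniform bound gives the integrability of \<open>\<eta>(f)\<close>.\<close>

lemma mean_limit:
  assumes f: "f \<in> bp_borel" and t: "0 \<le> t" and K: "\<And>n y. scaled f n t y \<le> K"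
  shows "integrable (Q t \<mu>) (\<lambda>\<eta>. integ \<eta> f)"
    and "(\<lambda>n. integ \<mu> (scaled f n t)) \<longlonglongrightarrow> (\<integral>\<eta>. integ \<eta> f \<partial>Q t \<mu>)"
proof -
  interpret prob_space "Q t \<mu>" by (rule prob_Q[OF t])
  define N where "N n = real n + 1" for n
  have N: "0 < N n" for n by (simp add: N_def)
  have m: "(\<lambda>\<eta>. integ \<eta> f) \<in> borel_measurable (Q t \<mu>)"
    using f t by (subst measurable_cong_sets[OF sets_Q refl]) auto
  have pos: "0 \<le> integ \<eta> f" for \<eta> using f by (intro integ_nonneg) auto
  have scaled_bp: "scaled f n t \<in> bp_borel" for n
    unfolding scaled_def[abs_def] using cmult_bp_borel[OF V_bp[OF scale_bp[OF f] t], of "real n + 1" n] by simp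
  define w where "w n = integ \<mu> (scaled f n t)" for n
  define K' where "K' = integ \<mu> (\<lambda>_. K)"
  have K0: "0 \<le> K" using scaled_nonneg[OF f t, of 0 undefined] K[of 0 undefined] by linarith
  have w: "0 \<le> w n" "w n \<le> K'" for n
    using scaled_bp[of n] K K0 const_bp_borel[of K]
    by (auto simp: w_def K'_def intro!: integ_nonneg integ_mono)
  have K'0: "0 \<le> K'" using w[of 0] by simp
  define g where "g n \<eta> = N n * (1 - exp (- (integ \<eta> f / N n)))" for n and \<eta> :: "'e fin_measure"
  have g_nonneg: "0 \<le> g n \<eta>" for n \<eta> using N[of n] pos[of \<eta>] by (simp add: g_def)
  have g_le: "g n \<eta> \<le> integ \<eta> f" for n \<eta>
  proof -
    have "N n * (1 - exp (- (integ \<eta> f / N n))) \<le> N n * (integ \<eta> f / N n)"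
      using N[of n] exp_ge_add_one_self[of "- (integ \<eta> f / N n)"] by (intro mult_left_mono) auto
    then show ?thesis using N[of n] by (simp add: g_def)
  qed
  have g_meas: "g n \<in> borel_measurable (Q t \<mu>)" for n
    unfolding g_def using m by measurable
  have g_lim: "(\<lambda>n. g n \<eta>) \<longlonglongrightarrow> integ \<eta> f" for \<eta>
    using tendsto_diff[OF tendsto_const exp_rescaled_limit[of "\<lambda>_. integ \<eta> f" "integ \<eta> f"], of "integ \<eta> f"] pos[of \<eta>]
    by (simp add: g_def N_def)
  have g_int: "(\<integral>\<eta>. g n \<eta> \<partial>Q t \<mu>) = N n * (1 - exp (- (w n / N n)))" and g_integrable: "integrable (Q t \<mu>) (g n)" for n
  proof -
    have "integ \<eta> f / N n = integ \<eta> (\<lambda>z. f z / (real n + 1))" for \<eta> :: "'e fin_measure"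
      by (simp add: integ_def N_def)
    moreover have "w n / N n = integ \<mu> (V t (\<lambda>z. f z / (real n + 1)))"
      by (simp add: w_def scaled_def[abs_def] N_def integ_cmult)
    ultimately have E: "(\<integral>\<eta>. exp (- (integ \<eta> f / N n)) \<partial>Q t \<mu>) = exp (- (w n / N n))"
      using laplace[OF t scale_bp[OF f, of n], of \<mu>] by simp
    have int: "integrable (Q t \<mu>) (\<lambda>\<eta>. exp (- (integ \<eta> f / N n)))"
      using m pos N[of n] by (intro integrable_const_bound[of _ 1]) auto
    show "(\<integral>\<eta>. g n \<eta> \<partial>Q t \<mu>) = N n * (1 - exp (- (w n / N n)))"
      unfolding g_def using int E prob_space by simp
    show "integrable (Q t \<mu>) (g n)" unfolding g_def using int by simp
  qed
  have I_le: "N n * (1 - exp (- (w n / N n))) \<le> K'" for n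
  proof -
    have "N n * (1 - exp (- (w n / N n))) \<le> N n * (w n / N n)"
      using N[of n] exp_ge_add_one_self[of "- (w n / N n)"] by (intro mult_left_mono) auto
    then show ?thesis using N[of n] w(2)[of n] by simp
  qed
  have "(\<integral>\<^sup>+\<eta>. ennreal (integ \<eta> f) \<partial>Q t \<mu>) = (\<integral>\<^sup>+\<eta>. liminf (\<lambda>n. ennreal (g n \<eta>)) \<partial>Q t \<mu>)"
    by (intro nn_integral_cong lim_imp_Liminf[symmetric] tendsto_ennrealI g_lim) simp
  also have "\<dots> \<le> liminf (\<lambda>n. \<integral>\<^sup>+\<eta>. ennreal (g n \<eta>) \<partial>Q t \<mu>)"
    using g_meas by (intro nn_integral_liminf) auto
  also have "\<dots> \<le> ennreal K'"
  proof -
    have "(\<integral>\<^sup>+\<eta>. ennreal (g n \<eta>) \<partial>Q t \<mu>) \<le> ennreal K'" for n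
      using g_integrable[of n] g_nonneg I_le[of n] g_int[of n]
      by (subst nn_integral_eq_integral) (auto intro: ennreal_leI)
    then have "liminf (\<lambda>n. \<integral>\<^sup>+\<eta>. ennreal (g n \<eta>) \<partial>Q t \<mu>) \<le> liminf (\<lambda>n :: nat. ennreal K')"
      by (intro Liminf_mono always_eventually allI)
    then show ?thesis by (simp add: Liminf_const)
  qed
  also have "\<dots> < \<infinity>" by simp
  finally show int: "integrable (Q t \<mu>) (\<lambda>\<eta>. integ \<eta> f)"
    using m pos by (intro integrableI_nonneg) auto
  have "(\<lambda>n. \<integral>\<eta>. g n \<eta> \<partial>Q t \<mu>) \<longlonglongrightarrow> (\<integral>\<eta>. integ \<eta> f \<partial>Q t \<mu>)"
    using m g_meas int g_lim g_le g_nonneg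
    by (intro integral_dominated_convergence[where w = "\<lambda>\<eta>. integ \<eta> f"]) auto
  then have "(\<lambda>n. N n * (1 - exp (- (w n / N n)))) \<longlonglongrightarrow> (\<integral>\<eta>. integ \<eta> f \<partial>Q t \<mu>)"
    by (simp add: g_int)
  moreover have "(\<lambda>n. w n - N n * (1 - exp (- (w n / N n)))) \<longlonglongrightarrow> 0"
    unfolding N_def by (rule exp_rescaled_limit[OF w])
  ultimately have "(\<lambda>n. (w n - N n * (1 - exp (- (w n / N n)))) + N n * (1 - exp (- (w n / N n))))
      \<longlonglongrightarrow> 0 + (\<integral>\<eta>. integ \<eta> f \<partial>Q t \<mu>)"
    by (intro tendsto_add)
  then show "(\<lambda>n. integ \<mu> (scaled f n t)) \<longlonglongrightarrow> (\<integral>\<eta>. integ \<eta> f \<partial>Q t \<mu>)"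
    by (simp add: w_def)
qed

text \<open>The mean of the superprocess is the mean semigroup: the rescaled cumulants converge to a
  bounded solution of the linear equation, which the Feynman-Kac formula identifies.\<close>

proposition mean_formula:
  assumes f: "f \<in> bp_borel" and t: "0 \<le> t"
  obtains m where "m \<in> bp_borel" "\<And>x. mean_semigroup \<xi> \<zeta> Law \<beta> t f x = ennreal (m x)"
    "\<And>\<mu>. integrable (Q t \<mu>) (\<lambda>\<eta>. integ \<eta> f)" "\<And>\<mu>. (\<integral>\<eta>. integ \<eta> f \<partial>Q t \<mu>) = integ \<mu> m"
proof -
  obtain Kf where Kf: "0 < Kf" "\<And>y. \<bar>f y\<bar> \<le> Kf" using bdd_borel_bound[of f] f by blast
  obtain b where b: "0 < b" "\<And>y. \<bar>\<beta> y\<bar> \<le> b" using bdd_borel_bound[OF \<beta>_bdd] by blast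
  define K where "K = 2 * Kf * exp (2 * b * t)"
  have K0: "0 \<le> K" using Kf by (simp add: K_def)
  have f_le: "f y \<le> Kf" for y using Kf(2)[of y] by simp
  have bound: "scaled f n s y \<le> K" if "0 \<le> s" "s \<le> t" for n s y
    unfolding K_def by (rule scaled_bound[OF f f_le b that])
  define M where "M s y = (\<integral>\<eta>. integ \<eta> f \<partial>Q s (dirac y))" for s y
  have scaled_bp: "scaled f n s \<in> bp_borel" if "0 \<le> s" for n s
    unfolding scaled_def[abs_def]
    using cmult_bp_borel[OF V_bp[OF scale_bp[OF f] that], of "real n + 1" n] by simp
  have lim: "(\<lambda>n. scaled f n s y) \<longlonglongrightarrow> M s y" if s: "0 \<le> s" "s \<le> t" for s y
  proof -
    have "integ (dirac y) (scaled f n s) = scaled f n s y" for n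
      using scaled_bp[OF s(1), of n] by (intro integ_dirac) auto
    with mean_limit(2)[OF f s(1) bound[OF s], of "dirac y"] show ?thesis
      by (simp add: M_def)
  qed
  have M_nonneg: "0 \<le> M s y" and M_le: "M s y \<le> K" if s: "0 \<le> s" "s \<le> t" for s y
    using LIMSEQ_le_const[OF lim[OF s]] LIMSEQ_le_const2[OF lim[OF s]] scaled_nonneg[OF f s(1)] bound[OF s]
    by blast+
  define m where "m s y = (if 0 \<le> s \<and> s \<le> t then M s y else 0)" for s y
  have m_bound: "\<bar>m s y\<bar> \<le> K" for s y
    using M_nonneg[of s y] M_le[of s y] K0 by (simp add: m_def)
  have m_meas: "(\<lambda>(s, y). m s y) \<in> borel_measurable (borel \<Otimes>\<^sub>M borel)"
  proof (rule borel_measurable_LIMSEQ_real)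
    show "(\<lambda>p. if fst p \<le> t then (\<lambda>(s, y). if 0 \<le> s then scaled f n s y else 0) p else 0)
        \<in> borel_measurable ((borel :: real measure) \<Otimes>\<^sub>M (borel :: 'e measure))" for n
      by (intro measurable_If scaled_measurable_joint[OF f]) measurable
    show "(\<lambda>n. if fst p \<le> t then (\<lambda>(s, y). if 0 \<le> s then scaled f n s y else 0) p else 0)
        \<longlonglongrightarrow> (\<lambda>(s, y). m s y) p" for p :: "real \<times> 'e"
      using lim[of "fst p" "snd p"]
      by (cases p; cases "0 \<le> fst p"; cases "fst p \<le> t") (simp_all add: m_def)
  qed
  obtain D where D: "\<And>n x. (real n + 1) * psi0 x (K / (real n + 1)) \<le> D"
    "\<And>x. (\<lambda>n. (real n + 1) * psi0 x (K / (real n + 1))) \<longlonglongrightarrow> 0"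
    by (rule psi0_scaled[OF K0]) blast
  have psi_le: "0 \<le> (real n + 1) * psi0 z (scaled f n s z / (real n + 1))"
    "(real n + 1) * psi0 z (scaled f n s z / (real n + 1)) \<le> (real n + 1) * psi0 z (K / (real n + 1))"
    if s: "0 \<le> s" "s \<le> t" for n s z
  proof -
    have "0 \<le> scaled f n s z / (real n + 1)" using scaled_nonneg[OF f s(1), of n z] by simp
    moreover have "scaled f n s z / (real n + 1) \<le> K / (real n + 1)"
      using bound[OF s, of n z] by (intro divide_right_mono) auto
    ultimately show "0 \<le> (real n + 1) * psi0 z (scaled f n s z / (real n + 1))"
      "(real n + 1) * psi0 z (scaled f n s z / (real n + 1)) \<le> (real n + 1) * psi0 z (K / (real n + 1))"
      by (auto intro!: mult_left_mono mult_nonneg_nonneg psi0_mono psi0_nonneg)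
  qed
  define C where "C = b * K + D"
  have D0: "0 \<le> D" using psi_le[OF order_refl t, of 0 undefined] D(1)[of 0 undefined] by linarith
  have C0: "0 \<le> C" using b K0 D0 by (simp add: C_def)
  have force_bound: "\<bar>force f n s z\<bar> \<le> C" if s: "0 \<le> s" "s \<le> t" for n s z
  proof -
    have "\<bar>\<beta> z * scaled f n s z\<bar> \<le> b * K"
      unfolding abs_mult using b bound[OF s, of n z] scaled_nonneg[OF f s(1), of n z]
      by (intro mult_mono) auto
    with psi_le[OF s, of n z] D(1)[of n z] show ?thesis
      unfolding force_def C_def by linarith
  qed
  have force_lim: "(\<lambda>n. force f n s z) \<longlonglongrightarrow> \<beta> z * M s z" if s: "0 \<le> s" "s \<le> t" for s z
  proof -
    have "(\<lambda>n. (real n + 1) * psi0 z (scaled f n s z / (real n + 1))) \<longlonglongrightarrow> 0"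
      by (rule tendsto_sandwich[OF _ _ tendsto_const D(2)[of z]])
        (use psi_le[OF s] in \<open>auto intro!: always_eventually\<close>)
    then have "(\<lambda>n. \<beta> z * scaled f n s z - (real n + 1) * psi0 z (scaled f n s z / (real n + 1)))
        \<longlonglongrightarrow> \<beta> z * M s z - 0"
      by (intro tendsto_diff tendsto_mult tendsto_const lim[OF s])
    then show ?thesis by (simp add: force_def)
  qed
  have equation: "m s y = (\<integral>z. f z \<partial>P s y) + (LINT r:{0..s}|lborel. \<integral>z. \<beta> z * m (s - r) z \<partial>P r y)"
    if s: "0 \<le> s" "s \<le> t" for s y
  proof -
    define g where "g n r z = (if 0 \<le> r \<and> r \<le> s then force f n (s - r) z else 0)" for n r z
    have g_meas: "(\<lambda>(r, z). g n r z) \<in> borel_measurable (borel \<Otimes>\<^sub>M borel)" for n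
      unfolding g_def by (rule force_measurable_joint[OF f])
    have g_bound: "\<bar>g n r z\<bar> \<le> C" for n r z
      using force_bound[of "s - r" n z] s C0 by (simp add: g_def)
    have g_sec: "g n r \<in> borel_measurable borel" for n r
      using measurable_compose[OF measurable_Pair1' g_meas, of r n] by simp
    define h where "h n r = (if 0 \<le> r \<and> r \<le> s then \<integral>z. g n r z \<partial>P r y else 0)" for n r
    define H where "H r = (if 0 \<le> r \<and> r \<le> s then \<integral>z. \<beta> z * m (s - r) z \<partial>P r y else 0)" for r
    have h_meas: "h n \<in> borel_measurable borel" for n
      using measurable_compose[OF measurable_Pair2' measurable_integral_P_joint[OF g_meas g_bound s(1)], of y n]
      by (simp add: h_def[abs_def])
    have h_bound: "\<bar>h n r\<bar> \<le> C" for n r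
      using integral_P_bound(1)[of r "g n r" C y] g_sec g_bound C0 by (simp add: h_def)
    have h_lim: "(\<lambda>n. h n r) \<longlonglongrightarrow> H r" for r
    proof (cases "0 \<le> r \<and> r \<le> s")
      case True
      interpret subprob_space "P r y" using True by (intro subprob_P) auto
      have gP: "g n r \<in> borel_measurable (P r y)" for n
        using g_sec True by (subst measurable_cong_sets[OF sets_P refl]) auto
      have lim_g: "(\<lambda>n. g n r z) \<longlonglongrightarrow> \<beta> z * m (s - r) z" for z
        using force_lim[of "s - r" z] True s by (simp add: g_def m_def)
      have "(\<lambda>n. \<integral>z. g n r z \<partial>P r y) \<longlonglongrightarrow> (\<integral>z. \<beta> z * m (s - r) z \<partial>P r y)"
      proof (rule integral_dominated_convergence[where w = "\<lambda>_. C"])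
        show "(\<lambda>z. \<beta> z * m (s - r) z) \<in> borel_measurable (P r y)"
          by (rule borel_measurable_LIMSEQ_real[OF lim_g gP])
      qed (use gP lim_g g_bound in auto)
      with True show ?thesis by (simp add: h_def H_def)
    next
      case False
      then have "h n r = 0" "H r = 0" for n by (auto simp: h_def H_def)
      then show ?thesis by simp
    qed
    have H_meas: "H \<in> borel_measurable borel"
      by (rule borel_measurable_LIMSEQ_real[OF h_lim h_meas])
    have "(\<lambda>n. \<integral>r. indicator {0..s} r * h n r \<partial>lborel) \<longlonglongrightarrow> (\<integral>r. indicator {0..s} r * H r \<partial>lborel)"
    proof (rule integral_dominated_convergence[where w = "\<lambda>r. C * indicator {0..s} r"])
      show "AE r in lborel. (\<lambda>n. indicator {0..s} r * h n r) \<longlonglongrightarrow> indicator {0..s} r * H r"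
        by (intro AE_I2 tendsto_mult tendsto_const h_lim)
      show "AE r in lborel. norm (indicator {0..s} r * h n r) \<le> C * indicator {0..s} r" for n
        using h_bound by (intro AE_I2) (auto split: split_indicator)
    qed (use h_meas H_meas s in auto)
    also have "(\<lambda>n. \<integral>r. indicator {0..s} r * h n r \<partial>lborel)
        = (\<lambda>n. LINT r:{0..s}|lborel. \<integral>z. force f n (s - r) z \<partial>P r y)"
      unfolding set_lebesgue_integral_def
      by (intro ext Bochner_Integration.integral_cong) (auto simp: h_def g_def[abs_def] split: split_indicator)
    also have "(\<integral>r. indicator {0..s} r * H r \<partial>lborel)
        = (LINT r:{0..s}|lborel. \<integral>z. \<beta> z * m (s - r) z \<partial>P r y)"
      unfolding set_lebesgue_integral_def
      by (intro Bochner_Integration.integral_cong) (auto simp: H_def split: split_indicator)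
    finally have "(\<lambda>n. (\<integral>z. f z \<partial>P s y) + (LINT r:{0..s}|lborel. \<integral>z. force f n (s - r) z \<partial>P r y))
        \<longlonglongrightarrow> (\<integral>z. f z \<partial>P s y) + (LINT r:{0..s}|lborel. \<integral>z. \<beta> z * m (s - r) z \<partial>P r y)"
      by (intro tendsto_add tendsto_const)
    then have "(\<lambda>n. scaled f n s y)
        \<longlonglongrightarrow> (\<integral>z. f z \<partial>P s y) + (LINT r:{0..s}|lborel. \<integral>z. \<beta> z * m (s - r) z \<partial>P r y)"
      by (simp add: scaled_equation[OF f s(1)])
    from LIMSEQ_unique[OF lim[OF s] this] show ?thesis using s by (simp add: m_def)
  qed
  have fb: "f \<in> bdd_borel" using f by simp
  note fk = feynman_kac[OF t \<beta>_bdd fb m_meas m_bound equation]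
  have M_meas: "M t \<in> borel_measurable borel"
    using measurable_compose[OF measurable_Pair1' m_meas, of t] t by (simp add: m_def)
  show thesis
  proof (rule that)
    show "M t \<in> bp_borel"
      using M_nonneg[OF t order_refl] M_le[OF t order_refl] by (intro bp_borelI[OF M_meas, of K])
  next
    fix x
    let ?w = "\<lambda>\<omega>. exp (LINT s:{0..t}|lborel. \<beta> (\<xi> s \<omega>)) * kill f t \<omega>"
    have "mean_semigroup \<xi> \<zeta> Law \<beta> t f x = (\<integral>\<^sup>+\<omega>. ennreal (?w \<omega>) \<partial>Law x)"
      unfolding mean_semigroup_def
      by (intro nn_integral_cong) (auto simp: kill_def split: split_indicator)
    also have "\<dots> = ennreal (\<integral>\<omega>. ?w \<omega> \<partial>Law x)"
      using f by (intro nn_integral_eq_integral fk(2) AE_I2)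
        (auto simp: kill_def nonneg_borel_nonneg)
    also have "(\<integral>\<omega>. ?w \<omega> \<partial>Law x) = M t x" using fk(1)[of x] t by (simp add: m_def)
    finally show "mean_semigroup \<xi> \<zeta> Law \<beta> t f x = ennreal (M t x)" .
  next
    fix \<mu>
    show "integrable (Q t \<mu>) (\<lambda>\<eta>. integ \<eta> f)"
      by (rule mean_limit(1)[OF f t bound[OF t order_refl]])
    interpret finite_measure "as_measure \<mu>" by (rule finite_as_measure)
    have "(\<lambda>n. integ \<mu> (scaled f n t)) \<longlonglongrightarrow> integ \<mu> (M t)"
      unfolding integ_def
    proof (rule integral_dominated_convergence[where w = "\<lambda>_. K"])
      show "scaled f n t \<in> borel_measurable (as_measure \<mu>)" for n
        using IntD1[OF scaled_bp[OF t, of n]]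
        by (subst measurable_cong_sets[OF sets_as_measure refl]) (rule bdd_borel_measurable)
      show "AE y in as_measure \<mu>. norm (scaled f n t y) \<le> K" for n
        using bound[OF t order_refl] scaled_nonneg[OF f t] by simp
      show "AE y in as_measure \<mu>. (\<lambda>n. scaled f n t y) \<longlonglongrightarrow> M t y"
        using lim[OF t order_refl] by simp
    qed (use M_meas in simp_all)
    with mean_limit(2)[OF f t bound[OF t order_refl], of \<mu>]
    show "(\<integral>\<eta>. integ \<eta> f \<partial>Q t \<mu>) = integ \<mu> (M t)" by (rule LIMSEQ_unique)
  qed
qed

end

section \<open>Linear approximation of the cumulants\<close>

text \<open>A lower bound on the ratio of successive terms propagates through a two-term recursion whose
  older term has a small coefficient.\<close>

lemma ratio_propagates:
  fixes x :: "nat \<Rightarrow> real"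
  assumes rec: "\<And>n. N \<le> n \<Longrightarrow> x (Suc (Suc n)) \<ge> L * x (Suc n) - D * x n"
    and nonneg: "\<And>n. N \<le> n \<Longrightarrow> 0 \<le> x n"
    and D: "0 \<le> D" "D \<le> (L - c) * c" and c: "0 < c"
    and init: "x (Suc N) \<ge> c * x N" and n: "N \<le> n"
  shows "x (Suc n) \<ge> c * x n"
  using n
proof (induction n rule: dec_induct)
  case (step n)
  have "0 \<le> (L - c) * c" using D by linarith
  then have Lc: "0 \<le> L - c" using c by (simp add: zero_le_mult_iff)
  have "D * x n \<le> (L - c) * c * x n" using D(2) nonneg[OF step.hyps(1)] by (rule mult_right_mono)
  also have "\<dots> = (L - c) * (c * x n)" by simp
  also have "\<dots> \<le> (L - c) * x (Suc n)" using step.IH Lc by (rule mult_left_mono)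
  finally have "D * x n \<le> L * x (Suc n) - c * x (Suc n)" by (simp add: left_diff_distrib)
  with rec[OF step.hyps(1)] show ?case by linarith
qed (rule init)

text \<open>The superprocess under the standing assumptions on its mean semigroup and on extinction.\<close>

locale subcritical_superproc =
  superproc W \<xi> \<zeta> Law P \<beta> \<sigma> \<pi> V Q Pr
  for W :: "'w measure"
    and \<xi> :: "real \<Rightarrow> 'w \<Rightarrow> 'e::polish_space"
    and \<zeta> :: "'w \<Rightarrow> ereal"
    and Law :: "'e \<Rightarrow> 'w measure"
    and P :: "real \<Rightarrow> 'e \<Rightarrow> 'e measure"
    and \<beta> \<sigma> :: "'e \<Rightarrow> real"
    and \<pi> :: "'e \<Rightarrow> real measure"
    and V :: "real \<Rightarrow> ('e \<Rightarrow> real) \<Rightarrow> 'e \<Rightarrow> real"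
    and Q :: "real \<Rightarrow> 'e fin_measure \<Rightarrow> 'e fin_measure measure"
    and Pr :: "'e fin_measure \<Rightarrow> (real \<Rightarrow> 'e fin_measure) measure" +
  fixes lam :: real and \<phi> :: "'e \<Rightarrow> real" and \<nu> :: "'e fin_measure"
  assumes eigen: "principal_eigen (mean_semigroup \<xi> \<zeta> Law \<beta>) lam \<phi> \<nu>"
    and asymp: "uniform_mean_asymptotics (mean_semigroup \<xi> \<zeta> Law \<beta>) lam \<phi> \<nu>"
    and subcritical: "lam < 0"
    and extinction: "\<forall>t>0. \<P>(\<omega> in Pr \<nu>. \<omega> t = 0) > 0"
begin

text \<open>The mean semigroup \<open>T\<^sub>t f(x)\<close>, as a real number; meaningful for bounded non-negative \<open>f\<close>, where it
  agrees with the extended real-valued one by the mean formula.\<close>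

definition mean :: "real \<Rightarrow> ('e \<Rightarrow> real) \<Rightarrow> 'e \<Rightarrow> real" where
  "mean t f x = (\<integral>\<eta>. integ \<eta> f \<partial>Q t (dirac x))"

lemma mean_facts:
  assumes "f \<in> bp_borel" "0 \<le> t"
  shows "mean t f \<in> bp_borel" "mean_semigroup \<xi> \<zeta> Law \<beta> t f x = ennreal (mean t f x)"
    "integrable (Q t \<mu>) (\<lambda>\<eta>. integ \<eta> f)" "(\<integral>\<eta>. integ \<eta> f \<partial>Q t \<mu>) = integ \<mu> (mean t f)"
proof -
  obtain m where m: "m \<in> bp_borel" "\<And>x. mean_semigroup \<xi> \<zeta> Law \<beta> t f x = ennreal (m x)"
    "\<And>\<mu>. integrable (Q t \<mu>) (\<lambda>\<eta>. integ \<eta> f)" "\<And>\<mu>. (\<integral>\<eta>. integ \<eta> f \<partial>Q t \<mu>) = integ \<mu> m"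
    by (rule mean_formula[OF assms]) blast
  have "mean t f = m"
    using m(1) by (auto simp: mean_def m(4) fun_eq_iff intro!: integ_dirac)
  with m show "mean t f \<in> bp_borel" "mean_semigroup \<xi> \<zeta> Law \<beta> t f x = ennreal (mean t f x)"
    "integrable (Q t \<mu>) (\<lambda>\<eta>. integ \<eta> f)" "(\<integral>\<eta>. integ \<eta> f \<partial>Q t \<mu>) = integ \<mu> (mean t f)"
    by simp_all
qed

lemma mean_nonneg: "f \<in> bp_borel \<Longrightarrow> 0 \<le> t \<Longrightarrow> 0 \<le> mean t f x"
  using mean_facts(1)[of f t] nonneg_borel_nonneg[of "mean t f" x] by simp

lemma \<phi>_pos: "0 < \<phi> x" and \<phi>_bdd: "\<phi> \<in> bdd_borel" and integ_\<nu>_\<phi>: "integ \<nu> \<phi> = 1"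
  using eigen unfolding principal_eigen_def by blast+

lemma \<phi>_bp: "\<phi> \<in> bp_borel"
  using \<phi>_bdd \<phi>_pos by (auto simp: nonneg_borel_def bdd_borel_def intro: less_imp_le)

lemma mean_\<phi>: "0 \<le> t \<Longrightarrow> mean t \<phi> x = exp (lam * t) * \<phi> x"
proof -
  assume t: "0 \<le> t"
  have "ennreal (mean t \<phi> x) = ennreal (exp (lam * t) * \<phi> x)"
    using eigen t mean_facts(2)[OF \<phi>_bp t, of x] unfolding principal_eigen_def by simp
  then show ?thesis
    using mean_nonneg[OF \<phi>_bp t, of x] \<phi>_pos[of x] by (simp add: less_imp_le)
qed

lemma \<nu>_mean:
  assumes f: "f \<in> bp_borel" and t: "0 \<le> t"
  shows "integ \<nu> (mean t f) = exp (lam * t) * integ \<nu> f"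
proof -
  have nn: "f \<in> nonneg_borel" using f by simp
  have "(\<integral>\<^sup>+x. mean_semigroup \<xi> \<zeta> Law \<beta> t f x \<partial>as_measure \<nu>)
      = ennreal (exp (lam * t)) * (\<integral>\<^sup>+x. ennreal (f x) \<partial>as_measure \<nu>)"
    using eigen t nn unfolding principal_eigen_def by blast
  then have "ennreal (integ \<nu> (mean t f)) = ennreal (exp (lam * t) * integ \<nu> f)"
    by (simp add: mean_facts(2)[OF f t] integ_eq_nn_integral[OF f]
        integ_eq_nn_integral[OF mean_facts(1)[OF f t]] ennreal_mult')
  then show ?thesis
    using integ_nonneg[of f \<nu>] integ_nonneg[of "mean t f" \<nu>] nn mean_facts(1)[OF f t] by simp
qed

text \<open>The uniform rate in the asymptotics of the mean, as a real number.\<close>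

lemma mean_rate:
  obtains h :: "real \<Rightarrow> real" where "\<And>t. 0 \<le> h t"
    "\<And>t f x. 0 < t \<Longrightarrow> f \<in> bp_borel \<Longrightarrow>
      \<bar>mean t f x - exp (lam * t) * \<phi> x * integ \<nu> f\<bar> \<le> h t * (exp (lam * t) * \<phi> x * integ \<nu> f)"
    "\<And>\<epsilon>. 0 < \<epsilon> \<Longrightarrow> \<exists>t>0. h t \<le> \<epsilon>"
proof -
  obtain H where H: "\<And>t x f. 0 < t \<Longrightarrow> f \<in> L1_plus \<nu> \<Longrightarrow>
      enn2ereal (mean_semigroup \<xi> \<zeta> Law \<beta> t f x)
        = ereal (exp (lam * t) * \<phi> x * integ \<nu> f * (1 + H t f x))"
    and fin: "\<And>t. 0 < t \<Longrightarrow> (SUP x. SUP f\<in>L1_plus \<nu>. ennreal \<bar>H t f x\<bar>) < \<infinity>"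
    and lim: "((\<lambda>t. SUP x. SUP f\<in>L1_plus \<nu>. ennreal \<bar>H t f x\<bar>) \<longlongrightarrow> 0) at_top"
    using asymp unfolding uniform_mean_asymptotics_def by blast
  define G where "G t = (SUP x. SUP f\<in>L1_plus \<nu>. ennreal \<bar>H t f x\<bar>)" for t
  define h where "h t = enn2real (G t)" for t
  show thesis
  proof (rule that[of h])
    show "0 \<le> h t" for t by (simp add: h_def)
  next
    fix t :: real and x and f :: "'e \<Rightarrow> real" assume t: "0 < t" and f: "f \<in> bp_borel"
    have f1: "f \<in> L1_plus \<nu>" using f by (simp add: L1_plus_def integ_eq_nn_integral)
    have "ennreal \<bar>H t f x\<bar> \<le> G t"
      unfolding G_def by (rule SUP_upper2[of x UNIV], simp, rule SUP_upper[OF f1])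
    then have "enn2real (ennreal \<bar>H t f x\<bar>) \<le> h t"
      unfolding h_def using fin[OF t] by (intro enn2real_mono) (simp_all add: G_def)
    then have H_le: "\<bar>H t f x\<bar> \<le> h t" by simp
    have m0: "0 \<le> mean t f x" using mean_nonneg f t by simp
    have "mean t f x = exp (lam * t) * \<phi> x * integ \<nu> f * (1 + H t f x)"
      using H[OF t f1, of x] mean_facts(2)[OF f, of t x] t m0 by simp
    then have eq: "mean t f x - exp (lam * t) * \<phi> x * integ \<nu> f = H t f x * (exp (lam * t) * \<phi> x * integ \<nu> f)"
      by (simp add: algebra_simps)
    have "0 \<le> exp (lam * t) * \<phi> x * integ \<nu> f"
      using \<phi>_pos[of x] integ_nonneg[of f \<nu>] f by simp
    moreover have "\<bar>a * z\<bar> \<le> b * z" if "0 \<le> z" "\<bar>a\<bar> \<le> b" for a b z :: real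
      using that by (simp add: abs_mult mult_right_mono)
    ultimately show "\<bar>mean t f x - exp (lam * t) * \<phi> x * integ \<nu> f\<bar> \<le> h t * (exp (lam * t) * \<phi> x * integ \<nu> f)"
      unfolding eq using H_le by blast
  next
    fix \<epsilon> :: real assume \<epsilon>: "0 < \<epsilon>"
    have "eventually (\<lambda>t. G t < ennreal \<epsilon>) at_top"
      by (rule order_tendstoD(2)[OF lim[folded G_def]]) (simp add: \<epsilon>)
    then have "eventually (\<lambda>t. 0 < t \<and> G t < ennreal \<epsilon>) at_top"
      using eventually_gt_at_top[of 0] by eventually_elim simp
    then obtain t where "0 < t" "G t < ennreal \<epsilon>"
      using eventually_happens'[OF trivial_limit_at_top_linorder] by blast
    then show "\<exists>t>0. h t \<le> \<epsilon>"
      using enn2real_mono[of "G t" "ennreal \<epsilon>"] \<epsilon> by (auto simp: h_def less_imp_le)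
  qed
qed

text \<open>Jensen's inequality for the Laplace functional.\<close>

lemma V_le_mean_integ:
  assumes f: "f \<in> bp_borel" and t: "0 \<le> t"
  shows "integ \<mu> (V t f) \<le> integ \<mu> (mean t f)"
proof -
  interpret prob_space "Q t \<mu>" by (rule prob_Q[OF t])
  define a where "a = integ \<mu> (mean t f)"
  note int = mean_facts(3)[OF f t, of \<mu>]
  have m: "(\<lambda>\<eta>. integ \<eta> f) \<in> borel_measurable (Q t \<mu>)" using int by auto
  have "exp (- a) * (1 + a - a) = (\<integral>\<eta>. exp (- a) * (1 + a - integ \<eta> f) \<partial>Q t \<mu>)"
    using int mean_facts(4)[OF f t, of \<mu>] prob_space by (simp add: a_def)
  also have "\<dots> \<le> (\<integral>\<eta>. exp (- integ \<eta> f) \<partial>Q t \<mu>)"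
  proof (rule integral_mono)
    show "integrable (Q t \<mu>) (\<lambda>\<eta>. exp (- integ \<eta> f))"
      using m f by (intro integrable_const_bound[of _ 1]) (auto simp: integ_nonneg)
    show "exp (- a) * (1 + a - integ \<eta> f) \<le> exp (- integ \<eta> f)" for \<eta>
    proof -
      have "exp (- a) * (1 + (a - integ \<eta> f)) \<le> exp (- a) * exp (a - integ \<eta> f)"
        by (intro mult_left_mono exp_ge_add_one_self) simp
      then show ?thesis by (simp add: mult_exp_exp add_diff_eq)
    qed
  qed (use int in simp)
  also have "\<dots> = exp (- integ \<mu> (V t f))" by (rule laplace[OF t f])
  finally show ?thesis by (simp add: a_def)
qed

lemma V_le_mean:
  assumes f: "f \<in> bp_borel" and t: "0 \<le> t"
  shows "V t f x \<le> mean t f x"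
  using V_le_mean_integ[OF assms, of "dirac x"] V_bp[OF assms] mean_facts(1)[OF assms]
  by (simp add: integ_dirac bdd_borel_measurable)

text \<open>A bound on the error of the linear approximation of \<open>\<mu>(V\<^sub>t f)\<close> when \<open>f \<le> \<epsilon> \<phi>\<close>; it is \<open>o(\<epsilon>)\<close> by
  \<open>rem_small\<close>.\<close>

definition rem :: "real \<Rightarrow> 'e fin_measure \<Rightarrow> real \<Rightarrow> real" where
  "rem t \<mu> \<epsilon> = (\<integral>\<eta>. exp (- (\<epsilon> * integ \<eta> \<phi>)) - 1 + \<epsilon> * integ \<eta> \<phi> \<partial>Q t \<mu>)"

lemma V_ge_mean:
  assumes f: "f \<in> bp_borel" and t: "0 \<le> t" and le: "\<And>x. f x \<le> \<epsilon> * \<phi> x" and \<epsilon>: "0 \<le> \<epsilon>"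
  shows "integ \<mu> (mean t f) - rem t \<mu> \<epsilon> \<le> integ \<mu> (V t f)"
proof -
  interpret prob_space "Q t \<mu>" by (rule prob_Q[OF t])
  note int = mean_facts(3)[OF f t, of \<mu>] and int\<phi> = mean_facts(3)[OF \<phi>_bp t, of \<mu>]
  have exp_int: "integrable (Q t \<mu>) (\<lambda>\<eta>. exp (- integ \<eta> f))"
    using int f by (intro integrable_const_bound[of _ 1]) (auto simp: integ_nonneg)
  have exp_int\<phi>: "integrable (Q t \<mu>) (\<lambda>\<eta>. exp (- (\<epsilon> * integ \<eta> \<phi>)))"
    using int\<phi> \<phi>_bp \<epsilon> by (intro integrable_const_bound[of _ 1]) (auto simp: integ_nonneg)
  have "integ \<mu> (mean t f) - (1 - exp (- integ \<mu> (V t f)))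
      = (\<integral>\<eta>. exp (- integ \<eta> f) - 1 + integ \<eta> f \<partial>Q t \<mu>)"
    using int exp_int prob_space laplace[OF t f, of \<mu>] mean_facts(4)[OF f t, of \<mu>] by simp
  also have "\<dots> \<le> rem t \<mu> \<epsilon>"
    unfolding rem_def
  proof (rule integral_mono)
    show "exp (- integ \<eta> f) - 1 + integ \<eta> f \<le> exp (- (\<epsilon> * integ \<eta> \<phi>)) - 1 + \<epsilon> * integ \<eta> \<phi>" for \<eta>
    proof (rule exp_remainder_mono)
      show "0 \<le> integ \<eta> f" using f by (intro integ_nonneg) simp
      have "integ \<eta> f \<le> integ \<eta> (\<lambda>x. \<epsilon> * \<phi> x)"
        using f cmult_bp_borel[OF \<phi>_bp \<epsilon>] le by (intro integ_mono) auto
      then show "integ \<eta> f \<le> \<epsilon> * integ \<eta> \<phi>" by (simp add: integ_cmult)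
    qed
  qed (use int exp_int int\<phi> exp_int\<phi> in auto)
  finally show ?thesis using exp_ge_add_one_self[of "- integ \<mu> (V t f)"] by linarith
qed

lemma rem_small:
  assumes t: "0 \<le> t" and \<delta>: "0 < \<delta>"
  obtains \<epsilon>0 where "0 < \<epsilon>0" "\<And>\<epsilon>. 0 \<le> \<epsilon> \<Longrightarrow> \<epsilon> \<le> \<epsilon>0 \<Longrightarrow> rem t \<mu> \<epsilon> \<le> \<delta> * \<epsilon>"
proof -
  interpret prob_space "Q t \<mu>" by (rule prob_Q[OF t])
  note int = mean_facts(3)[OF \<phi>_bp t, of \<mu>]
  have m: "(\<lambda>\<eta>. integ \<eta> \<phi>) \<in> borel_measurable (Q t \<mu>)" using int by auto
  have pos: "0 \<le> integ \<eta> \<phi>" for \<eta> using \<phi>_bp by (intro integ_nonneg) simp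
  define g where "g n \<eta> = min (integ \<eta> \<phi>) ((integ \<eta> \<phi>)\<^sup>2 / (real n + 1))" for n and \<eta> :: "'e fin_measure"
  have g_meas: "g n \<in> borel_measurable (Q t \<mu>)" for n unfolding g_def using m by measurable
  have g_bd: "norm (g n \<eta>) \<le> integ \<eta> \<phi>" for n \<eta>
    using pos[of \<eta>] by (simp add: g_def)
  have g_int: "integrable (Q t \<mu>) (g n)" for n
    using g_bd pos by (intro Bochner_Integration.integrable_bound[OF int g_meas]) auto
  have "(\<lambda>n. \<integral>\<eta>. g n \<eta> \<partial>Q t \<mu>) \<longlonglongrightarrow> (\<integral>\<eta>. 0 \<partial>Q t \<mu>)"
  proof (rule integral_dominated_convergence[OF _ g_meas int])
    show "AE \<eta> in Q t \<mu>. (\<lambda>n. g n \<eta>) \<longlonglongrightarrow> 0"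
    proof (rule AE_I2)
      fix \<eta>
      have "(\<lambda>n. (integ \<eta> \<phi>)\<^sup>2 / (real n + 1)) \<longlonglongrightarrow> 0"
        using tendsto_mult_right_zero[OF LIMSEQ_inverse_real_of_nat, of "(integ \<eta> \<phi>)\<^sup>2"]
        by (simp add: divide_inverse add.commute)
      note upper = this
      have "eventually (\<lambda>n. 0 \<le> g n \<eta>) sequentially"
        using pos[of \<eta>] by (simp add: g_def)
      moreover have "eventually (\<lambda>n. g n \<eta> \<le> (integ \<eta> \<phi>)\<^sup>2 / (real n + 1)) sequentially"
        by (simp add: g_def)
      ultimately show "(\<lambda>n. g n \<eta>) \<longlonglongrightarrow> 0"
        by (rule tendsto_sandwich[OF _ _ tendsto_const upper])
    qed
  qed (use g_bd in auto)
  then have "eventually (\<lambda>n. (\<integral>\<eta>. g n \<eta> \<partial>Q t \<mu>) < \<delta>) sequentially"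
    using \<delta> by (intro order_tendstoD(2)) auto
  then obtain n where n: "(\<integral>\<eta>. g n \<eta> \<partial>Q t \<mu>) < \<delta>"
    using eventually_happens'[OF sequentially_bot] by blast
  show thesis
  proof (rule that[of "1 / (real n + 1)"])
    fix \<epsilon> :: real assume \<epsilon>: "0 \<le> \<epsilon>" "\<epsilon> \<le> 1 / (real n + 1)"
    have "rem t \<mu> \<epsilon> \<le> (\<integral>\<eta>. \<epsilon> * g n \<eta> \<partial>Q t \<mu>)"
      unfolding rem_def
    proof (rule integral_mono)
      have "integrable (Q t \<mu>) (\<lambda>\<eta>. exp (- (\<epsilon> * integ \<eta> \<phi>)))"
        using m pos \<epsilon> by (intro integrable_const_bound[of _ 1]) auto
      then show "integrable (Q t \<mu>) (\<lambda>\<eta>. exp (- (\<epsilon> * integ \<eta> \<phi>)) - 1 + \<epsilon> * integ \<eta> \<phi>)"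
        using int by simp
      show "exp (- (\<epsilon> * integ \<eta> \<phi>)) - 1 + \<epsilon> * integ \<eta> \<phi> \<le> \<epsilon> * g n \<eta>" for \<eta>
      proof -
        let ?y = "integ \<eta> \<phi>"
        have y: "0 \<le> \<epsilon> * ?y" using pos \<epsilon> by simp
        have "(\<epsilon> * ?y)\<^sup>2 = \<epsilon> * (\<epsilon> * ?y\<^sup>2)" by (simp add: power2_eq_square)
        also have "\<dots> \<le> \<epsilon> * (1 / (real n + 1) * ?y\<^sup>2)"
          using \<epsilon> by (intro mult_left_mono mult_right_mono) auto
        finally have "exp (- (\<epsilon> * ?y)) - 1 + \<epsilon> * ?y \<le> \<epsilon> * (?y\<^sup>2 / (real n + 1))"
          using exp_remainder(3)[OF y] by simp
        with exp_remainder(2)[OF y] show ?thesis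
          by (simp add: g_def min_def)
      qed
    qed (use g_int in simp)
    also have "\<dots> \<le> \<delta> * \<epsilon>" using mult_left_mono[OF less_imp_le[OF n] \<epsilon>(1)] by (simp add: mult.commute)
    finally show "rem t \<mu> \<epsilon> \<le> \<delta> * \<epsilon>" .
  qed simp
qed

section \<open>Extinction probabilities\<close>

lemma measurable_Q_cong: "0 \<le> t \<Longrightarrow> Q t \<mu> \<rightarrow>\<^sub>M N = borel \<rightarrow>\<^sub>M N"
  by (rule measurable_cong_sets[OF sets_Q refl])

lemma laplace_measurable:
  fixes f :: "'e \<Rightarrow> real"
  shows "f \<in> bp_borel \<Longrightarrow> (\<lambda>\<eta>. exp (- integ \<eta> f)) \<in> borel_measurable borel"
  using measurable_integ[of f] by simp

lemma laplace_integrable: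
  assumes f: "f \<in> bp_borel" and t: "0 \<le> t"
  shows "integrable (Q t \<mu>) (\<lambda>\<eta>. exp (- integ \<eta> f))"
proof -
  interpret prob_space "Q t \<mu>" by (rule prob_Q[OF t])
  show ?thesis
    using laplace_measurable[OF f] f
    by (intro integrable_const_bound[of _ 1]) (auto simp: integ_nonneg measurable_Q_cong[OF t])
qed

lemma V_semigroup:
  assumes f: "f \<in> bp_borel" and s: "0 \<le> s" and t: "0 \<le> t"
  shows "V (s + t) f x = V s (V t f) x"
proof -
  have Vt: "V t f \<in> bp_borel" by (rule V_bp[OF f t])
  have E: "(\<integral>\<^sup>+\<eta>. ennreal (exp (- integ \<eta> f)) \<partial>Q r \<mu>) = ennreal (exp (- integ \<mu> (V r f)))"
    if f: "f \<in> bp_borel" and r: "0 \<le> r" for r \<mu> f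
    using nn_integral_eq_integral[OF laplace_integrable[OF f r, of \<mu>]] laplace[OF r f, of \<mu>] by simp
  have "ennreal (exp (- integ (dirac x) (V (s + t) f)))
      = (\<integral>\<^sup>+\<eta>. ennreal (exp (- integ \<eta> f)) \<partial>(Q s (dirac x) \<bind> Q t))"
    using E[OF f, of "s + t" "dirac x"] s t by (simp add: Q_semigroup)
  also have "\<dots> = (\<integral>\<^sup>+\<eta>. \<integral>\<^sup>+\<eta>'. ennreal (exp (- integ \<eta>' f)) \<partial>Q t \<eta> \<partial>Q s (dirac x))"
  proof (rule nn_integral_bind[where B = borel])
    show "Q t \<in> Q s (dirac x) \<rightarrow>\<^sub>M subprob_algebra borel"
      using Q_kernel[OF t] by (simp add: measurable_Q_cong[OF s])
  qed (use laplace_measurable[OF f] in simp)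
  also have "\<dots> = ennreal (exp (- integ (dirac x) (V s (V t f))))"
    by (simp add: E[OF f t] E[OF Vt s])
  finally have "integ (dirac x) (V (s + t) f) = integ (dirac x) (V s (V t f))" by simp
  then show ?thesis
    using V_bp[OF f, of "s + t"] V_bp[OF Vt s] s t by (simp add: integ_dirac bdd_borel_measurable)
qed

text \<open>The probability of being extinct at time \<open>t\<close>.\<close>

definition ext :: "real \<Rightarrow> 'e fin_measure \<Rightarrow> real" where
  "ext t \<mu> = measure (Q t \<mu>) {0}"

lemma ext_nonneg: "0 \<le> ext t \<mu>" by (simp add: ext_def)

lemma ext_le_laplace:
  assumes f: "f \<in> bp_borel" and t: "0 \<le> t"
  shows "ext t \<mu> \<le> exp (- integ \<mu> (V t f))"
proof -
  interpret prob_space "Q t \<mu>" by (rule prob_Q[OF t])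
  have z: "{0} \<in> sets (Q t \<mu>)" using sets_Q[OF t] by (simp add: sets_singleton_zero)
  have "ext t \<mu> = (\<integral>\<eta>. indicator {0} \<eta> \<partial>Q t \<mu>)" using z by (simp add: ext_def)
  also have "\<dots> \<le> (\<integral>\<eta>. exp (- integ \<eta> f) \<partial>Q t \<mu>)"
  proof (rule integral_mono)
    show "integrable (Q t \<mu>) (indicat_real {0})"
      using z by (intro integrable_const_bound[of _ 1]) auto
  qed (use laplace_integrable[OF f t] in \<open>auto split: split_indicator\<close>)
  finally show ?thesis using laplace[OF t f] by simp
qed

lemma ext_\<nu>_pos: "0 < t \<Longrightarrow> 0 < ext t \<nu>"
proof -
  assume t: "0 < t"
  have "0 < measure (Pr \<nu>) {\<omega> \<in> space (Pr \<nu>). \<omega> t = 0}" using extinction t by blast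
  also have "measure (Pr \<nu>) {\<omega> \<in> space (Pr \<nu>). \<omega> t = 0} = ext t \<nu>"
    using Q_eq_Pr[of t "{0}" \<nu>] t by (simp add: measure_def ext_def space_Pr sets_singleton_zero)
  finally show ?thesis .
qed

lemma laplace_const_tendsto_ext:
  assumes t: "0 \<le> t"
  shows "(\<lambda>n. exp (- integ \<mu> (V t (\<lambda>_. real n)))) \<longlonglongrightarrow> ext t \<mu>"
proof -
  interpret prob_space "Q t \<mu>" by (rule prob_Q[OF t])
  have c: "(\<lambda>_ :: 'e. real n) \<in> bp_borel" for n by (rule const_bp_borel) simp
  have z: "{0} \<in> sets (Q t \<mu>)" using sets_Q[OF t] by (simp add: sets_singleton_zero)
  have "(\<lambda>n. \<integral>\<eta>. exp (- integ \<eta> (\<lambda>_. real n)) \<partial>Q t \<mu>) \<longlonglongrightarrow> (\<integral>\<eta>. indicator {0} \<eta> \<partial>Q t \<mu>)"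
  proof (rule integral_dominated_convergence[where w = "\<lambda>_. 1"])
    show "(\<lambda>\<eta>. exp (- integ \<eta> (\<lambda>_. real n))) \<in> borel_measurable (Q t \<mu>)" for n
      using laplace_measurable[OF c] by (simp add: measurable_Q_cong[OF t])
    show "AE \<eta> in Q t \<mu>. (\<lambda>n. exp (- integ \<eta> (\<lambda>_. real n))) \<longlonglongrightarrow> indicat_real {0} \<eta>"
    proof (rule AE_I2)
      fix \<eta> :: "'e fin_measure"
      show "(\<lambda>n. exp (- integ \<eta> (\<lambda>_. real n))) \<longlonglongrightarrow> indicat_real {0} \<eta>"
      proof (cases "\<eta> = 0")
        case False
        define a where "a = integ \<eta> (\<lambda>_. 1)"
        have a: "0 < a" unfolding a_def using False const_bp_borel[of 1] by (intro integ_pos) auto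
        have "integ \<eta> (\<lambda>_. real n) = real n * a" for n
          unfolding a_def integ_cmult[symmetric] by simp
        then have "exp (- integ \<eta> (\<lambda>_. real n)) = exp (- a) ^ n" for n
          by (simp add: exp_of_nat_mult[symmetric])
        moreover have "(\<lambda>n. exp (- a) ^ n) \<longlonglongrightarrow> 0"
          using a by (intro LIMSEQ_power_zero) simp
        ultimately show ?thesis using False by simp
      qed simp
    qed
    show "AE \<eta> in Q t \<mu>. norm (exp (- integ \<eta> (\<lambda>_. real n))) \<le> 1" for n
      using integ_nonneg[OF IntD2[OF c[of n]]] by simp
  qed (use z in simp_all)
  then show ?thesis using z by (simp add: laplace[OF t c] ext_def)
qed

text \<open>The extinction cumulant \<open>v\<^sub>t\<close>, the limit of \<open>V\<^sub>t n\<close> as \<open>n \<rightarrow> \<infinity>\<close>.  It is finite for \<open>t > 0\<close>.\<close>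

definition v :: "real \<Rightarrow> 'e \<Rightarrow> real" where
  "v t x = - ln (ext t (dirac x))"

text \<open>Finiteness: \<open>V\<^sub>t n \<le> T\<^sub>t\<^sub>/\<^sub>2 (V\<^sub>t\<^sub>/\<^sub>2 n)\<close>, the mean over a positive time is bounded by a multiple of
  the integral against \<open>\<nu>\<close>, and \<open>\<nu>(V\<^sub>t\<^sub>/\<^sub>2 n)\<close> is bounded because extinction from \<open>\<nu>\<close> has positive
  probability.\<close>

lemma v_facts:
  assumes t: "0 < t"
  shows "v t \<in> bp_borel" and "ext t \<mu> = exp (- integ \<mu> (v t))"
proof -
  obtain h :: "real \<Rightarrow> real" where h: "\<And>t. 0 \<le> h t"
    "\<And>t f x. 0 < t \<Longrightarrow> f \<in> bp_borel \<Longrightarrow>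
      \<bar>mean t f x - exp (lam * t) * \<phi> x * integ \<nu> f\<bar> \<le> h t * (exp (lam * t) * \<phi> x * integ \<nu> f)"
    by (rule mean_rate) blast
  define s where "s = t / 2"
  have s: "0 < s" and ts: "t = s + s" using t by (auto simp: s_def)
  define u where "u n = V t (\<lambda>_. real n)" for n
  have c: "(\<lambda>_ :: 'e. real n) \<in> bp_borel" for n by (rule const_bp_borel) simp
  have u_bp: "u n \<in> bp_borel" for n unfolding u_def using t by (intro V_bp c) simp
  obtain b where b: "0 < b" "\<And>x. \<bar>\<phi> x\<bar> \<le> b" using bdd_borel_bound[OF \<phi>_bdd] by blast
  define E where "E = exp (lam * s)"
  define q where "q = - ln (ext s \<nu>)"
  define K where "K = (1 + h s) * (E * b * q)"
  have u_le: "u n x \<le> K" for n x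
  proof -
    define g where "g = V s (\<lambda>_. real n)"
    have g: "g \<in> bp_borel" unfolding g_def using s by (intro V_bp c) simp
    have g0: "0 \<le> integ \<nu> g" using g by (intro integ_nonneg) simp
    have "integ \<nu> g \<le> q"
    proof -
      have "ext s \<nu> \<le> exp (- integ \<nu> g)" unfolding g_def using s by (intro ext_le_laplace c) simp
      then have "ln (ext s \<nu>) \<le> - integ \<nu> g"
        using ext_\<nu>_pos[OF s] by (metis exp_gt_zero ln_exp ln_le_cancel_iff)
      then show ?thesis by (simp add: q_def)
    qed
    have "u n x = V s g x" unfolding u_def g_def ts using s by (intro V_semigroup c) auto
    also have "\<dots> \<le> mean s g x" using s by (intro V_le_mean g) simp
    also have "\<dots> \<le> (1 + h s) * (E * \<phi> x * integ \<nu> g)"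
      using h(2)[OF s g, of x] by (simp add: E_def algebra_simps abs_le_iff)
    also have "\<dots> \<le> K"
      unfolding K_def using h(1)[of s] b abs_le_D1[OF b(2)[of x]] \<phi>_pos[of x] g0 \<open>integ \<nu> g \<le> q\<close>
      by (intro mult_left_mono mult_mono) (auto simp: E_def less_imp_le)
    finally show ?thesis .
  qed
  have lim: "(\<lambda>n. u n x) \<longlonglongrightarrow> v t x" for x
  proof -
    have "integ (dirac x) (u n) = u n x" for n
      using u_bp[of n] by (intro integ_dirac) auto
    then have "(\<lambda>n. exp (- u n x)) \<longlonglongrightarrow> ext t (dirac x)"
      using laplace_const_tendsto_ext[of t "dirac x"] t by (simp add: u_def[symmetric])
    moreover from this have "exp (- K) \<le> ext t (dirac x)"
      by (rule LIMSEQ_le_const) (use u_le in auto)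
    then have "ext t (dirac x) \<noteq> 0" using exp_gt_zero[of "- K"] by linarith
    ultimately have "(\<lambda>n. ln (exp (- u n x))) \<longlonglongrightarrow> ln (ext t (dirac x))"
      by (rule tendsto_ln)
    then have "(\<lambda>n. - ln (exp (- u n x))) \<longlonglongrightarrow> - ln (ext t (dirac x))" by (rule tendsto_minus)
    then show ?thesis by (simp add: v_def)
  qed
  have u_meas: "u n \<in> borel_measurable borel" for n using IntD1[OF u_bp[of n]] by (rule bdd_borel_measurable)
  have u_nonneg: "0 \<le> u n x" for n x using u_bp[of n] by (simp add: nonneg_borel_nonneg)
  have v_meas: "v t \<in> borel_measurable borel"
    by (rule borel_measurable_LIMSEQ_real[OF lim u_meas])
  have v_nonneg: "0 \<le> v t x" and v_le: "v t x \<le> K" for x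
    using LIMSEQ_le_const[OF lim] LIMSEQ_le_const2[OF lim] u_nonneg u_le by blast+
  show "v t \<in> bp_borel" using v_nonneg v_le by (intro bp_borelI[OF v_meas, of K])
  interpret finite_measure "as_measure \<mu>" by (rule finite_as_measure)
  have "(\<lambda>n. integ \<mu> (u n)) \<longlonglongrightarrow> integ \<mu> (v t)"
    unfolding integ_def
  proof (rule integral_dominated_convergence[where w = "\<lambda>_. K"])
    show "AE x in as_measure \<mu>. norm (u n x) \<le> K" for n using u_le u_nonneg by simp
    show "AE x in as_measure \<mu>. (\<lambda>n. u n x) \<longlonglongrightarrow> v t x" using lim by simp
  qed (use u_meas v_meas in simp_all)
  then have "(\<lambda>n. exp (- integ \<mu> (u n))) \<longlonglongrightarrow> exp (- integ \<mu> (v t))"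
    by (intro tendsto_intros)
  with laplace_const_tendsto_ext[of t \<mu>] t show "ext t \<mu> = exp (- integ \<mu> (v t))"
    by (simp add: u_def LIMSEQ_unique)
qed

lemma v_shift:
  assumes r: "0 < r" and s: "0 \<le> s"
  shows "V s (v r) x = v (r + s) x"
proof -
  interpret prob_space "Q s (dirac x)" by (rule prob_Q[OF s])
  have vr: "v r \<in> bp_borel" by (rule v_facts(1)[OF r])
  have "ext (s + r) (dirac x) = measure (Q s (dirac x) \<bind> Q r) {0}"
    using r s by (simp add: ext_def Q_semigroup)
  also have "\<dots> = (\<integral>\<eta>. ext r \<eta> \<partial>Q s (dirac x))"
    unfolding ext_def
  proof (rule measure_bind[where N = borel])
    show "Q r \<in> Q s (dirac x) \<rightarrow>\<^sub>M subprob_algebra borel"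
      using Q_kernel[of r] r by (simp add: measurable_Q_cong[OF s])
  qed (rule sets_singleton_zero)
  also have "\<dots> = exp (- integ (dirac x) (V s (v r)))"
    using laplace[OF s vr, of "dirac x"] by (simp add: v_facts(2)[OF r])
  also have "integ (dirac x) (V s (v r)) = V s (v r) x"
    using IntD1[OF V_bp[OF vr s]] by (intro integ_dirac bdd_borel_measurable)
  finally show ?thesis by (simp add: v_def add.commute)
qed

section \<open>Decay of the extinction cumulants\<close>

text \<open>The mass \<open>\<nu>(v\<^sub>r)\<close> of the extinction cumulant, which normalises the survival probabilities.\<close>

definition w :: "real \<Rightarrow> real" where
  "w r = integ \<nu> (v r)"

lemma v_bp: "0 < r \<Longrightarrow> v r \<in> bp_borel"
  by (rule v_facts(1))

lemma w_pos: "0 < r \<Longrightarrow> 0 < w r"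
proof (rule ccontr)
  assume r: "0 < r" and "\<not> 0 < w r"
  moreover have "0 \<le> w r" unfolding w_def using v_bp[OF r] by (intro integ_nonneg) simp
  ultimately have "ext r \<nu> = 1" by (simp add: v_facts(2) w_def)
  interpret prob_space "Q r \<nu>" using r by (intro prob_Q) simp
  have "AE \<eta> in Q r \<nu>. \<eta> \<in> {0}"
    using \<open>ext r \<nu> = 1\<close> unfolding ext_def by (rule AE_prob_1)
  then have "(\<integral>\<eta>. integ \<eta> \<phi> \<partial>Q r \<nu>) = 0"
    by (intro integral_eq_zero_AE) (auto elim: eventually_mono)
  then show False
    using mean_facts(4)[OF \<phi>_bp, of r \<nu>] \<nu>_mean[OF \<phi>_bp, of r] r by (simp add: integ_\<nu>_\<phi>)
qed

lemma v_shift_fun: "0 < r \<Longrightarrow> 0 \<le> s \<Longrightarrow> V s (v r) = v (r + s)"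
  by (rule ext) (rule v_shift)

lemma w_shift_le: "0 < r \<Longrightarrow> 0 \<le> s \<Longrightarrow> w (r + s) \<le> exp (lam * s) * w r"
  using V_le_mean_integ[OF v_bp, of r s \<nu>] \<nu>_mean[OF v_bp, of r s]
  by (simp add: v_shift_fun w_def)

lemma w_antimono:
  assumes "0 < r" "r \<le> r'"
  shows "w r' \<le> w r"
proof -
  have "w r' \<le> exp (lam * (r' - r)) * w r"
    using w_shift_le[of r "r' - r"] assms by simp
  also have "\<dots> \<le> 1 * w r"
    using assms subcritical w_pos[OF assms(1)] by (intro mult_right_mono) (auto simp: mult_nonpos_nonneg)
  finally show ?thesis by simp
qed

lemma w_small:
  assumes "0 < \<epsilon>"
  obtains r1 where "0 < r1" "\<And>r. r1 \<le> r \<Longrightarrow> w r \<le> \<epsilon>"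
proof -
  have w1: "0 < w 1" by (rule w_pos) simp
  obtain n where n: "exp lam ^ n < \<epsilon> / w 1"
    using real_arch_pow_inv[of "\<epsilon> / w 1" "exp lam"] assms w1 subcritical by auto
  have "w (1 + real n) \<le> exp (lam * real n) * w 1" by (rule w_shift_le) auto
  also have "\<dots> \<le> \<epsilon>"
    using n w1 by (simp add: exp_of_nat2_mult less_divide_eq less_imp_le)
  finally have "w (1 + real n) \<le> \<epsilon>" .
  then show thesis
    using w_antimono[of "1 + real n"] by (intro that[of "1 + real n"]) (auto intro: order_trans)
qed

lemma w_tendsto_0: "(w \<longlongrightarrow> 0) at_top"
proof (rule tendstoI)
  fix e :: real assume e: "0 < e"
  obtain r1 where r1: "0 < r1" "\<And>r. r1 \<le> r \<Longrightarrow> w r \<le> e / 2"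
    using w_small[of "e / 2"] e by auto
  have "dist (w r) 0 < e" if "r1 \<le> r" for r
    using r1(2)[OF that] w_pos[of r] r1(1) that e by simp
  then show "eventually (\<lambda>r. dist (w r) 0 < e) at_top"
    by (auto simp: eventually_at_top_linorder)
qed

lemma mean_le:
  obtains C1 where "0 < C1" "\<And>f x. f \<in> bp_borel \<Longrightarrow> mean 1 f x \<le> C1 * integ \<nu> f * \<phi> x"
proof -
  obtain h :: "real \<Rightarrow> real" where h: "\<And>t. 0 \<le> h t"
    "\<And>t f x. 0 < t \<Longrightarrow> f \<in> bp_borel \<Longrightarrow>
      \<bar>mean t f x - exp (lam * t) * \<phi> x * integ \<nu> f\<bar> \<le> h t * (exp (lam * t) * \<phi> x * integ \<nu> f)"
    by (rule mean_rate) blast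
  show thesis
  proof (rule that[of "(1 + h 1) * exp lam"])
    show "0 < (1 + h 1) * exp lam" using h(1)[of 1] by simp
    fix f :: "'e \<Rightarrow> real" and x assume "f \<in> bp_borel"
    then show "mean 1 f x \<le> (1 + h 1) * exp lam * integ \<nu> f * \<phi> x"
      using h(2)[of 1 f x] by (simp add: algebra_simps abs_le_iff)
  qed
qed

lemma V_0: "f \<in> bp_borel \<Longrightarrow> V 0 f x = f x"
proof -
  assume f: "f \<in> bp_borel"
  have "Q 0 (dirac x) = return borel (dirac x)"
    using Q_borel_semigroup by (simp add: borel_semigroup_def)
  then have "exp (- integ (dirac x) f) = exp (- integ (dirac x) (V 0 f))"
    using laplace[OF order_refl f, of "dirac x"] laplace_measurable[OF f] by (simp add: integral_return)
  then show ?thesis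
    using IntD1[OF f] IntD1[OF V_bp[OF f order_refl]] by (simp add: integ_dirac bdd_borel_measurable)
qed

text \<open>The sequence \<open>w\<close> decays at most geometrically.  Both \<open>w\<close> and the cumulants started from a
  small multiple of \<open>\<phi>\<close> satisfy \<open>x\<^sub>n\<^sub>+\<^sub>2 \<ge> exp \<lambda> x\<^sub>n\<^sub>+\<^sub>1 - o(x\<^sub>n)\<close>, so that a ratio bound at one time
  propagates.  The latter satisfy one from the start, which gives a geometric lower bound
  for \<open>w\<close>; hence the ratios of \<open>w\<close> cannot all be small.\<close>

lemma w_ratio:
  obtains C2 r0 where "0 < C2" "1 < r0" "\<And>r. r0 \<le> r \<Longrightarrow> w (r - 1) \<le> C2 * w r"
proof -
  obtain C1 where C1: "0 < C1" "\<And>f x. f \<in> bp_borel \<Longrightarrow> mean 1 f x \<le> C1 * integ \<nu> f * \<phi> x"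
    by (rule mean_le) blast
  define L where "L = exp lam"
  have L: "0 < L" "L < 1" using subcritical by (auto simp: L_def)
  define \<delta> where "\<delta> = min (L / 4) (L\<^sup>2 / (8 * C1))"
  have \<delta>: "0 < \<delta>" "\<delta> \<le> L / 4" using L C1 by (auto simp: \<delta>_def)
  define D where "D = \<delta> * C1"
  have D: "0 \<le> D" using \<delta> C1 by (simp add: D_def)
  have D_le: "D \<le> L\<^sup>2 / 8"
  proof -
    have "\<delta> * C1 \<le> L\<^sup>2 / (8 * C1) * C1" using C1 by (intro mult_right_mono) (auto simp: \<delta>_def)
    then show ?thesis using C1 by (simp add: D_def)
  qed
  obtain \<epsilon>0 where \<epsilon>0: "0 < \<epsilon>0" "\<And>\<epsilon>. 0 \<le> \<epsilon> \<Longrightarrow> \<epsilon> \<le> \<epsilon>0 \<Longrightarrow> rem 1 \<nu> \<epsilon> \<le> \<delta> * \<epsilon>"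
    by (rule rem_small[of 1 \<delta> \<nu>]) (use \<delta> in auto)
  \<comment> \<open>one step of the recursion\<close>
  have recursion: "L * integ \<nu> (V 1 f) - D * integ \<nu> f \<le> integ \<nu> (V 1 (V 1 f))"
    if f: "f \<in> bp_borel" and small: "C1 * integ \<nu> f \<le> \<epsilon>0" for f
  proof -
    have f0: "0 \<le> integ \<nu> f" using f by (intro integ_nonneg) simp
    have V1: "V 1 f \<in> bp_borel" using f by (intro V_bp) auto
    have "integ \<nu> (mean 1 (V 1 f)) - rem 1 \<nu> (C1 * integ \<nu> f) \<le> integ \<nu> (V 1 (V 1 f))"
    proof (rule V_ge_mean[OF V1])
      show "V 1 f x \<le> C1 * integ \<nu> f * \<phi> x" for x
        using V_le_mean[OF f, of 1 x] C1(2)[OF f, of x] by simp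
    qed (use C1 f0 in auto)
    moreover have "rem 1 \<nu> (C1 * integ \<nu> f) \<le> D * integ \<nu> f"
      using \<epsilon>0(2)[of "C1 * integ \<nu> f"] small C1 f0 by (simp add: D_def ac_simps)
    ultimately show ?thesis using \<nu>_mean[OF V1, of 1] by (simp add: L_def)
  qed

  define \<theta> where "\<theta> = min \<epsilon>0 (\<epsilon>0 / C1)"
  have \<theta>: "0 < \<theta>" "\<theta> \<le> \<epsilon>0" "C1 * \<theta> \<le> \<epsilon>0"
  proof -
    show "0 < \<theta>" "\<theta> \<le> \<epsilon>0" using \<epsilon>0 C1 by (auto simp: \<theta>_def)
    have "C1 * \<theta> \<le> C1 * (\<epsilon>0 / C1)" using C1 by (intro mult_left_mono) (auto simp: \<theta>_def)
    then show "C1 * \<theta> \<le> \<epsilon>0" using C1 by simp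
  qed
  define f where "f x = \<theta> * \<phi> x" for x
  have f: "f \<in> bp_borel" unfolding f_def using \<theta> by (intro cmult_bp_borel \<phi>_bp) simp
  define a where "a n = integ \<nu> (V (real n) f)" for n
  have a_bp: "V (real n) f \<in> bp_borel" for n by (intro V_bp f) simp
  have a_Suc: "V 1 (V (real n) f) = V (real (Suc n)) f" for n
    using V_semigroup[OF f, of 1 "real n"] by (auto simp: fun_eq_iff)
  have V0: "V 0 f = f" using V_0[OF f] by (simp add: fun_eq_iff)
  have a_0: "a 0 = \<theta>"
    by (simp add: a_def V0) (simp add: f_def[abs_def] integ_cmult integ_\<nu>_\<phi>)
  have a_nonneg: "0 \<le> a n" for n unfolding a_def using a_bp by (intro integ_nonneg) simp
  have a_le: "a n \<le> \<theta>" for n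
  proof (induction n)
    case (Suc n)
    have "a (Suc n) \<le> L * a n"
      using V_le_mean_integ[OF a_bp[of n], of 1 \<nu>] \<nu>_mean[OF a_bp[of n], of 1] by (simp add: a_Suc a_def L_def)
    also have "\<dots> \<le> a n" using a_nonneg[of n] L by (simp add: mult_left_le_one_le)
    finally show ?case using Suc by simp
  qed (simp add: a_0)
  define c' where "c' = 3 / 4 * L"
  define c where "c = L / 2"
  have c: "0 < c" "0 < c'" using L by (auto simp: c_def c'_def)
  have a_ratio: "a (Suc n) \<ge> c' * a n" for n
  proof (rule ratio_propagates[where N = 0 and L = L and D = D])
    fix n
    have "C1 * a n \<le> C1 * \<theta>" using a_le[of n] C1 by (intro mult_left_mono) auto
    then have "C1 * integ \<nu> (V (real n) f) \<le> \<epsilon>0" using \<theta>(3) by (simp add: a_def)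
    from recursion[OF a_bp this] show "L * a (Suc n) - D * a n \<le> a (Suc (Suc n))"
      unfolding a_Suc a_def .
  next
    have "(L - c') * c' = 3 / 16 * L\<^sup>2" by (simp add: c'_def power2_eq_square field_simps)
    moreover have "0 \<le> L\<^sup>2" by simp
    ultimately show "D \<le> (L - c') * c'" using D_le by linarith
    have "integ \<nu> (mean 1 f) - rem 1 \<nu> \<theta> \<le> integ \<nu> (V 1 f)"
      using \<theta> by (intro V_ge_mean f) (auto simp: f_def)
    moreover have "integ \<nu> (mean 1 f) = L * \<theta>"
      using \<nu>_mean[OF f, of 1] a_0 by (simp add: a_def V0 L_def)
    moreover have "rem 1 \<nu> \<theta> \<le> L / 4 * \<theta>"
    proof -
      have "rem 1 \<nu> \<theta> \<le> \<delta> * \<theta>" using \<theta> by (intro \<epsilon>0(2)) auto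
      also have "\<dots> \<le> L / 4 * \<theta>" using \<delta>(2) \<theta> by (intro mult_right_mono) auto
      finally show ?thesis .
    qed
    ultimately show "c' * a 0 \<le> a (Suc 0)"
      unfolding a_0 by (simp add: a_def c'_def)
  qed (use D c a_nonneg in auto)
  have a_ge: "c' ^ n * \<theta> \<le> a n" for n
  proof (induction n)
    case (Suc n)
    have "c' ^ Suc n * \<theta> \<le> c' * a n" using Suc c by simp
    with a_ratio[of n] show ?case by simp
  qed (simp add: a_0)
  have w_ge: "c' ^ n * \<theta> \<le> w (real n)" if "0 < n" for n
  proof -
    have "exp (- w (real n)) \<le> exp (- a n)"
      using ext_le_laplace[OF f, of "real n" \<nu>] v_facts(2)[of "real n" \<nu>] that
      by (simp add: w_def a_def)
    with a_ge[of n] show ?thesis by simp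
  qed

  obtain r1 where r1: "0 < r1" "\<And>r. r1 \<le> r \<Longrightarrow> w r \<le> \<epsilon>0 / C1"
    using w_small[of "\<epsilon>0 / C1"] \<epsilon>0 C1 by auto
  define n0 where "n0 = nat \<lceil>r1\<rceil>"
  have n0: "r1 \<le> real n0" "0 < n0" using r1(1) by (auto simp: n0_def)
  have w_rec: "L * w (real (Suc n)) - D * w (real n) \<le> w (real (Suc (Suc n)))" if "n0 \<le> n" for n
  proof -
    have n: "0 < real n" using n0 that by simp
    have "w (real n) \<le> \<epsilon>0 / C1" using r1(2)[of "real n"] n0 that by simp
    then have "C1 * integ \<nu> (v (real n)) \<le> \<epsilon>0" using C1 by (simp add: w_def field_simps)
    from recursion[OF v_bp[OF n] this] show ?thesis
      using n by (simp add: v_shift_fun w_def add.commute)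
  qed
  have w_nonneg: "0 \<le> w (real n)" if "n0 \<le> n" for n
    using w_pos[of "real n"] n0 that by simp
  have "\<exists>N\<ge>n0. c * w (real N) \<le> w (real (Suc N))"
  proof (rule ccontr)
    assume none: "\<not> ?thesis"
    have less: "w (real (Suc n)) < c * w (real n)" if "n0 \<le> n" for n
      using none that by (meson not_le)
    have upper: "w (real (n0 + k)) \<le> c ^ k * w (real n0)" for k
    proof (induction k)
      case (Suc k)
      have "w (real (n0 + Suc k)) \<le> c * w (real (n0 + k))" using less[of "n0 + k"] by simp
      also have "\<dots> \<le> c * (c ^ k * w (real n0))" using Suc c by (intro mult_left_mono) auto
      finally show ?case by simp
    qed simp
    define B where "B = w (real n0) / (c' ^ n0 * \<theta>)"
    have "(3 / 2) ^ k \<le> B" for k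
    proof -
      have "c' = 3 / 2 * c" by (simp add: c'_def c_def)
      then have "c' ^ k = (3 / 2) ^ k * c ^ k" by (simp only: power_mult_distrib)
      then have "c' ^ (n0 + k) = c' ^ n0 * ((3 / 2) ^ k * c ^ k)" by (simp only: power_add)
      then have "c ^ k * ((3 / 2) ^ k * (c' ^ n0 * \<theta>)) \<le> c ^ k * w (real n0)"
        using w_ge[of "n0 + k"] upper[of k] n0 by (simp add: ac_simps)
      then have "(3 / 2) ^ k * (c' ^ n0 * \<theta>) \<le> w (real n0)" using c by simp
      then show ?thesis using c \<theta> by (simp add: B_def le_divide_eq)
    qed
    moreover obtain k where "B < (3 / 2) ^ k" using real_arch_pow[of "3 / 2" B] by auto
    ultimately show False by (meson not_le)
  qed
  then obtain N where N: "n0 \<le> N" "c * w (real N) \<le> w (real (Suc N))" by blast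
  have ratio: "c * w (real n) \<le> w (real (Suc n))" if "N \<le> n" for n
  proof (rule ratio_propagates[where N = N and L = L and D = D and x = "\<lambda>n. w (real n)"])
    have "(L - c) * c = L\<^sup>2 / 4" by (simp add: c_def power2_eq_square field_simps)
    moreover have "0 \<le> L\<^sup>2" by simp
    ultimately show "D \<le> (L - c) * c" using D_le by linarith
  qed (use that D c N w_rec w_nonneg in auto)
  show thesis
  proof (rule that[of "1 / c\<^sup>2" "real N + 2"])
    show "0 < 1 / c\<^sup>2" using c by simp
    show "1 < real N + 2" by simp
    fix r assume r: "real N + 2 \<le> r"
    define n where "n = nat \<lfloor>r\<rfloor> - 1"
    have n: "N \<le> n" "real n \<le> r - 1" "r \<le> real (Suc (Suc n))"
      using r by (auto simp: n_def) linarith+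
    have n_pos: "0 < real n" using n n0 N(1) by simp
    have "c\<^sup>2 * w (r - 1) \<le> c\<^sup>2 * w (real n)"
      using w_antimono[OF n_pos n(2)] by (intro mult_left_mono) auto
    also have "\<dots> = c * (c * w (real n))" by (simp add: power2_eq_square)
    also have "\<dots> \<le> c * w (real (Suc n))" using ratio[OF n(1)] c by (intro mult_left_mono) auto
    also have "\<dots> \<le> w (real (Suc (Suc n)))" using ratio[of "Suc n"] n(1) by simp
    also have "\<dots> \<le> w r" using r n by (intro w_antimono) auto
    finally show "w (r - 1) \<le> 1 / c\<^sup>2 * w r" using c by (simp add: field_simps)
  qed
qed

lemma v_le_\<phi>:
  obtains C1 where "0 < C1" "\<And>r x. 1 < r \<Longrightarrow> v r x \<le> C1 * w (r - 1) * \<phi> x"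
proof -
  obtain C1 where C1: "0 < C1" "\<And>f x. f \<in> bp_borel \<Longrightarrow> mean 1 f x \<le> C1 * integ \<nu> f * \<phi> x"
    by (rule mean_le) blast
  have "v r x \<le> C1 * w (r - 1) * \<phi> x" if r: "1 < r" for r x
  proof -
    have f: "v (r - 1) \<in> bp_borel" using r by (intro v_bp) simp
    have "v r x = V 1 (v (r - 1)) x" using v_shift[of "r - 1" 1 x] r by simp
    also have "\<dots> \<le> mean 1 (v (r - 1)) x" by (intro V_le_mean f) simp
    also have "\<dots> \<le> C1 * w (r - 1) * \<phi> x" using C1(2)[OF f] by (simp add: w_def)
    finally show ?thesis .
  qed
  with C1(1) show thesis by (rule that)
qed

text \<open>The profile of the extinction cumulant: \<open>v\<^sub>r \<sim> \<nu>(v\<^sub>r) \<phi>\<close>, since over a further time \<open>s\<close> the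
  flow \<open>V\<^sub>s\<close> is almost linear on the small function \<open>v\<^sub>r\<close> and the mean over time \<open>s\<close> almost projects
  on \<open>\<phi>\<close>.\<close>

proposition v_asymptotics: "((\<lambda>r. integ \<mu> (v r) / w r) \<longlongrightarrow> integ \<mu> \<phi>) at_top"
proof (rule tendstoI)
  fix e :: real assume e: "0 < e"
  define m where "m = integ \<mu> \<phi>"
  have m: "0 \<le> m" unfolding m_def using \<phi>_bp by (intro integ_nonneg) simp
  obtain C1 where C1: "0 < C1" "\<And>r x. 1 < r \<Longrightarrow> v r x \<le> C1 * w (r - 1) * \<phi> x"
    by (rule v_le_\<phi>) blast
  obtain C2 r0 where C2: "0 < C2" "1 < r0" "\<And>r. r0 \<le> r \<Longrightarrow> w (r - 1) \<le> C2 * w r"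
    by (rule w_ratio) blast
  obtain h :: "real \<Rightarrow> real" where h: "\<And>t. 0 \<le> h t"
    "\<And>t f x. 0 < t \<Longrightarrow> f \<in> bp_borel \<Longrightarrow>
      \<bar>mean t f x - exp (lam * t) * \<phi> x * integ \<nu> f\<bar> \<le> h t * (exp (lam * t) * \<phi> x * integ \<nu> f)"
    "\<And>\<epsilon>. 0 < \<epsilon> \<Longrightarrow> \<exists>t>0. h t \<le> \<epsilon>"
    by (rule mean_rate) blast
  obtain s where s: "0 < s" "h s \<le> e / (8 * (m + 1))"
    using h(3)[of "e / (8 * (m + 1))"] e m by auto
  define E where "E = exp (lam * s)"
  have E: "0 < E" by (simp add: E_def)
  define d where "d = E * min (1 / 2) (e / (8 * (m + 1)))"
  have d: "0 < d" "d \<le> E / 2" "d * (m + 1) \<le> E * (e / 8)"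
  proof -
    show "0 < d" using E e m by (simp add: d_def)
    have "d \<le> E * (1 / 2)" unfolding d_def using E by (intro mult_left_mono min.cobounded1) simp
    then show "d \<le> E / 2" by simp
    have "d * (m + 1) \<le> E * (e / (8 * (m + 1))) * (m + 1)"
      unfolding d_def using E m by (intro mult_right_mono mult_left_mono min.cobounded2) simp_all
    also have "\<dots> = E * (e / 8)"
    proof -
      have cancel: "E * (e / (8 * k)) * k = E * (e / 8)" if "0 < k" for k using that by simp
      show ?thesis by (rule cancel) (use m in simp)
    qed
    finally show "d * (m + 1) \<le> E * (e / 8)" .
  qed
  define \<delta> where "\<delta> = d / (C1 * C2)"
  have \<delta>: "0 < \<delta>" using d C1 C2 by (simp add: \<delta>_def)
  obtain \<epsilon>\<mu> where \<epsilon>\<mu>: "0 < \<epsilon>\<mu>" "\<And>\<epsilon>. 0 \<le> \<epsilon> \<Longrightarrow> \<epsilon> \<le> \<epsilon>\<mu> \<Longrightarrow> rem s \<mu> \<epsilon> \<le> \<delta> * \<epsilon>"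
    by (rule rem_small[of s \<delta> \<mu>]) (use \<delta> s in auto)
  obtain \<epsilon>\<nu> where \<epsilon>\<nu>: "0 < \<epsilon>\<nu>" "\<And>\<epsilon>. 0 \<le> \<epsilon> \<Longrightarrow> \<epsilon> \<le> \<epsilon>\<nu> \<Longrightarrow> rem s \<nu> \<epsilon> \<le> \<delta> * \<epsilon>"
    by (rule rem_small[of s \<delta> \<nu>]) (use \<delta> s in auto)
  obtain r1 where r1: "0 < r1" "\<And>r. r1 \<le> r \<Longrightarrow> w r \<le> min \<epsilon>\<mu> \<epsilon>\<nu> / C1"
    using w_small[of "min \<epsilon>\<mu> \<epsilon>\<nu> / C1"] \<epsilon>\<mu> \<epsilon>\<nu> C1 by auto
  have main: "dist (integ \<mu> (v (r + s)) / w (r + s)) (integ \<mu> \<phi>) < e"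
    if r: "r0 \<le> r" "r1 + 1 \<le> r" for r
  proof -
    define X Y Z where "X = integ \<mu> (v (r + s))" and "Y = w (r + s)" and "Z = w r"
    have r_pos: "0 < r" "1 < r" using r C2 by auto
    have Z: "0 < Z" unfolding Z_def by (rule w_pos[OF r_pos(1)])
    have Y: "0 < Y" unfolding Y_def using r_pos s by (intro w_pos) simp
    have f: "v r \<in> bp_borel" by (rule v_bp[OF r_pos(1)])
    have shift: "V s (v r) = v (r + s)" using r_pos s by (intro v_shift_fun) auto
    define \<epsilon> where "\<epsilon> = C1 * w (r - 1)"
    have w1: "0 < w (r - 1)" using r_pos by (intro w_pos) simp
    have \<epsilon>: "0 \<le> \<epsilon>" using C1 w1 by (simp add: \<epsilon>_def)
    have "w (r - 1) \<le> min \<epsilon>\<mu> \<epsilon>\<nu> / C1" using r by (intro r1) simp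
    then have "\<epsilon> \<le> min \<epsilon>\<mu> \<epsilon>\<nu>" using C1 by (simp add: \<epsilon>_def field_simps)
    then have \<epsilon>_le: "\<epsilon> \<le> \<epsilon>\<mu>" "\<epsilon> \<le> \<epsilon>\<nu>" by auto
    have "\<delta> * \<epsilon> \<le> d * Z"
    proof -
      have "\<delta> * \<epsilon> \<le> \<delta> * (C1 * (C2 * Z))"
        unfolding \<epsilon>_def Z_def using C2(3)[OF r(1)] \<delta> C1 by (intro mult_left_mono) auto
      then show ?thesis using C1 C2 by (simp add: \<delta>_def)
    qed
    then have rem_le: "rem s \<mu> \<epsilon> \<le> d * Z" "rem s \<nu> \<epsilon> \<le> d * Z"
      using \<epsilon>\<mu>(2)[OF \<epsilon> \<epsilon>_le(1)] \<epsilon>\<nu>(2)[OF \<epsilon> \<epsilon>_le(2)] by auto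
    have le: "v r x \<le> \<epsilon> * \<phi> x" for x using C1(2)[OF r_pos(2)] by (simp add: \<epsilon>_def)
    have s0: "0 \<le> s" using s by simp
    have X1: "X \<le> integ \<mu> (mean s (v r))" "integ \<mu> (mean s (v r)) - d * Z \<le> X"
      using V_le_mean_integ[OF f s0, of \<mu>] V_ge_mean[OF f s0 le \<epsilon>, of \<mu>] rem_le(1)
      by (auto simp: X_def shift)
    have Y1: "Y \<le> E * Z" "E * Z - d * Z \<le> Y"
      using V_le_mean_integ[OF f s0, of \<nu>] V_ge_mean[OF f s0 le \<epsilon>, of \<nu>] rem_le(2) \<nu>_mean[OF f s0]
      by (auto simp: Y_def Z_def shift w_def E_def)
    have mult_bdd: "(\<lambda>x. c * \<phi> x) \<in> bdd_borel" for c
    proof -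
      obtain b where "\<And>x. \<bar>\<phi> x\<bar> \<le> b" using bdd_borel_bound[OF \<phi>_bdd] by blast
      then show ?thesis
        using bdd_borel_measurable[OF \<phi>_bdd]
        by (intro bdd_borelI[of _ "\<bar>c\<bar> * b"]) (auto simp: abs_mult intro: mult_left_mono)
    qed
    have mean_bdd: "mean s (v r) \<in> bdd_borel" using mean_facts(1)[OF f s0] by simp
    have mean_x: "mean s (v r) x \<le> (1 + h s) * E * Z * \<phi> x"
      "(1 - h s) * E * Z * \<phi> x \<le> mean s (v r) x" for x
      using h(2)[OF s(1) f, of x] by (auto simp: E_def Z_def w_def algebra_simps abs_le_iff)
    have "integ \<mu> (mean s (v r)) \<le> integ \<mu> (\<lambda>x. (1 + h s) * E * Z * \<phi> x)"
      by (rule integ_mono[OF mean_bdd mult_bdd mean_x(1)])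
    moreover have "integ \<mu> (\<lambda>x. (1 - h s) * E * Z * \<phi> x) \<le> integ \<mu> (mean s (v r))"
      by (rule integ_mono[OF mult_bdd mean_bdd mean_x(2)])
    ultimately have M1: "integ \<mu> (mean s (v r)) \<le> (1 + h s) * E * Z * m"
      "(1 - h s) * E * Z * m \<le> integ \<mu> (mean s (v r))"
      by (simp_all only: integ_cmult m_def)
    define q where "q = (E * m * h s + d * (m + 1)) * Z"
    have q: "\<bar>X - m * Y\<bar> \<le> q"
    proof -
      have a: "m * Y \<le> m * (E * Z)" "m * (E * Z - d * Z) \<le> m * Y"
        using Y1 m by (auto intro: mult_left_mono)
      have "0 \<le> m * d * Z" "0 \<le> d * Z" "0 \<le> E * m * h s * Z" using m d Z E h(1)[of s] by simp_all
      then show ?thesis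
        using X1 M1 a unfolding q_def abs_le_iff by (simp add: algebra_simps)
    qed
    have "q \<le> (E * (e / 4)) * Z"
    proof -
      have "m * h s \<le> (m + 1) * (e / (8 * (m + 1)))"
        using s(2) m h(1)[of s] e by (intro mult_mono) auto
      also have "\<dots> = e / 8"
      proof -
        have cancel: "k * (e / (8 * k)) = e / 8" if "0 < k" for k using that by simp
        show ?thesis by (rule cancel) (use m in simp)
      qed
      finally have "E * (m * h s) \<le> E * (e / 8)" using E by (intro mult_left_mono) auto
      then have "E * m * h s \<le> E * (e / 8)" by (simp only: mult.assoc)
      moreover have "E * (e / 4) = E * (e / 8) + E * (e / 8)" by simp
      ultimately have "E * m * h s + d * (m + 1) \<le> E * (e / 4)" using d(3) by linarith
      then show ?thesis unfolding q_def using Z by (intro mult_right_mono) auto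
    qed
    also have "\<dots> = (e / 2) * (E / 2 * Z)" by simp
    also have "\<dots> \<le> (e / 2) * Y"
    proof -
      have "d * Z \<le> E / 2 * Z" using d Z by (intro mult_right_mono) auto
      with Y1(2) have "E / 2 * Z \<le> Y" by linarith
      then show ?thesis using e by (intro mult_left_mono) auto
    qed
    finally have "\<bar>X - m * Y\<bar> \<le> (e / 2) * Y" using q by linarith
    then have "\<bar>X / Y - m\<bar> \<le> e / 2"
      using Y by (simp add: abs_le_iff field_simps)
    then show ?thesis using e by (simp add: dist_real_def X_def Y_def m_def)
  qed
  show "eventually (\<lambda>r. dist (integ \<mu> (v r) / w r) (integ \<mu> \<phi>) < e) at_top"
    unfolding eventually_at_top_linorder
  proof (intro exI allI impI)
    fix r assume "max r0 (r1 + 1) + s \<le> r"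
    then show "dist (integ \<mu> (v r) / w r) (integ \<mu> \<phi>) < e"
      using main[of "r - s"] by simp
  qed
qed

lemma survival_dominated:
  obtains C r0 where "0 \<le> C" "0 < r0" "\<And>r \<mu>. r0 \<le> r \<Longrightarrow> (1 - ext r \<mu>) / w r \<le> C * integ \<mu> \<phi>"
proof -
  obtain C1 where C1: "0 < C1" "\<And>r x. 1 < r \<Longrightarrow> v r x \<le> C1 * w (r - 1) * \<phi> x"
    by (rule v_le_\<phi>) blast
  obtain C2 r0 where C2: "0 < C2" "1 < r0" "\<And>r. r0 \<le> r \<Longrightarrow> w (r - 1) \<le> C2 * w r"
    by (rule w_ratio) blast
  show thesis
  proof (rule that[of "C1 * C2" r0])
    fix r \<mu> assume r: "r0 \<le> r"
    have W: "0 < w r" "0 < w (r - 1)" using r C2 by (auto intro!: w_pos)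
    have f: "v r \<in> bp_borel" using r C2 by (intro v_bp) simp
    have \<phi>0: "0 \<le> integ \<mu> \<phi>" using \<phi>_bp by (intro integ_nonneg) simp
    have "1 - ext r \<mu> \<le> integ \<mu> (v r)"
      using v_facts(2)[of r \<mu>] exp_ge_add_one_self[of "- integ \<mu> (v r)"] r C2 by simp
    also have "\<dots> \<le> integ \<mu> (\<lambda>x. C1 * w (r - 1) * \<phi> x)"
      using f C1 W r C2 cmult_bp_borel[OF \<phi>_bp, of "C1 * w (r - 1)"] by (intro integ_mono) auto
    also have "\<dots> = C1 * w (r - 1) * integ \<mu> \<phi>" by (rule integ_cmult)
    also have "\<dots> \<le> C1 * (C2 * w r) * integ \<mu> \<phi>"
      using C2(3)[OF r] C1 \<phi>0 by (intro mult_right_mono mult_left_mono) auto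
    finally show "(1 - ext r \<mu>) / w r \<le> C1 * C2 * integ \<mu> \<phi>"
      using W by (simp add: divide_le_eq ac_simps)
  qed (use C1 C2 in auto)
qed

lemma survival_asymptotics: "((\<lambda>r. (1 - ext r \<mu>) / w r) \<longlongrightarrow> integ \<mu> \<phi>) at_top"
proof -
  define y where "y r = integ \<mu> (v r)" for r
  have y_lim: "((\<lambda>r. y r / w r) \<longlongrightarrow> integ \<mu> \<phi>) at_top"
    unfolding y_def by (rule v_asymptotics)
  have "((\<lambda>r. (y r / w r) * (y r / w r) * w r) \<longlongrightarrow> integ \<mu> \<phi> * integ \<mu> \<phi> * 0) at_top"
    by (intro tendsto_mult y_lim w_tendsto_0)
  then have sq: "((\<lambda>r. (y r / w r) * (y r / w r) * w r) \<longlongrightarrow> 0) at_top" by simp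
  have bounds: "0 \<le> y r / w r - (1 - ext r \<mu>) / w r"
    "y r / w r - (1 - ext r \<mu>) / w r \<le> (y r / w r) * (y r / w r) * w r" if r: "0 < r" for r
  proof -
    have y0: "0 \<le> y r" unfolding y_def using v_bp[OF r] by (intro integ_nonneg) simp
    have W: "0 < w r" by (rule w_pos[OF r])
    have eq: "y r / w r - (1 - ext r \<mu>) / w r = (exp (- y r) - 1 + y r) / w r"
      by (simp add: v_facts(2)[OF r] y_def diff_divide_distrib add_divide_distrib)
    show "0 \<le> y r / w r - (1 - ext r \<mu>) / w r"
      unfolding eq using exp_remainder(1)[OF y0] W by simp
    have "(exp (- y r) - 1 + y r) / w r \<le> (y r)\<^sup>2 / w r"
      using exp_remainder(3)[OF y0] W by (intro divide_right_mono) auto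
    also have "\<dots> = (y r / w r) * (y r / w r) * w r" using W by (simp add: power2_eq_square)
    finally show "y r / w r - (1 - ext r \<mu>) / w r \<le> (y r / w r) * (y r / w r) * w r"
      unfolding eq .
  qed
  have "((\<lambda>r. y r / w r - (1 - ext r \<mu>) / w r) \<longlongrightarrow> 0) at_top"
  proof (rule tendsto_sandwich[OF _ _ tendsto_const sq])
    show "eventually (\<lambda>r. 0 \<le> y r / w r - (1 - ext r \<mu>) / w r) at_top"
      using eventually_gt_at_top[of 0] by eventually_elim (rule bounds(1))
    show "eventually (\<lambda>r. y r / w r - (1 - ext r \<mu>) / w r \<le> (y r / w r) * (y r / w r) * w r) at_top"
      using eventually_gt_at_top[of 0] by eventually_elim (rule bounds(2))
  qed
  from tendsto_diff[OF y_lim this] show ?thesis by simp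
qed

end

section \<open>The conditional laws\<close>

context subcritical_superproc
begin

lemma coordinate_measurable: "0 \<le> t \<Longrightarrow> (\<lambda>\<omega>. \<omega> t) \<in> Pr \<mu> \<rightarrow>\<^sub>M (borel :: 'e fin_measure measure)"
proof (rule measurableI)
  fix A :: "'e fin_measure set" assume t: "0 \<le> t" and A: "A \<in> sets borel"
  have "(\<lambda>\<omega>. \<omega> t) -` A \<inter> space (Pr \<mu>) = {\<omega> \<in> space path_space. \<omega> t \<in> A}"
    by (auto simp: space_Pr)
  then show "(\<lambda>\<omega>. \<omega> t) -` A \<inter> space (Pr \<mu>) \<in> sets (Pr \<mu>)"
    using coordinate_event[OF t A] by (simp add: sets_Pr)
qed simp

lemma distr_coordinate:
  assumes t: "0 \<le> t"
  shows "distr (Pr \<mu>) borel (\<lambda>\<omega>. \<omega> t) = Q t \<mu>"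
proof (rule measure_eqI)
  fix A assume "A \<in> sets (distr (Pr \<mu>) borel (\<lambda>\<omega>. \<omega> t))"
  then have A: "A \<in> sets borel" by simp
  have "(\<lambda>\<omega>. \<omega> t) -` A \<inter> space (Pr \<mu>) = {\<omega> \<in> space path_space. \<omega> t \<in> A}"
    by (auto simp: space_Pr)
  then show "emeasure (distr (Pr \<mu>) borel (\<lambda>\<omega>. \<omega> t)) A = emeasure (Q t \<mu>) A"
    by (simp add: emeasure_distr[OF coordinate_measurable[OF t] A] Q_eq_Pr[OF t A])
qed (simp add: sets_Q[OF t])

lemma ext_measurable:
  assumes "0 \<le> r"
  shows "ext r \<in> borel_measurable borel"
proof -
  have "(\<lambda>\<mu>. emeasure (Q r \<mu>) {0}) \<in> borel_measurable borel"
    by (rule measurable_compose[OF Q_kernel[OF assms]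
          measurable_emeasure_subprob_algebra[OF sets_singleton_zero]])
  then show ?thesis unfolding ext_def[abs_def] measure_def by measurable
qed

lemma ext_le_1: "0 \<le> r \<Longrightarrow> ext r \<mu> \<le> 1"
  unfolding ext_def using prob_space.prob_le_1[OF prob_Q] .

lemma emeasure_Q_survival:
  assumes r: "0 \<le> r"
  shows "emeasure (Q r \<mu>) (- {0}) = ennreal (1 - ext r \<mu>)"
proof -
  interpret prob_space "Q r \<mu>" by (rule prob_Q[OF r])
  have "prob (space (Q r \<mu>) - {0}) = 1 - prob {0}"
    by (rule prob_compl) (simp add: sets_Q[OF r] sets_singleton_zero)
  moreover have "space (Q r \<mu>) - {0} = - {0}" using space_Q[OF r] by auto
  ultimately show ?thesis by (simp add: emeasure_eq_measure ext_def)
qed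

lemma survival_event:
  assumes t: "0 \<le> t" and r: "0 \<le> r" and A: "A \<in> sets borel"
  shows "emeasure (Pr \<mu>) {\<omega> \<in> space path_space. \<omega> t \<in> A \<and> \<omega> (t + r) \<noteq> 0}
    = (\<integral>\<^sup>+\<eta>. ennreal (1 - ext r \<eta>) * indicator A \<eta> \<partial>Q t \<mu>)"
proof -
  have "emeasure (Pr \<mu>) {\<omega> \<in> space path_space. \<omega> t \<in> A \<and> \<omega> (t + r) \<in> - {0}}
      = (\<integral>\<^sup>+\<omega>. emeasure (Q r (\<omega> t)) (- {0}) * indicator {\<omega> \<in> space path_space. \<omega> t \<in> A} \<omega> \<partial>Pr \<mu>)"
  proof (rule Pr_markov[OF t r A])
    show "- {0} \<in> sets (borel :: 'e fin_measure measure)"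
      using sets.compl_sets[OF sets_singleton_zero] by (simp add: Compl_eq_Diff_UNIV)
  qed
  also have "\<dots> = (\<integral>\<^sup>+\<omega>. ennreal (1 - ext r (\<omega> t)) * indicator A (\<omega> t) \<partial>Pr \<mu>)"
    by (intro nn_integral_cong) (auto simp: emeasure_Q_survival[OF r] space_Pr split: split_indicator)
  also have "\<dots> = (\<integral>\<^sup>+\<eta>. ennreal (1 - ext r \<eta>) * indicator A \<eta> \<partial>distr (Pr \<mu>) borel (\<lambda>\<omega>. \<omega> t))"
    using ext_measurable[OF r] A
    by (intro nn_integral_distr[OF coordinate_measurable[OF t], symmetric]) simp
  finally show ?thesis by (simp add: distr_coordinate[OF t])
qed

lemma ext_markov:
  assumes t: "0 \<le> t" and r: "0 \<le> r"
  shows "1 - ext (t + r) \<mu> = (\<integral>\<eta>. 1 - ext r \<eta> \<partial>Q t \<mu>)"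
proof -
  interpret prob_space "Q t \<mu>" by (rule prob_Q[OF t])
  have "ext (t + r) \<mu> = (\<integral>\<eta>. ext r \<eta> \<partial>Q t \<mu>)"
    unfolding ext_def Q_semigroup[OF t r]
    by (rule measure_bind[where N = borel])
      (use Q_kernel[OF r] in \<open>simp_all add: measurable_Q_cong[OF t] sets_singleton_zero\<close>)
  moreover have "integrable (Q t \<mu>) (ext r)"
    using ext_measurable[OF r] ext_nonneg ext_le_1[OF r]
    by (intro integrable_const_bound[of _ 1]) (auto simp: measurable_Q_cong[OF t])
  ultimately show ?thesis using prob_space by simp
qed

lemma cond_law_eq_density:
  assumes t: "0 \<le> t" and r: "0 \<le> r" and pos: "ext (t + r) \<mu> < 1"
  shows "cond_law Pr \<mu> t r = density (Q t \<mu>) (\<lambda>\<eta>. ennreal ((1 - ext r \<eta>) / (1 - ext (t + r) \<mu>)))"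
proof (rule measure_eqI)
  show "sets (cond_law Pr \<mu> t r) = sets (density (Q t \<mu>) (\<lambda>\<eta>. ennreal ((1 - ext r \<eta>) / (1 - ext (t + r) \<mu>))))"
    by (simp add: cond_law_def sets_Q[OF t])
  fix A assume "A \<in> sets (cond_law Pr \<mu> t r)"
  then have A: "A \<in> sets borel" by (simp add: cond_law_def)
  then have A_Q: "A \<in> sets (Q t \<mu>)" by (simp add: sets_Q[OF t])
  then have ind_m: "(indicator A :: 'e fin_measure \<Rightarrow> ennreal) \<in> borel_measurable (Q t \<mu>)"
    by (rule borel_measurable_indicator)
  define S where "S = {\<omega> \<in> space (Pr \<mu>). \<omega> (t + r) \<noteq> 0}"
  define p where "p = 1 - ext (t + r) \<mu>"
  have p: "0 < p" using pos by (simp add: p_def)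
  have tr: "0 \<le> t + r" using t r by simp
  have S_eq: "S = {\<omega> \<in> space path_space. \<omega> (t + r) \<in> - {0}}" by (auto simp: S_def space_Pr)
  have compl: "- {0} \<in> sets (borel :: 'e fin_measure measure)"
    using sets.compl_sets[OF sets_singleton_zero] by (simp add: Compl_eq_Diff_UNIV)
  have S: "S \<in> sets (Pr \<mu>)"
    unfolding S_eq sets_Pr by (rule coordinate_event[OF tr compl])
  have S_mass: "emeasure (Pr \<mu>) S = ennreal p"
    unfolding S_eq Q_eq_Pr[OF tr compl] p_def by (rule emeasure_Q_survival[OF tr])
  let ?B = "(\<lambda>\<omega>. \<omega> t) -` A \<inter> space (Pr \<mu>)"
  have B: "?B \<in> sets (Pr \<mu>)" by (rule measurable_sets[OF coordinate_measurable[OF t] A])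
  have ext_m: "ext r \<in> borel_measurable (Q t \<mu>)"
    using ext_measurable[OF r] by (simp add: measurable_Q_cong[OF t])
  have "emeasure (cond_law Pr \<mu> t r) A = emeasure (uniform_measure (Pr \<mu>) S) ?B"
    unfolding cond_law_def S_def[symmetric] using coordinate_measurable[OF t] A
    by (subst emeasure_distr) auto
  also have "\<dots> = emeasure (Pr \<mu>) (S \<inter> ?B) / ennreal p"
    using S B by (simp add: S_mass)
  also have "S \<inter> ?B = {\<omega> \<in> space path_space. \<omega> t \<in> A \<and> \<omega> (t + r) \<noteq> 0}"
    by (auto simp: S_def space_Pr)
  also have "emeasure (Pr \<mu>) \<dots> / ennreal p
      = (\<integral>\<^sup>+\<eta>. ennreal (1 - ext r \<eta>) * indicator A \<eta> \<partial>Q t \<mu>) / ennreal p"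
    by (simp add: survival_event[OF t r A])
  also have "\<dots> = (\<integral>\<^sup>+\<eta>. ennreal (1 - ext r \<eta>) * indicator A \<eta> / ennreal p \<partial>Q t \<mu>)"
    using ext_m ind_m by (intro nn_integral_divide[symmetric]) simp
  also have "\<dots> = (\<integral>\<^sup>+\<eta>. ennreal ((1 - ext r \<eta>) / p) * indicator A \<eta> \<partial>Q t \<mu>)"
    using p ext_le_1[OF r]
    by (intro nn_integral_cong) (auto simp: divide_ennreal split: split_indicator)
  also have "\<dots> = emeasure (density (Q t \<mu>) (\<lambda>\<eta>. ennreal ((1 - ext r \<eta>) / p))) A"
    using ext_m A_Q by (intro emeasure_density[symmetric]) simp_all
  finally show "emeasure (cond_law Pr \<mu> t r) A
      = emeasure (density (Q t \<mu>) (\<lambda>\<eta>. ennreal ((1 - ext r \<eta>) / (1 - ext (t + r) \<mu>)))) A"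
    by (simp add: p_def)
qed

lemma integral_survival_tendsto:
  fixes f :: "'e fin_measure \<Rightarrow> real"
  assumes t: "0 \<le> t" and f: "f \<in> borel_measurable borel" "\<And>\<eta>. \<bar>f \<eta>\<bar> \<le> b"
  shows "((\<lambda>r. (\<integral>\<eta>. (1 - ext r \<eta>) * f \<eta> \<partial>Q t \<mu>) / w r)
    \<longlongrightarrow> (\<integral>\<eta>. integ \<eta> \<phi> * f \<eta> \<partial>Q t \<mu>)) at_top"
proof -
  obtain C r0 where C: "0 \<le> C" "0 < r0" "\<And>r \<mu>. r0 \<le> r \<Longrightarrow> (1 - ext r \<mu>) / w r \<le> C * integ \<mu> \<phi>"
    by (rule survival_dominated) blast
  have b: "0 \<le> b" using f(2) abs_ge_zero order_trans by blast
  note int = mean_facts(3)[OF \<phi>_bp t, of \<mu>]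
  have \<phi>_m: "(\<lambda>\<eta>. integ \<eta> \<phi>) \<in> borel_measurable borel"
    using \<phi>_bp by (intro measurable_integ) simp
  define g where "g r \<eta> = (if r0 \<le> r then (1 - ext r \<eta>) / w r * f \<eta> else 0)" for r \<eta>
  have g_meas: "g r \<in> borel_measurable borel" for r
  proof (cases "r0 \<le> r")
    case True
    then have "ext r \<in> borel_measurable borel" using C(2) by (intro ext_measurable) simp
    then show ?thesis using f(1) unfolding g_def by simp
  qed (simp add: g_def[abs_def])
  have g_lim: "((\<lambda>r. g r \<eta>) \<longlongrightarrow> integ \<eta> \<phi> * f \<eta>) at_top" for \<eta>
  proof (rule Lim_transform_eventually)
    show "((\<lambda>r. (1 - ext r \<eta>) / w r * f \<eta>) \<longlongrightarrow> integ \<eta> \<phi> * f \<eta>) at_top"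
      by (intro tendsto_mult tendsto_const survival_asymptotics)
    show "eventually (\<lambda>r. (1 - ext r \<eta>) / w r * f \<eta> = g r \<eta>) at_top"
      using eventually_ge_at_top[of r0] by eventually_elim (simp add: g_def)
  qed
  have g_bound: "\<bar>g r \<eta>\<bar> \<le> C * integ \<eta> \<phi> * b" for r \<eta>
  proof (cases "r0 \<le> r")
    case True
    then have r: "0 < r" using C(2) by simp
    have "0 \<le> (1 - ext r \<eta>) / w r" using ext_le_1[of r \<eta>] r w_pos[OF r] by simp
    have "\<bar>g r \<eta>\<bar> = (1 - ext r \<eta>) / w r * \<bar>f \<eta>\<bar>"
      using True \<open>0 \<le> (1 - ext r \<eta>) / w r\<close> by (simp only: g_def if_True abs_mult abs_of_nonneg)
    also have "\<dots> \<le> (C * integ \<eta> \<phi>) * b"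
      using C(3)[OF True, of \<eta>] f(2)[of \<eta>] \<open>0 \<le> (1 - ext r \<eta>) / w r\<close> by (intro mult_mono) auto
    finally show ?thesis .
  next
    case False
    have "0 \<le> integ \<eta> \<phi>" using \<phi>_bp by (intro integ_nonneg) simp
    with False C(1) b show ?thesis by (simp add: g_def)
  qed
  have "((\<lambda>r. \<integral>\<eta>. g r \<eta> \<partial>Q t \<mu>) \<longlongrightarrow> (\<integral>\<eta>. integ \<eta> \<phi> * f \<eta> \<partial>Q t \<mu>)) at_top"
  proof (rule integral_dominated_convergence_at_top[where w = "\<lambda>\<eta>. C * integ \<eta> \<phi> * b"])
    show "(\<lambda>\<eta>. integ \<eta> \<phi> * f \<eta>) \<in> borel_measurable (Q t \<mu>)" "g r \<in> borel_measurable (Q t \<mu>)" for r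
      using \<phi>_m f(1) g_meas by (simp_all add: measurable_Q_cong[OF t])
    show "AE \<eta> in Q t \<mu>. ((\<lambda>r. g r \<eta>) \<longlongrightarrow> integ \<eta> \<phi> * f \<eta>) at_top" by (intro AE_I2 g_lim)
    show "eventually (\<lambda>r. AE \<eta> in Q t \<mu>. norm (g r \<eta>) \<le> C * integ \<eta> \<phi> * b) at_top"
      using g_bound by (intro always_eventually allI AE_I2) simp
  qed (use int in simp)
  then show ?thesis
  proof (rule Lim_transform_eventually)
    show "eventually (\<lambda>r. (\<integral>\<eta>. g r \<eta> \<partial>Q t \<mu>) = (\<integral>\<eta>. (1 - ext r \<eta>) * f \<eta> \<partial>Q t \<mu>) / w r) at_top"
      using eventually_ge_at_top[of r0]
    proof eventually_elim
      case (elim r)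
      then have "g r \<eta> = (1 - ext r \<eta>) * f \<eta> / w r" for \<eta> by (simp add: g_def)
      then show ?case by simp
    qed
  qed
qed

text \<open>The limit is the \<open>h\<close>-transform of the law of \<open>X\<^sub>t\<close> by \<open>\<eta> \<mapsto> \<eta>(\<phi>)\<close>.\<close>

proposition cond_law_converges:
  assumes \<mu>: "\<mu> \<noteq> 0" and t: "0 \<le> t"
  defines "L \<equiv> density (Q t \<mu>) (\<lambda>\<eta>. ennreal (integ \<eta> \<phi> / (exp (lam * t) * integ \<mu> \<phi>)))"
  shows "prob_space L" "sets L = sets borel" "strongly_converges (cond_law Pr \<mu> t) L at_top"
proof -
  define c where "c = exp (lam * t) * integ \<mu> \<phi>"
  have c: "0 < c" unfolding c_def using integ_pos[OF \<mu> \<phi>_bdd \<phi>_pos] by simp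
  interpret N: prob_space "Q t \<mu>" by (rule prob_Q[OF t])
  note int = mean_facts(3)[OF \<phi>_bp t, of \<mu>]
  have mass: "(\<integral>\<eta>. integ \<eta> \<phi> \<partial>Q t \<mu>) = c"
    using mean_facts(4)[OF \<phi>_bp t, of \<mu>] mean_\<phi>[OF t] by (simp add: c_def integ_cmult[symmetric] integ_def)
  have \<phi>_m: "(\<lambda>\<eta>. integ \<eta> \<phi>) \<in> borel_measurable (Q t \<mu>)" using int by auto
  have \<phi>0: "0 \<le> integ \<eta> \<phi>" for \<eta> using \<phi>_bp by (intro integ_nonneg) simp
  have L: "L = density (Q t \<mu>) (\<lambda>\<eta>. ennreal (integ \<eta> \<phi> / c))" by (simp add: L_def c_def)
  show "sets L = sets borel" by (simp add: L sets_Q[OF t])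
  show "prob_space L"
  proof (rule prob_spaceI)
    have "emeasure L (space L) = (\<integral>\<^sup>+\<eta>. ennreal (integ \<eta> \<phi> / c) \<partial>Q t \<mu>)"
      unfolding L using \<phi>_m by (subst emeasure_density) (auto intro!: nn_integral_cong)
    also have "\<dots> = ennreal (\<integral>\<eta>. integ \<eta> \<phi> / c \<partial>Q t \<mu>)"
      using int \<phi>0 c by (intro nn_integral_eq_integral) auto
    also have "\<dots> = 1" using mass c by simp
    finally show "emeasure L (space L) = 1" .
  qed
  show "strongly_converges (cond_law Pr \<mu> t) L at_top"
    unfolding strongly_converges_def
  proof (intro allI impI)
    fix f :: "'e fin_measure \<Rightarrow> real"
    assume f: "f \<in> borel_measurable L \<and> bounded (f ` space L)"
    have f_m: "f \<in> borel_measurable borel"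
      using f by (simp add: L measurable_Q_cong[OF t])
    obtain b where b: "\<And>\<eta>. \<bar>f \<eta>\<bar> \<le> b"
      using f by (auto simp: L space_Q[OF t] bounded_iff)
    have fQ: "f \<in> borel_measurable (Q t \<mu>)" using f_m by (simp add: measurable_Q_cong[OF t])
    have lim1: "((\<lambda>r. (\<integral>\<eta>. (1 - ext r \<eta>) * f \<eta> \<partial>Q t \<mu>) / w r)
        \<longlongrightarrow> (\<integral>\<eta>. integ \<eta> \<phi> * f \<eta> \<partial>Q t \<mu>)) at_top"
      by (rule integral_survival_tendsto[OF t f_m b])
    have "((\<lambda>r. (\<integral>\<eta>. (1 - ext r \<eta>) * 1 \<partial>Q t \<mu>) / w r) \<longlongrightarrow> (\<integral>\<eta>. integ \<eta> \<phi> * 1 \<partial>Q t \<mu>)) at_top"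
      by (rule integral_survival_tendsto[OF t, of "\<lambda>_. 1" 1]) auto
    then have lim2: "((\<lambda>r. (\<integral>\<eta>. 1 - ext r \<eta> \<partial>Q t \<mu>) / w r) \<longlongrightarrow> c) at_top"
      by (simp add: mass)
    have "((\<lambda>r. ((\<integral>\<eta>. (1 - ext r \<eta>) * f \<eta> \<partial>Q t \<mu>) / w r) / ((\<integral>\<eta>. 1 - ext r \<eta> \<partial>Q t \<mu>) / w r))
        \<longlongrightarrow> (\<integral>\<eta>. integ \<eta> \<phi> * f \<eta> \<partial>Q t \<mu>) / c) at_top"
      using c by (intro tendsto_divide lim1 lim2) simp
    moreover have "eventually (\<lambda>r. ((\<integral>\<eta>. (1 - ext r \<eta>) * f \<eta> \<partial>Q t \<mu>) / w r)
        / ((\<integral>\<eta>. 1 - ext r \<eta> \<partial>Q t \<mu>) / w r) = (\<integral>\<eta>. f \<eta> \<partial>cond_law Pr \<mu> t r)) at_top"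
      using order_tendstoD(1)[OF lim2 c] eventually_gt_at_top[of 0]
    proof eventually_elim
      case (elim r)
      have r: "0 \<le> r" and W: "0 < w r" using elim(2) w_pos by auto
      define p where "p = 1 - ext (t + r) \<mu>"
      have p_eq: "(\<integral>\<eta>. 1 - ext r \<eta> \<partial>Q t \<mu>) = p" unfolding p_def by (rule ext_markov[OF t r, symmetric])
      have p: "0 < p" using elim(1) W by (simp add: p_eq zero_less_divide_iff)
      have ext_m: "ext r \<in> borel_measurable (Q t \<mu>)"
        using ext_measurable[OF r] by (simp add: measurable_Q_cong[OF t])
      have "(\<integral>\<eta>. f \<eta> \<partial>cond_law Pr \<mu> t r) = (\<integral>\<eta>. f \<eta> \<partial>density (Q t \<mu>) (\<lambda>\<eta>. ennreal ((1 - ext r \<eta>) / p)))"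
        using cond_law_eq_density[OF t r, of \<mu>] p by (simp add: p_def)
      also have "\<dots> = (\<integral>\<eta>. (1 - ext r \<eta>) / p * f \<eta> \<partial>Q t \<mu>)"
        using ext_m fQ p ext_le_1[OF r] by (subst integral_density) auto
      also have "\<dots> = (\<integral>\<eta>. (1 - ext r \<eta>) * f \<eta> \<partial>Q t \<mu>) / p" by simp
      finally show ?case using W by (simp add: p_eq)
    qed
    ultimately have "((\<lambda>r. \<integral>\<eta>. f \<eta> \<partial>cond_law Pr \<mu> t r)
        \<longlongrightarrow> (\<integral>\<eta>. integ \<eta> \<phi> * f \<eta> \<partial>Q t \<mu>) / c) at_top"
      by (rule Lim_transform_eventually)
    moreover have "(\<integral>\<eta>. f \<eta> \<partial>L) = (\<integral>\<eta>. integ \<eta> \<phi> * f \<eta> \<partial>Q t \<mu>) / c"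
    proof -
      have "(\<integral>\<eta>. f \<eta> \<partial>L) = (\<integral>\<eta>. integ \<eta> \<phi> / c * f \<eta> \<partial>Q t \<mu>)"
        unfolding L using \<phi>_m fQ \<phi>0 c by (subst integral_density) auto
      then show ?thesis by simp
    qed
    ultimately show "((\<lambda>r. \<integral>\<eta>. f \<eta> \<partial>cond_law Pr \<mu> t r) \<longlongrightarrow> (\<integral>\<eta>. f \<eta> \<partial>L)) at_top" by simp
  qed
qed

end

theorem theorem1p2:
  fixes W :: "'w measure"
    and \<xi> :: "real \<Rightarrow> 'w \<Rightarrow> 'e::polish_space"
    and \<zeta> :: "'w \<Rightarrow> ereal"
    and Law :: "'e \<Rightarrow> 'w measure"
    and P :: "real \<Rightarrow> 'e \<Rightarrow> 'e measure"
    and \<beta> \<sigma> :: "'e \<Rightarrow> real"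
    and \<pi> :: "'e \<Rightarrow> real measure"
    and V :: "real \<Rightarrow> ('e \<Rightarrow> real) \<Rightarrow> 'e \<Rightarrow> real"
    and Q :: "real \<Rightarrow> 'e fin_measure \<Rightarrow> 'e fin_measure measure"
    and Pr :: "'e fin_measure \<Rightarrow> (real \<Rightarrow> 'e fin_measure) measure"
    and lam :: real
    and \<phi> :: "'e \<Rightarrow> real"
    and \<nu> :: "'e fin_measure"
  assumes motion: "borel_right_process W \<xi> \<zeta> Law P"
    and branching: "branching_data \<beta> \<sigma> \<pi>"
    and cumulant: "cumulant_semigroup P (branching_mechanism \<beta> \<sigma> \<pi>) V"
    and super: "superprocess V Q Pr"
    and eigen: "principal_eigen (mean_semigroup \<xi> \<zeta> Law \<beta>) lam \<phi> \<nu>"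
    and asymp: "uniform_mean_asymptotics (mean_semigroup \<xi> \<zeta> Law \<beta>) lam \<phi> \<nu>"
    and subcritical: "lam < 0"
    and extinction: "\<forall>t>0. \<P>(\<omega> in Pr \<nu>. \<omega> t = 0) > 0"
  shows "\<forall>\<mu> t. \<mu> \<noteq> 0 \<and> 0 \<le> t \<longrightarrow>
    (\<exists>Qinf :: 'e fin_measure measure.
       prob_space Qinf \<and> sets Qinf = sets borel \<and>
       strongly_converges (cond_law Pr \<mu> t) Qinf at_top)"
proof -
  interpret subcritical_superproc W \<xi> \<zeta> Law P \<beta> \<sigma> \<pi> V Q Pr lam \<phi> \<nu>
    by unfold_locales (fact motion branching cumulant super eigen asymp subcritical extinction)+
  show ?thesis using cond_law_converges by blast
qed

end
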